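(* Let $k$ be a field, $V$ a $k$-vector space, $s\ge 2$ an integer, $R\subseteq V^{\otimes s}$ a subspace, and $A=T(V)/(R)$ the associated $s$-homogeneous algebra. Let $J_n\subseteq V^{\otimes n}$, the graded bimodules $\overline{K}_{L-R,n}=A\otimes J_n\otimes A$, and the bimodule maps $\delta'_L,\delta'_R:\overline{K}_{L-R,n}\to\overline{K}_{L-R,n-1}$ be as defined in the context. Then: (1) $(\delta'_L)^s=0$ and $(\delta'_R)^s=0$, i.e. $\overline{K}_{L-R}$ is an $s$-complex of bimodules for $\delta'_L$ and also for $\delta'_R$; (2) $\delta'_L\,\delta'_R=\delta'_R\,\delta'_L$; (3) let $n(2j)=js$ and $n(2j+1)=js+1$ for $j\ge 0$, let $K_{L-R,i}=A\otimes J_{n(i)}\otimes A$ for $i\ge 0$, and define $d'_i:K_{L-R,i}\to K_{L-R,i-1}$ for $i\ge 1$ by $$d'_i=\delta'_L-\delta'_R\quad\text{if } i \text{ is odd},$$ $$d'_i=(\delta'_L)^{s-1}+(\delta'_L)^{s-2}\delta'_R+\cdots+\delta'_L(\delta'_R)^{s-2}+(\delta'_R)^{s-1}\quad\text{if } i \text{ is even}.$$ Then $(K_{L-R},d')$ is a pure projective complex of graded $A$-$A$-bimodules; that is, $d'_i\circ d'_{i+1}=0$ for all $i\ge 1$, the maps $d'_i$ are homogeneous of degree $0$ for the total grading, and each $K_{L-R,i}$ is a projective graded $A$-$A$-bimodule generated in the single degree $n(i)$.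
   Context: All tensor products are over the field $k$. $T(V)$ is the tensor algebra of $V$, $(R)$ is the two-sided ideal generated by $R$, and $A=T(V)/(R)$ is graded by $\deg V=1$. For $n\ge 0$, the subspace $J_n\subseteq V^{\otimes n}$ is defined by $J_n=V^{\otimes n}$ if $n<s$, and $$J_n=\bigcap_{i+s+j=n}V^{\otimes i}\otimes R\otimes V^{\otimes j}\quad\text{if } n\ge s,$$ where $i,j\ge 0$. For every $n\ge 1$ one has $J_n\subseteq V\otimes J_{n-1}$ and $J_n\subseteq J_{n-1}\otimes V$. Elements of $J_n$ are homogeneous of degree $n$, and $A\otimes J_n\otimes A$ carries the total grading and the outer $A$-$A$-bimodule structure. Put $\overline{K}_{L,n}=A\otimes J_n$ and let $\delta_L:\overline{K}_{L,n}\to\overline{K}_{L,n-1}$ ($n\ge1$) be the left $A$-linear map induced by the natural inclusion $J_n\hookrightarrow V\otimes J_{n-1}\to A\otimes J_{n-1}$; explicitly it is the restriction to $A\otimes J_n$ of $a\otimes v_1v_2\cdots v_n\mapsto av_1\otimes v_2\cdots v_n$. Analogously, put $\overline{K}_{R,n}=J_n\otimes A$ and let $\delta_R:\overline{K}_{R,n}\to\overline{K}_{R,n-1}$ be the right $A$-linear map given by restriction of $v_1\cdots v_{n-1}v_n\otimes a\mapsto v_1\cdots v_{n-1}\otimes v_na$. Put $\overline{K}_{L-R,n}=A\otimes J_n\otimes A$, so that $\overline{K}_{L-R}=\overline{K}_L\otimes A=A\otimes\overline{K}_R$, and let $\delta'_L=\delta_L\otimes 1_A$, $\delta'_R=1_A\otimes\delta_R$.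 By convention $\delta'_L$ and $\delta'_R$ vanish on $\overline{K}_{L-R,0}$ (terms of negative index are zero). An $s$-complex is a sequence of objects with a map $\delta$ lowering the index by $1$ such that $\delta^s=0$. Powers and products such as $(\delta'_L)^a(\delta'_R)^b$ denote compositions, mapping $\overline{K}_{L-R,n}$ to $\overline{K}_{L-R,n-a-b}$. In particular, for $i$ odd $d'_i$ lowers the index $n$ by $1$, and for $i$ even it lowers it by $s-1$. A complex of graded bimodules is called pure if each of its terms is generated in a single degree. *)

theory Defs
  imports "HOL-Algebra.Module" "HOL-Algebra.QuotRing"
begin

section \<open>Linear algebra over a field\<close>

text \<open>
  Vector spaces over \<open>K\<close> are modules in the sense of the locale \<^locale>\<open>module\<close>; for a bare vector
  space the multiplicative fields of the record are irrelevant. An algebra is a record of the same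
  type whose multiplicative fields do matter.
\<close>

definition lspan :: "'k ring \<Rightarrow> ('k, 'm, 'z) module_scheme \<Rightarrow> 'm set \<Rightarrow> 'm set" where
  "lspan K M S = \<Inter>{H. submodule H K M \<and> S \<subseteq> H}"

definition linear_maps ::
  "'k ring \<Rightarrow> ('k, 'm, 'y) module_scheme \<Rightarrow> ('k, 'n, 'z) module_scheme \<Rightarrow> ('m \<Rightarrow> 'n) set" where
  "linear_maps K M N = {f \<in> carrier M \<rightarrow>\<^sub>E carrier N.
     (\<forall>x\<in>carrier M. \<forall>y\<in>carrier M. f (x \<oplus>\<^bsub>M\<^esub> y) = f x \<oplus>\<^bsub>N\<^esub> f y) \<and>
     (\<forall>c\<in>carrier K. \<forall>x\<in>carrier M. f (c \<odot>\<^bsub>M\<^esub> x) = c \<odot>\<^bsub>N\<^esub> f x)}"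

text \<open>
  The quotient of a module by a submodule, or of an algebra by a two-sided ideal. It is the
  library's \<^const>\<open>FactRing\<close> with the induced scalar multiplication; for a bare module its
  multiplicative fields are irrelevant.
\<close>

definition quot :: "('k, 'm) module \<Rightarrow> 'm set \<Rightarrow> ('k, 'm set) module" where
  "quot M N = ring.extend (M Quot N)
     (module.fields (\<lambda>c S. \<Union>x\<in>S. N +>\<^bsub>M\<^esub> (c \<odot>\<^bsub>M\<^esub> x)))"

definition free_module :: "'k ring \<Rightarrow> 'x set \<Rightarrow> ('k, 'x \<Rightarrow> 'k) module" where
  "free_module K S =
     \<lparr>carrier = {f. range f \<subseteq> carrier K \<and> finite {x. f x \<noteq> \<zero>\<^bsub>K\<^esub>} \<and> {x. f x \<noteq> \<zero>\<^bsub>K\<^esub>} \<subseteq> S},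
      mult = undefined, one = undefined,
      zero = (\<lambda>x. \<zero>\<^bsub>K\<^esub>),
      add = (\<lambda>f g x. f x \<oplus>\<^bsub>K\<^esub> g x),
      smult = (\<lambda>c f x. c \<otimes>\<^bsub>K\<^esub> f x)\<rparr>"

definition basis_vec :: "'k ring \<Rightarrow> 'x \<Rightarrow> 'x \<Rightarrow> 'k" where
  "basis_vec K x = (\<lambda>y. if y = x then \<one>\<^bsub>K\<^esub> else \<zero>\<^bsub>K\<^esub>)"

section \<open>Tensor products\<close>

definition tensor_rels ::
  "'k ring \<Rightarrow> ('k, 'm) module \<Rightarrow> ('k, 'n) module \<Rightarrow> ('m \<times> 'n \<Rightarrow> 'k) set" where
  "tensor_rels K M N = (let F = free_module K (carrier M \<times> carrier N); e = basis_vec K in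
     lspan K F (
       {e (x \<oplus>\<^bsub>M\<^esub> x', y) \<ominus>\<^bsub>F\<^esub> (e (x, y) \<oplus>\<^bsub>F\<^esub> e (x', y)) | x x' y.
          x \<in> carrier M \<and> x' \<in> carrier M \<and> y \<in> carrier N} \<union>
       {e (x, y \<oplus>\<^bsub>N\<^esub> y') \<ominus>\<^bsub>F\<^esub> (e (x, y) \<oplus>\<^bsub>F\<^esub> e (x, y')) | x y y'.
          x \<in> carrier M \<and> y \<in> carrier N \<and> y' \<in> carrier N} \<union>
       {e (c \<odot>\<^bsub>M\<^esub> x, y) \<ominus>\<^bsub>F\<^esub> (c \<odot>\<^bsub>F\<^esub> e (x, y)) | c x y.
          c \<in> carrier K \<and> x \<in> carrier M \<and> y \<in> carrier N} \<union>
       {e (x, c \<odot>\<^bsub>N\<^esub> y) \<ominus>\<^bsub>F\<^esub> (c \<odot>\<^bsub>F\<^esub> e (x, y)) | c x y.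
          c \<in> carrier K \<and> x \<in> carrier M \<and> y \<in> carrier N}))"

definition tensor ::
  "'k ring \<Rightarrow> ('k, 'm) module \<Rightarrow> ('k, 'n) module \<Rightarrow> ('k, ('m \<times> 'n \<Rightarrow> 'k) set) module" where
  "tensor K M N = quot (free_module K (carrier M \<times> carrier N)) (tensor_rels K M N)"

definition tens ::
  "'k ring \<Rightarrow> ('k, 'm) module \<Rightarrow> ('k, 'n) module \<Rightarrow> 'm \<Rightarrow> 'n \<Rightarrow> ('m \<times> 'n \<Rightarrow> 'k) set" where
  "tens K M N x y =
     tensor_rels K M N +>\<^bsub>free_module K (carrier M \<times> carrier N)\<^esub> basis_vec K (x, y)"

text \<open>
  Linear maps out of a tensor product are specified by their values on pure tensors. Uniqueness in
  the definite descriptions below comes from the fact that elements of \<^const>\<open>linear_maps\<close> are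
  extensional and pure tensors span.
\<close>

definition tensor_map ::
  "'k ring \<Rightarrow> ('k, 'm) module \<Rightarrow> ('k, 'n) module \<Rightarrow> ('k, 'p) module \<Rightarrow> ('k, 'q) module \<Rightarrow>
   ('m \<Rightarrow> 'p) \<Rightarrow> ('n \<Rightarrow> 'q) \<Rightarrow> ('m \<times> 'n \<Rightarrow> 'k) set \<Rightarrow> ('p \<times> 'q \<Rightarrow> 'k) set" where
  "tensor_map K M N P Q f g = (THE h. h \<in> linear_maps K (tensor K M N) (tensor K P Q) \<and>
     (\<forall>x\<in>carrier M. \<forall>y\<in>carrier N. h (tens K M N x y) = tens K P Q (f x) (g y)))"

definition tensor_assoc ::
  "'k ring \<Rightarrow> ('k, 'm) module \<Rightarrow> ('k, 'n) module \<Rightarrow> ('k, 'p) module \<Rightarrow>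
   (('m \<times> 'n \<Rightarrow> 'k) set \<times> 'p \<Rightarrow> 'k) set \<Rightarrow> ('m \<times> ('n \<times> 'p \<Rightarrow> 'k) set \<Rightarrow> 'k) set" where
  "tensor_assoc K M N P = (THE h.
     h \<in> linear_maps K (tensor K (tensor K M N) P) (tensor K M (tensor K N P)) \<and>
     (\<forall>x\<in>carrier M. \<forall>y\<in>carrier N. \<forall>z\<in>carrier P.
        h (tens K (tensor K M N) P (tens K M N x y) z) = tens K M (tensor K N P) x (tens K N P y z)))"

section \<open>The tensor algebra and its homogeneous quotients\<close>

text \<open>The free associative algebra on a set, i.e. the monoid algebra of the words over it.\<close>

definition free_algebra :: "'k ring \<Rightarrow> 'x set \<Rightarrow> ('k, 'x list \<Rightarrow> 'k) module" where
  "free_algebra K S = (free_module K (lists S))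
     \<lparr>mult := (\<lambda>f g w. \<Oplus>\<^bsub>K\<^esub>i\<in>{..length w}. f (take i w) \<otimes>\<^bsub>K\<^esub> g (drop i w)),
      one := basis_vec K []\<rparr>"

text \<open>
  \<open>T(V)\<close> is the free algebra on the set of vectors of \<open>V\<close> modulo the two-sided ideal that makes
  the inclusion of \<open>V\<close> linear.
\<close>

definition multilin_ideal :: "'k ring \<Rightarrow> ('k, 'v) module \<Rightarrow> ('v list \<Rightarrow> 'k) set" where
  "multilin_ideal K V = (let F = free_algebra K (carrier V); e = basis_vec K in
     Idl\<^bsub>F\<^esub> (
       {e [u \<oplus>\<^bsub>V\<^esub> v] \<ominus>\<^bsub>F\<^esub> (e [u] \<oplus>\<^bsub>F\<^esub> e [v]) | u v. u \<in> carrier V \<and> v \<in> carrier V} \<union>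
       {e [c \<odot>\<^bsub>V\<^esub> v] \<ominus>\<^bsub>F\<^esub> (c \<odot>\<^bsub>F\<^esub> e [v]) | c v. c \<in> carrier K \<and> v \<in> carrier V}))"

type_synonym ('k, 'v) talg = "('v list \<Rightarrow> 'k) set"

definition tensor_algebra :: "'k ring \<Rightarrow> ('k, 'v) module \<Rightarrow> ('k, ('k, 'v) talg) module" where
  "tensor_algebra K V = quot (free_algebra K (carrier V)) (multilin_ideal K V)"

text \<open>\<open>word K V [v\<^sub>1, \<dots>, v\<^sub>n]\<close> is the product \<open>v\<^sub>1 \<cdots> v\<^sub>n\<close> in \<open>T(V)\<close>.\<close>

definition word :: "'k ring \<Rightarrow> ('k, 'v) module \<Rightarrow> 'v list \<Rightarrow> ('k, 'v) talg" where
  "word K V w = multilin_ideal K V +>\<^bsub>free_algebra K (carrier V)\<^esub> basis_vec K w"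

text \<open>\<open>V\<^bsup>\<otimes>n\<^esup>\<close> as the subspace of \<open>T(V)\<close> of degree \<open>n\<close>.\<close>

definition tpow :: "'k ring \<Rightarrow> ('k, 'v) module \<Rightarrow> nat \<Rightarrow> ('k, 'v) talg set" where
  "tpow K V n = lspan K (tensor_algebra K V) {word K V w | w. w \<in> lists (carrier V) \<and> length w = n}"

text \<open>\<open>V\<^bsup>\<otimes>i\<^esup> \<otimes> R \<otimes> V\<^bsup>\<otimes>j\<^esup>\<close> for a subspace \<open>R\<close> of a tensor power.\<close>

definition shifted ::
  "'k ring \<Rightarrow> ('k, 'v) module \<Rightarrow> ('k, 'v) talg set \<Rightarrow> nat \<Rightarrow> nat \<Rightarrow> ('k, 'v) talg set" where
  "shifted K V R i j = (let T = tensor_algebra K V in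
     lspan K T {u \<otimes>\<^bsub>T\<^esub> r \<otimes>\<^bsub>T\<^esub> v | u r v. u \<in> tpow K V i \<and> r \<in> R \<and> v \<in> tpow K V j})"

definition J_space ::
  "'k ring \<Rightarrow> ('k, 'v) module \<Rightarrow> nat \<Rightarrow> ('k, 'v) talg set \<Rightarrow> nat \<Rightarrow> ('k, 'v) talg set" where
  "J_space K V s R n =
     (if n < s then tpow K V n else \<Inter>{shifted K V R i j | i j. i + s + j = n})"

type_synonym ('k, 'v) halg = "('k, 'v) talg set"

definition hom_algebra ::
  "'k ring \<Rightarrow> ('k, 'v) module \<Rightarrow> ('k, 'v) talg set \<Rightarrow> ('k, ('k, 'v) halg) module" where
  "hom_algebra K V R = (let T = tensor_algebra K V in quot T (Idl\<^bsub>T\<^esub> R))"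

definition proj ::
  "'k ring \<Rightarrow> ('k, 'v) module \<Rightarrow> ('k, 'v) talg set \<Rightarrow> ('k, 'v) talg \<Rightarrow> ('k, 'v) halg" where
  "proj K V R t = (let T = tensor_algebra K V in (Idl\<^bsub>T\<^esub> R) +>\<^bsub>T\<^esub> t)"

definition hom_algebra_deg ::
  "'k ring \<Rightarrow> ('k, 'v) module \<Rightarrow> ('k, 'v) talg set \<Rightarrow> nat \<Rightarrow> ('k, 'v) halg set" where
  "hom_algebra_deg K V R p = proj K V R ` tpow K V p"

section \<open>Graded bimodules\<close>

text \<open>Over a \<open>K\<close>-algebra, bimodules are \<open>K\<close>-symmetric: the two induced actions of \<open>K\<close> agree.\<close>

record ('k, 'a, 'm) bimod = "('k, 'm) module" +
  lact :: "'a \<Rightarrow> 'm \<Rightarrow> 'm"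
  ract :: "'m \<Rightarrow> 'a \<Rightarrow> 'm"

locale bimodule = ring A + module K M
  for K :: "'k ring" and A :: "('k, 'a) module" and M :: "('k, 'a, 'm) bimod" +
  assumes lact_closed: "\<lbrakk>a \<in> carrier A; x \<in> carrier M\<rbrakk> \<Longrightarrow> lact M a x \<in> carrier M"
    and ract_closed: "\<lbrakk>a \<in> carrier A; x \<in> carrier M\<rbrakk> \<Longrightarrow> ract M x a \<in> carrier M"
    and lact_add_r: "\<lbrakk>a \<in> carrier A; x \<in> carrier M; y \<in> carrier M\<rbrakk>
      \<Longrightarrow> lact M a (x \<oplus>\<^bsub>M\<^esub> y) = lact M a x \<oplus>\<^bsub>M\<^esub> lact M a y"
    and lact_add_l: "\<lbrakk>a \<in> carrier A; b \<in> carrier A; x \<in> carrier M\<rbrakk>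
      \<Longrightarrow> lact M (a \<oplus>\<^bsub>A\<^esub> b) x = lact M a x \<oplus>\<^bsub>M\<^esub> lact M b x"
    and ract_add_l: "\<lbrakk>a \<in> carrier A; x \<in> carrier M; y \<in> carrier M\<rbrakk>
      \<Longrightarrow> ract M (x \<oplus>\<^bsub>M\<^esub> y) a = ract M x a \<oplus>\<^bsub>M\<^esub> ract M y a"
    and ract_add_r: "\<lbrakk>a \<in> carrier A; b \<in> carrier A; x \<in> carrier M\<rbrakk>
      \<Longrightarrow> ract M x (a \<oplus>\<^bsub>A\<^esub> b) = ract M x a \<oplus>\<^bsub>M\<^esub> ract M x b"
    and lact_mult: "\<lbrakk>a \<in> carrier A; b \<in> carrier A; x \<in> carrier M\<rbrakk>
      \<Longrightarrow> lact M (a \<otimes>\<^bsub>A\<^esub> b) x = lact M a (lact M b x)"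
    and ract_mult: "\<lbrakk>a \<in> carrier A; b \<in> carrier A; x \<in> carrier M\<rbrakk>
      \<Longrightarrow> ract M x (a \<otimes>\<^bsub>A\<^esub> b) = ract M (ract M x a) b"
    and lact_one: "x \<in> carrier M \<Longrightarrow> lact M \<one>\<^bsub>A\<^esub> x = x"
    and ract_one: "x \<in> carrier M \<Longrightarrow> ract M x \<one>\<^bsub>A\<^esub> = x"
    and lact_ract: "\<lbrakk>a \<in> carrier A; b \<in> carrier A; x \<in> carrier M\<rbrakk>
      \<Longrightarrow> ract M (lact M a x) b = lact M a (ract M x b)"
    and lact_scalar: "\<lbrakk>c \<in> carrier K; a \<in> carrier A; x \<in> carrier M\<rbrakk>
      \<Longrightarrow> lact M (c \<odot>\<^bsub>A\<^esub> a) x = c \<odot>\<^bsub>M\<^esub> lact M a x \<and> lact M a (c \<odot>\<^bsub>M\<^esub> x) = c \<odot>\<^bsub>M\<^esub> lact M a x"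
    and ract_scalar: "\<lbrakk>c \<in> carrier K; a \<in> carrier A; x \<in> carrier M\<rbrakk>
      \<Longrightarrow> ract M x (c \<odot>\<^bsub>A\<^esub> a) = c \<odot>\<^bsub>M\<^esub> ract M x a \<and> ract M (c \<odot>\<^bsub>M\<^esub> x) a = c \<odot>\<^bsub>M\<^esub> ract M x a"

definition bimod_hom ::
  "'k ring \<Rightarrow> ('k, 'a) module \<Rightarrow> ('k, 'a, 'm) bimod \<Rightarrow> ('k, 'a, 'n) bimod \<Rightarrow> ('m \<Rightarrow> 'n) set" where
  "bimod_hom K A M N = {f \<in> carrier M \<rightarrow> carrier N.
     (\<forall>x\<in>carrier M. \<forall>y\<in>carrier M. f (x \<oplus>\<^bsub>M\<^esub> y) = f x \<oplus>\<^bsub>N\<^esub> f y) \<and>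
     (\<forall>c\<in>carrier K. \<forall>x\<in>carrier M. f (c \<odot>\<^bsub>M\<^esub> x) = c \<odot>\<^bsub>N\<^esub> f x) \<and>
     (\<forall>a\<in>carrier A. \<forall>x\<in>carrier M. f (lact M a x) = lact N a (f x)) \<and>
     (\<forall>a\<in>carrier A. \<forall>x\<in>carrier M. f (ract M x a) = ract N (f x) a)}"

definition direct_sum_decomp ::
  "'k ring \<Rightarrow> ('k, 'm, 'z) module_scheme \<Rightarrow> (int \<Rightarrow> 'm set) \<Rightarrow> bool" where
  "direct_sum_decomp K M G \<longleftrightarrow> (\<forall>d. submodule (G d) K M) \<and>
     (\<forall>x\<in>carrier M. \<exists>!f. (\<forall>d. f d \<in> G d) \<and> finite {d. f d \<noteq> \<zero>\<^bsub>M\<^esub>} \<and>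
        x = (\<Oplus>\<^bsub>M\<^esub>d\<in>{d. f d \<noteq> \<zero>\<^bsub>M\<^esub>}. f d))"

text \<open>
  Here \<open>A\<close> is graded by the natural numbers with pieces \<open>Ad p\<close>, and bimodules are graded by the
  integers.
\<close>

definition graded_bimodule ::
  "'k ring \<Rightarrow> ('k, 'a) module \<Rightarrow> (nat \<Rightarrow> 'a set) \<Rightarrow> ('k, 'a, 'm) bimod \<Rightarrow> (int \<Rightarrow> 'm set) \<Rightarrow> bool" where
  "graded_bimodule K A Ad M G \<longleftrightarrow> bimodule K A M \<and> direct_sum_decomp K M G \<and>
     (\<forall>p d. \<forall>a\<in>Ad p. \<forall>x\<in>G d. lact M a x \<in> G (int p + d) \<and> ract M x a \<in> G (d + int p))"

definition degree_zero :: "('m \<Rightarrow> 'n) \<Rightarrow> (int \<Rightarrow> 'm set) \<Rightarrow> (int \<Rightarrow> 'n set) \<Rightarrow> bool" where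
  "degree_zero f G H \<longleftrightarrow> (\<forall>d. f ` G d \<subseteq> H d)"

text \<open>
  Projectivity is the lifting property against surjections between bimodules whose underlying
  types are the type arguments. Those are free type variables wherever these notions are used, so
  the test bimodules range over all types. The graded variant is projectivity in the category of
  graded bimodules and homomorphisms of degree 0.
\<close>

definition projective_bimodule ::
  "'m itself \<Rightarrow> 'n itself \<Rightarrow> 'k ring \<Rightarrow> ('k, 'a) module \<Rightarrow> ('k, 'a, 'p) bimod \<Rightarrow> bool" where
  "projective_bimodule _ _ K A P \<longleftrightarrow> bimodule K A P \<and>
     (\<forall>(M :: ('k, 'a, 'm) bimod) (N :: ('k, 'a, 'n) bimod) e g.
        bimodule K A M \<and> bimodule K A N \<and>
        e \<in> bimod_hom K A M N \<and> e ` carrier M = carrier N \<and> g \<in> bimod_hom K A P N \<longrightarrow>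
        (\<exists>h \<in> bimod_hom K A P M. \<forall>x\<in>carrier P. e (h x) = g x))"

definition graded_projective_bimodule ::
  "'m itself \<Rightarrow> 'n itself \<Rightarrow> 'k ring \<Rightarrow> ('k, 'a) module \<Rightarrow> (nat \<Rightarrow> 'a set) \<Rightarrow>
   ('k, 'a, 'p) bimod \<Rightarrow> (int \<Rightarrow> 'p set) \<Rightarrow> bool" where
  "graded_projective_bimodule _ _ K A Ad P G \<longleftrightarrow> graded_bimodule K A Ad P G \<and>
     (\<forall>(M :: ('k, 'a, 'm) bimod) GM (N :: ('k, 'a, 'n) bimod) GN e g.
        graded_bimodule K A Ad M GM \<and> graded_bimodule K A Ad N GN \<and>
        e \<in> bimod_hom K A M N \<and> degree_zero e GM GN \<and> e ` carrier M = carrier N \<and>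
        g \<in> bimod_hom K A P N \<and> degree_zero g G GN \<longrightarrow>
        (\<exists>h \<in> bimod_hom K A P M. degree_zero h G GM \<and> (\<forall>x\<in>carrier P. e (h x) = g x)))"

definition generated_in_degree ::
  "'k ring \<Rightarrow> ('k, 'a) module \<Rightarrow> ('k, 'a, 'm) bimod \<Rightarrow> (int \<Rightarrow> 'm set) \<Rightarrow> int \<Rightarrow> bool" where
  "generated_in_degree K A M G d \<longleftrightarrow>
     lspan K M {lact M a (ract M x b) | a x b. a \<in> carrier A \<and> x \<in> G d \<and> b \<in> carrier A} = carrier M"

text \<open>
  An \<open>s\<close>-complex indexed by the natural numbers, the terms of negative index being zero. All the
  differentials are given by one function on a common ambient type.
\<close>

definition s_complex_of_bimodules ::
  "'k ring \<Rightarrow> ('k, 'a) module \<Rightarrow> nat \<Rightarrow> (nat \<Rightarrow> ('k, 'a, 'm) bimod) \<Rightarrow> ('m \<Rightarrow> 'm) \<Rightarrow> bool" where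
  "s_complex_of_bimodules K A s C \<delta> \<longleftrightarrow> (\<forall>n. bimodule K A (C n)) \<and>
     (\<forall>n. \<delta> \<in> bimod_hom K A (C (Suc n)) (C n)) \<and>
     (\<forall>x\<in>carrier (C 0). \<delta> x = \<zero>\<^bsub>C 0\<^esub>) \<and>
     (\<forall>n. \<forall>x\<in>carrier (C n). (\<delta> ^^ s) x = \<zero>\<^bsub>C n\<^esub>)"

section \<open>The bimodule Koszul complex\<close>

text \<open>
  Since \<open>K\<close> is a field, \<open>A \<otimes> J\<^sub>n \<otimes> A\<close> is the subspace of \<open>A \<otimes> T(V) \<otimes> A\<close> spanned by the
  \<open>a \<otimes> x \<otimes> b\<close> with \<open>x \<in> J\<^sub>n\<close>. All the spaces below are subspaces of this ambient space, and the
  differentials are the restrictions of maps defined on it.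
\<close>

type_synonym ('k, 'v) atens = "(('k, 'v) halg \<times> ('k, 'v) talg \<Rightarrow> 'k) set"
type_synonym ('k, 'v) tensa = "(('k, 'v) talg \<times> ('k, 'v) halg \<Rightarrow> 'k) set"
type_synonym ('k, 'v) atensa = "(('k, 'v) atens \<times> ('k, 'v) halg \<Rightarrow> 'k) set"

definition AT :: "'k ring \<Rightarrow> ('k, 'v) module \<Rightarrow> ('k, 'v) talg set \<Rightarrow> ('k, ('k, 'v) atens) module" where
  "AT K V R = tensor K (hom_algebra K V R) (tensor_algebra K V)"

definition TA :: "'k ring \<Rightarrow> ('k, 'v) module \<Rightarrow> ('k, 'v) talg set \<Rightarrow> ('k, ('k, 'v) tensa) module" where
  "TA K V R = tensor K (tensor_algebra K V) (hom_algebra K V R)"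

definition ATA :: "'k ring \<Rightarrow> ('k, 'v) module \<Rightarrow> ('k, 'v) talg set \<Rightarrow> ('k, ('k, 'v) atensa) module" where
  "ATA K V R = tensor K (AT K V R) (hom_algebra K V R)"

definition pure3 ::
  "'k ring \<Rightarrow> ('k, 'v) module \<Rightarrow> ('k, 'v) talg set \<Rightarrow>
   ('k, 'v) halg \<Rightarrow> ('k, 'v) talg \<Rightarrow> ('k, 'v) halg \<Rightarrow> ('k, 'v) atensa" where
  "pure3 K V R a x b =
     tens K (AT K V R) (hom_algebra K V R) (tens K (hom_algebra K V R) (tensor_algebra K V) a x) b"

definition K_LR ::
  "'k ring \<Rightarrow> ('k, 'v) module \<Rightarrow> nat \<Rightarrow> ('k, 'v) talg set \<Rightarrow> nat \<Rightarrow>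
   ('k, ('k, 'v) halg, ('k, 'v) atensa) bimod" where
  "K_LR K V s R n = (let A = hom_algebra K V R; T = tensor_algebra K V in
     module.extend
       ((ATA K V R)\<lparr>carrier := lspan K (ATA K V R)
          {pure3 K V R a x b | a x b. a \<in> carrier A \<and> x \<in> J_space K V s R n \<and> b \<in> carrier A}\<rparr>)
       (bimod.fields
          (\<lambda>a'. tensor_map K (AT K V R) A (AT K V R) A
                  (tensor_map K A T A T (\<lambda>a. a' \<otimes>\<^bsub>A\<^esub> a) (\<lambda>t. t)) (\<lambda>b. b))
          (\<lambda>z b'. tensor_map K (AT K V R) A (AT K V R) A
                     (\<lambda>y. y) (\<lambda>b. b \<otimes>\<^bsub>A\<^esub> b') z)))"

text \<open>Total grading: the component of degree \<open>d\<close> of \<open>A \<otimes> J\<^sub>n \<otimes> A\<close>.\<close>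

definition K_LR_deg ::
  "'k ring \<Rightarrow> ('k, 'v) module \<Rightarrow> nat \<Rightarrow> ('k, 'v) talg set \<Rightarrow> nat \<Rightarrow> int \<Rightarrow> ('k, 'v) atensa set" where
  "K_LR_deg K V s R n d = lspan K (ATA K V R)
     {pure3 K V R a x b | a x b p q. a \<in> hom_algebra_deg K V R p \<and> x \<in> J_space K V s R n \<and>
        b \<in> hom_algebra_deg K V R q \<and> int (p + n + q) = d}"

definition \<delta>_L ::
  "'k ring \<Rightarrow> ('k, 'v) module \<Rightarrow> ('k, 'v) talg set \<Rightarrow> ('k, 'v) atens \<Rightarrow> ('k, 'v) atens" where
  "\<delta>_L K V R = (let A = hom_algebra K V R; T = tensor_algebra K V in
     THE h. h \<in> linear_maps K (AT K V R) (AT K V R) \<and>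
       (\<forall>a\<in>carrier A. h (tens K A T a (word K V [])) = \<zero>\<^bsub>AT K V R\<^esub>) \<and>
       (\<forall>a\<in>carrier A. \<forall>v\<in>carrier V. \<forall>w\<in>lists (carrier V).
          h (tens K A T a (word K V (v # w))) =
            tens K A T (a \<otimes>\<^bsub>A\<^esub> proj K V R (word K V [v])) (word K V w)))"

definition \<delta>_R ::
  "'k ring \<Rightarrow> ('k, 'v) module \<Rightarrow> ('k, 'v) talg set \<Rightarrow> ('k, 'v) tensa \<Rightarrow> ('k, 'v) tensa" where
  "\<delta>_R K V R = (let A = hom_algebra K V R; T = tensor_algebra K V in
     THE h. h \<in> linear_maps K (TA K V R) (TA K V R) \<and>
       (\<forall>a\<in>carrier A. h (tens K T A (word K V []) a) = \<zero>\<^bsub>TA K V R\<^esub>) \<and>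
       (\<forall>a\<in>carrier A. \<forall>v\<in>carrier V. \<forall>w\<in>lists (carrier V).
          h (tens K T A (word K V (w @ [v])) a) =
            tens K T A (word K V w) (proj K V R (word K V [v]) \<otimes>\<^bsub>A\<^esub> a)))"

definition \<delta>'_L ::
  "'k ring \<Rightarrow> ('k, 'v) module \<Rightarrow> ('k, 'v) talg set \<Rightarrow> ('k, 'v) atensa \<Rightarrow> ('k, 'v) atensa" where
  "\<delta>'_L K V R = (let A = hom_algebra K V R in
     tensor_map K (AT K V R) A (AT K V R) A (\<delta>_L K V R) (\<lambda>b. b))"

text \<open>\<open>1 \<otimes> \<delta>\<^sub>R\<close> lives on \<open>A \<otimes> (T(V) \<otimes> A)\<close> and is transported along the associativity isomorphism.\<close>

definition \<delta>'_R ::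
  "'k ring \<Rightarrow> ('k, 'v) module \<Rightarrow> ('k, 'v) talg set \<Rightarrow> ('k, 'v) atensa \<Rightarrow> ('k, 'v) atensa" where
  "\<delta>'_R K V R = (let A = hom_algebra K V R; T = tensor_algebra K V; \<alpha> = tensor_assoc K A T A in
     inv_into (carrier (ATA K V R)) \<alpha> \<circ>
     tensor_map K A (TA K V R) A (TA K V R) (\<lambda>a. a) (\<delta>_R K V R) \<circ> \<alpha>)"

definition ndeg :: "nat \<Rightarrow> nat \<Rightarrow> nat" where
  "ndeg s i = (if even i then (i div 2) * s else (i div 2) * s + 1)"

definition d' ::
  "'k ring \<Rightarrow> ('k, 'v) module \<Rightarrow> nat \<Rightarrow> ('k, 'v) talg set \<Rightarrow> nat \<Rightarrow> ('k, 'v) atensa \<Rightarrow> ('k, 'v) atensa" where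
  "d' K V s R i x =
     (if odd i then \<delta>'_L K V R x \<ominus>\<^bsub>ATA K V R\<^esub> \<delta>'_R K V R x
      else (\<Oplus>\<^bsub>ATA K V R\<^esub>j\<in>{..<s}. ((\<delta>'_L K V R) ^^ (s - 1 - j)) (((\<delta>'_R K V R) ^^ j) x)))"

end

theory Submission
  imports Defs
begin

text \<open>
  On pure tensors the two differentials move a letter from the middle factor into one of the outer
  factors: \<open>\<delta>'\<^sub>L (a \<otimes> v t \<otimes> b) = a v \<otimes> t \<otimes> b\<close> and \<open>\<delta>'\<^sub>R (a \<otimes> t v \<otimes> b) = a \<otimes> t \<otimes> v b\<close>. Since they act on
  opposite ends of the middle word they commute (\<open>dL_dR_commute\<close>). The \<open>s\<close>-th power of \<open>\<delta>'\<^sub>L\<close> moves \<open>s\<close>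
  letters at once (\<open>dL_power\<close>), and an element of \<open>J\<^sub>n\<close> with \<open>n \<ge> s\<close> lies in \<open>R \<otimes> V\<^bsup>\<otimes>n-s\<^esup>\<close>, so those letters
  form an element of \<open>R\<close>, which is zero in \<open>A\<close>; for \<open>n < s\<close> the letters run out. Hence
  \<open>\<delta>'\<^sub>L\<^sup>s = 0\<close> (\<open>dL_nilpotent\<close>), and likewise on the right. With \<open>S = \<Sum> \<delta>'\<^sub>L\<^bsup>s-1-j\<^esup> \<delta>'\<^sub>R\<^sup>j\<close> the identity
  \<open>(\<delta>'\<^sub>L - \<delta>'\<^sub>R) S = \<delta>'\<^sub>L\<^sup>s - \<delta>'\<^sub>R\<^sup>s\<close> then makes all composites of consecutive \<open>d'\<close> vanish
  (\<open>dL_mixed\<close>, \<open>dK_dK\<close>).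

  That the differentials restrict to the spaces \<open>A \<otimes> J\<^sub>n \<otimes> A\<close> rests on the inclusions
  \<open>J\<^sub>n\<^sub>+\<^sub>1 \<subseteq> V \<otimes> J\<^sub>n\<close> and \<open>J\<^sub>n\<^sub>+\<^sub>1 \<subseteq> J\<^sub>n \<otimes> V\<close>, that is, on the fact that \<open>V \<otimes> -\<close> commutes with intersections over a
  field. Here this is seen by contracting the first factor with linear functionals:
  contraction maps \<open>J\<^sub>n\<^sub>+\<^sub>1\<close> into \<open>J\<^sub>n\<close>, and an element of \<open>V\<^bsup>\<otimes>n+1\<^esup>\<close> is recovered from finitely many of
  its contractions (\<open>left_factor\<close>, \<open>J_left\<close>). The inclusion on the right follows by reversing words
  (\<open>J_right\<close>).

  The bimodule \<open>A \<otimes> J\<^sub>n \<otimes> A\<close> is induced from the vector space \<open>J\<^sub>n\<close>, so a bimodule map out of it can be lifted along a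
  surjection as soon as its restriction to \<open>1 \<otimes> J\<^sub>n \<otimes> 1\<close> lifts linearly (\<open>C_lift\<close>), which is always possible over a
  field. Such linear lifts and the functionals above both come from one application of Zorn's
  lemma, \<open>linear_section\<close>. The grading splits because \<open>R\<close> is homogeneous, so that the projections onto
  the homogeneous parts of \<open>T(V)\<close> descend to \<open>A\<close>.

  Every map in sight is defined by its values on words or pure tensors, so each of the
  constructions (free module, tensor product, tensor algebra, quotient algebra) is used only
  through its universal property and the fact that its generators span it.
\<close>

section \<open>Linear maps and spans\<close>

text \<open>
  In contrast to \<^const>\<open>linear_maps\<close>, values outside the carrier are left free, so that identities,
  composites and sums of linear maps can be written as plain \<open>\<lambda>\<close>-terms.
\<close>

definition lin ::
  "'k ring \<Rightarrow> ('k, 'm, 'y) module_scheme \<Rightarrow> ('k, 'n, 'z) module_scheme \<Rightarrow> ('m \<Rightarrow> 'n) \<Rightarrow> bool" where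
  "lin K M N f \<longleftrightarrow> f \<in> carrier M \<rightarrow> carrier N \<and>
     (\<forall>x\<in>carrier M. \<forall>y\<in>carrier M. f (x \<oplus>\<^bsub>M\<^esub> y) = f x \<oplus>\<^bsub>N\<^esub> f y) \<and>
     (\<forall>c\<in>carrier K. \<forall>x\<in>carrier M. f (c \<odot>\<^bsub>M\<^esub> x) = c \<odot>\<^bsub>N\<^esub> f x)"

lemma linI:
  assumes "\<And>x. x \<in> carrier M \<Longrightarrow> f x \<in> carrier N"
    and "\<And>x y. x \<in> carrier M \<Longrightarrow> y \<in> carrier M \<Longrightarrow> f (x \<oplus>\<^bsub>M\<^esub> y) = f x \<oplus>\<^bsub>N\<^esub> f y"
    and "\<And>c x. c \<in> carrier K \<Longrightarrow> x \<in> carrier M \<Longrightarrow> f (c \<odot>\<^bsub>M\<^esub> x) = c \<odot>\<^bsub>N\<^esub> f x"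
  shows "lin K M N f"
  using assms by (auto simp: lin_def)

lemma lin_closed: "lin K M N f \<Longrightarrow> x \<in> carrier M \<Longrightarrow> f x \<in> carrier N"
  by (auto simp: lin_def)

lemma lin_add: "lin K M N f \<Longrightarrow> x \<in> carrier M \<Longrightarrow> y \<in> carrier M \<Longrightarrow> f (x \<oplus>\<^bsub>M\<^esub> y) = f x \<oplus>\<^bsub>N\<^esub> f y"
  by (auto simp: lin_def)

lemma lin_smult: "lin K M N f \<Longrightarrow> c \<in> carrier K \<Longrightarrow> x \<in> carrier M \<Longrightarrow> f (c \<odot>\<^bsub>M\<^esub> x) = c \<odot>\<^bsub>N\<^esub> f x"
  by (auto simp: lin_def)

lemma lin_cong:
  assumes "module K M" "lin K M N f" "\<And>x. x \<in> carrier M \<Longrightarrow> f x = g x"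
  shows "lin K M N g"
proof -
  interpret M: module K M by fact
  show ?thesis using assms(2,3) by (auto simp: lin_def Pi_def)
qed

lemma linear_maps_iff: "f \<in> linear_maps K M N \<longleftrightarrow> lin K M N f \<and> f \<in> extensional (carrier M)"
  by (auto simp: linear_maps_def lin_def PiE_def)

lemma lin_zero:
  assumes "module K M" "module K N" "lin K M N f"
  shows "f \<zero>\<^bsub>M\<^esub> = \<zero>\<^bsub>N\<^esub>"
proof -
  interpret M: module K M by fact
  interpret N: module K N by fact
  have "f (\<zero>\<^bsub>K\<^esub> \<odot>\<^bsub>M\<^esub> \<zero>\<^bsub>M\<^esub>) = \<zero>\<^bsub>K\<^esub> \<odot>\<^bsub>N\<^esub> f \<zero>\<^bsub>M\<^esub>"
    using lin_smult[OF assms(3)] by blast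
  then show ?thesis using lin_closed[OF assms(3), of "\<zero>\<^bsub>M\<^esub>"] by simp
qed

lemma smult_minus_one:
  assumes "module K M" "x \<in> carrier M"
  shows "(\<ominus>\<^bsub>K\<^esub> \<one>\<^bsub>K\<^esub>) \<odot>\<^bsub>M\<^esub> x = \<ominus>\<^bsub>M\<^esub> x"
proof -
  interpret M: module K M by fact
  show ?thesis using assms(2) M.smult_l_minus[of "\<one>\<^bsub>K\<^esub>" x] by simp
qed

lemma diff_eq_zero_iff:
  assumes "module K M" "x \<in> carrier M" "y \<in> carrier M"
  shows "x \<ominus>\<^bsub>M\<^esub> y = \<zero>\<^bsub>M\<^esub> \<longleftrightarrow> x = y"
proof -
  interpret M: module K M by fact
  show ?thesis using assms M.add.inv_solve_right'[of "\<zero>\<^bsub>M\<^esub>" x y] by (auto simp: M.minus_eq)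
qed

lemma lin_minus:
  assumes "module K M" "module K N" "lin K M N f" "x \<in> carrier M" "y \<in> carrier M"
  shows "f (x \<ominus>\<^bsub>M\<^esub> y) = f x \<ominus>\<^bsub>N\<^esub> f y"
proof -
  interpret M: module K M by fact
  interpret N: module K N by fact
  have "f ((\<ominus>\<^bsub>K\<^esub> \<one>\<^bsub>K\<^esub>) \<odot>\<^bsub>M\<^esub> y) = (\<ominus>\<^bsub>K\<^esub> \<one>\<^bsub>K\<^esub>) \<odot>\<^bsub>N\<^esub> f y"
    using assms by (intro lin_smult) auto
  then have "f (\<ominus>\<^bsub>M\<^esub> y) = \<ominus>\<^bsub>N\<^esub> f y"
    using assms lin_closed[OF assms(3,5)] by (simp add: smult_minus_one)
  then show ?thesis
    using assms by (simp add: M.minus_eq N.minus_eq lin_add)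
qed

lemma lin_comp: "lin K M N f \<Longrightarrow> lin K N P g \<Longrightarrow> lin K M P (\<lambda>x. g (f x))"
  by (auto simp: lin_def Pi_def)

lemma lin_id: "lin K M M (\<lambda>x. x)"
  by (auto simp: lin_def)

lemma lin_const_zero:
  assumes "module K N"
  shows "lin K M N (\<lambda>x. \<zero>\<^bsub>N\<^esub>)"
proof -
  interpret N: module K N by fact
  show ?thesis by (auto simp: lin_def)
qed

lemma lin_plus:
  assumes "module K M" "module K N" "lin K M N f" "lin K M N g"
  shows "lin K M N (\<lambda>x. f x \<oplus>\<^bsub>N\<^esub> g x)"
proof -
  interpret M: module K M by fact
  interpret N: module K N by fact
  show ?thesis
    by (rule linI) (auto simp: lin_closed[OF assms(3)] lin_closed[OF assms(4)] lin_add[OF assms(3)]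
       lin_add[OF assms(4)] lin_smult[OF assms(3)] lin_smult[OF assms(4)] N.smult_r_distr N.add.m_ac)
qed

lemma lin_scale:
  assumes "module K M" "module K N" "lin K M N f" "c \<in> carrier K"
  shows "lin K M N (\<lambda>x. c \<odot>\<^bsub>N\<^esub> f x)"
proof -
  interpret M: module K M by fact
  interpret N: module K N by fact
  show ?thesis using assms(4)
    by (intro linI) (auto simp: lin_closed[OF assms(3)] lin_add[OF assms(3)]
       lin_smult[OF assms(3)] N.smult_r_distr N.smult_assoc1[symmetric] M.R.m_comm)
qed

lemma lin_diff:
  assumes "module K M" "module K N" "lin K M N f" "lin K M N g"
  shows "lin K M N (\<lambda>x. f x \<ominus>\<^bsub>N\<^esub> g x)"
proof -
  interpret N: module K N by fact
  have "lin K M N (\<lambda>x. f x \<oplus>\<^bsub>N\<^esub> ((\<ominus>\<^bsub>K\<^esub> \<one>\<^bsub>K\<^esub>) \<odot>\<^bsub>N\<^esub> g x))"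
    using assms by (intro lin_plus lin_scale) auto
  then show ?thesis
    by (rule lin_cong[OF assms(1)]) (auto simp: smult_minus_one[OF assms(2)] lin_closed[OF assms(4)] N.minus_eq)
qed

lemma lin_finsum:
  assumes "module K M" "module K N" "finite I" "\<And>i. i \<in> I \<Longrightarrow> lin K M N (f i)"
  shows "lin K M N (\<lambda>x. \<Oplus>\<^bsub>N\<^esub>i\<in>I. f i x)"
  using assms(3,4)
proof (induction I rule: finite_induct)
  case empty
  interpret N: module K N by fact
  show ?case using lin_const_zero[OF assms(2)] by simp
next
  case (insert i I)
  interpret N: module K N by fact
  have "lin K M N (\<lambda>x. f i x \<oplus>\<^bsub>N\<^esub> (\<Oplus>\<^bsub>N\<^esub>i\<in>I. f i x))"
    using insert assms by (intro lin_plus) auto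
  then show ?case
  proof (rule lin_cong[OF assms(1)])
    fix x assume "x \<in> carrier M"
    then show "f i x \<oplus>\<^bsub>N\<^esub> (\<Oplus>\<^bsub>N\<^esub>i\<in>I. f i x) = (\<Oplus>\<^bsub>N\<^esub>i\<in>insert i I. f i x)"
      using insert.hyps lin_closed[OF insert.prems] by (subst N.finsum_insert) auto
  qed
qed

lemma lin_of_finsum:
  assumes "module K M" "module K N" "lin K M N f" "finite I" "\<And>i. i \<in> I \<Longrightarrow> x i \<in> carrier M"
  shows "f (\<Oplus>\<^bsub>M\<^esub>i\<in>I. x i) = (\<Oplus>\<^bsub>N\<^esub>i\<in>I. f (x i))"
  using assms(4,5)
proof (induction I rule: finite_induct)
  case empty
  interpret M: module K M by fact
  interpret N: module K N by fact
  show ?case using lin_zero[OF assms(1-3)] by simp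
next
  case (insert i I)
  interpret M: module K M by fact
  interpret N: module K N by fact
  show ?case using insert
    by (auto simp: lin_add[OF assms(3)] lin_closed[OF assms(3)] Pi_def)
qed

text \<open>
  Closure under negatives comes for free from the scalar \<open>-1\<close>.
\<close>

lemma submoduleI':
  assumes "module K M" "H \<subseteq> carrier M" "\<zero>\<^bsub>M\<^esub> \<in> H"
    "\<And>x y. x \<in> H \<Longrightarrow> y \<in> H \<Longrightarrow> x \<oplus>\<^bsub>M\<^esub> y \<in> H"
    "\<And>c x. c \<in> carrier K \<Longrightarrow> x \<in> H \<Longrightarrow> c \<odot>\<^bsub>M\<^esub> x \<in> H"
  shows "submodule H K M"
proof -
  interpret M: module K M by fact
  show ?thesis
  proof (rule M.submoduleI)
    fix a assume a: "a \<in> H"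
    have "(\<ominus>\<^bsub>K\<^esub> \<one>\<^bsub>K\<^esub>) \<odot>\<^bsub>M\<^esub> a \<in> H" using a assms by auto
    moreover have "a \<in> carrier M" using a assms(2) by blast
    ultimately show "\<ominus>\<^bsub>M\<^esub> a \<in> H" using smult_minus_one[OF assms(1), of a] by simp
  qed (use assms in auto)
qed

lemma submodule_facts:
  assumes "module K M" "submodule H K M"
  shows submodule_subset: "H \<subseteq> carrier M"
    and submodule_zero: "\<zero>\<^bsub>M\<^esub> \<in> H"
    and submodule_add: "\<And>x y. x \<in> H \<Longrightarrow> y \<in> H \<Longrightarrow> x \<oplus>\<^bsub>M\<^esub> y \<in> H"
    and submodule_diff: "\<And>x y. x \<in> H \<Longrightarrow> y \<in> H \<Longrightarrow> x \<ominus>\<^bsub>M\<^esub> y \<in> H"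
    and submodule_smult: "\<And>c x. c \<in> carrier K \<Longrightarrow> x \<in> H \<Longrightarrow> c \<odot>\<^bsub>M\<^esub> x \<in> H"
proof -
  interpret M: module K M by fact
  note E = M.submoduleE[OF assms(2)]
  show "H \<subseteq> carrier M" "\<And>x y. x \<in> H \<Longrightarrow> y \<in> H \<Longrightarrow> x \<oplus>\<^bsub>M\<^esub> y \<in> H"
    "\<And>x y. x \<in> H \<Longrightarrow> y \<in> H \<Longrightarrow> x \<ominus>\<^bsub>M\<^esub> y \<in> H"
    "\<And>c x. c \<in> carrier K \<Longrightarrow> x \<in> H \<Longrightarrow> c \<odot>\<^bsub>M\<^esub> x \<in> H" using E by (auto simp: M.minus_eq)
  show "\<zero>\<^bsub>M\<^esub> \<in> H"
    using submodule.axioms(1)[OF assms(2)] subgroup.one_closed by fastforce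
qed

lemma submodule_finsum:
  assumes "module K M" "submodule H K M" "finite I" "\<And>i. i \<in> I \<Longrightarrow> x i \<in> H"
  shows "(\<Oplus>\<^bsub>M\<^esub>i\<in>I. x i) \<in> H"
  using assms(3,4)
proof (induction I rule: finite_induct)
  case empty
  interpret M: module K M by fact
  show ?case using submodule_zero[OF assms(1,2)] by simp
next
  case (insert i I)
  interpret M: module K M by fact
  have "(\<Oplus>\<^bsub>M\<^esub>i\<in>insert i I. x i) = x i \<oplus>\<^bsub>M\<^esub> (\<Oplus>\<^bsub>M\<^esub>i\<in>I. x i)"
    using insert submodule_subset[OF assms(1,2)] by (intro M.finsum_insert) auto
  then show ?case using insert submodule_add[OF assms(1,2)] by simp
qed

lemma lin_vimage_submodule:
  assumes "module K M" "module K N" "lin K M N f" "submodule H K N"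
  shows "submodule {x \<in> carrier M. f x \<in> H} K M"
proof -
  interpret M: module K M by fact
  note S = submodule_facts[OF assms(2,4)]
  show ?thesis
    by (rule submoduleI'[OF assms(1)])
       (auto simp: lin_zero[OF assms(1-3)] lin_add[OF assms(3)] lin_smult[OF assms(3)] intro: S)
qed

lemma zero_submodule:
  assumes "module K M"
  shows "submodule {\<zero>\<^bsub>M\<^esub>} K M"
proof -
  interpret M: module K M by fact
  show ?thesis by (rule submoduleI'[OF assms]) auto
qed

lemma lspan_least: "submodule H K M \<Longrightarrow> S \<subseteq> H \<Longrightarrow> lspan K M S \<subseteq> H"
  by (auto simp: lspan_def)

lemma lspan_superset: "S \<subseteq> lspan K M S"
  by (auto simp: lspan_def)

lemma lspan_base: "x \<in> S \<Longrightarrow> x \<in> lspan K M S"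
  by (auto simp: lspan_def)

lemma lspan_carrier:
  assumes "module K M" "S \<subseteq> carrier M"
  shows "lspan K M S \<subseteq> carrier M"
  using lspan_least[OF module.carrier_is_submodule[OF assms(1)] assms(2)] .

lemma lspan_submodule:
  assumes "module K M" "S \<subseteq> carrier M"
  shows "submodule (lspan K M S) K M"
proof (rule submoduleI'[OF assms(1) lspan_carrier[OF assms]])
  show "\<zero>\<^bsub>M\<^esub> \<in> lspan K M S"
    by (auto simp: lspan_def intro: submodule_zero[OF assms(1)])
  show "x \<oplus>\<^bsub>M\<^esub> y \<in> lspan K M S" if "x \<in> lspan K M S" "y \<in> lspan K M S" for x y
    using that by (auto simp: lspan_def intro: submodule_add[OF assms(1)])
  show "c \<odot>\<^bsub>M\<^esub> x \<in> lspan K M S" if "c \<in> carrier K" "x \<in> lspan K M S" for c x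
    using that by (auto simp: lspan_def intro: submodule_smult[OF assms(1)])
qed

lemma lspan_mono: "S \<subseteq> S' \<Longrightarrow> lspan K M S \<subseteq> lspan K M S'"
  by (auto simp: lspan_def)

lemma lspan_induct [consumes 3, case_names base zero add smult]:
  assumes "module K M" "S \<subseteq> carrier M" "x \<in> lspan K M S"
    and base: "\<And>x. x \<in> S \<Longrightarrow> P x"
    and zero: "P \<zero>\<^bsub>M\<^esub>"
    and add: "\<And>x y. x \<in> carrier M \<Longrightarrow> y \<in> carrier M \<Longrightarrow> P x \<Longrightarrow> P y \<Longrightarrow> P (x \<oplus>\<^bsub>M\<^esub> y)"
    and smult: "\<And>c x. c \<in> carrier K \<Longrightarrow> x \<in> carrier M \<Longrightarrow> P x \<Longrightarrow> P (c \<odot>\<^bsub>M\<^esub> x)"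
  shows "P x"
proof -
  interpret M: module K M by fact
  have "submodule {x \<in> carrier M. P x} K M"
    by (rule submoduleI'[OF assms(1)]) (use assms in auto)
  then have "lspan K M S \<subseteq> {x \<in> carrier M. P x}"
    using base assms(2) by (intro lspan_least) auto
  then show ?thesis using assms(3) by auto
qed

text \<open>
  This lemma and \<open>lin_eq_on_span\<close> reduce every claim about a linear map to spanning elements; they
  replace inductions over sums throughout.
\<close>

lemma lin_span_mem:
  assumes "module K M" "module K N" "lin K M N f" "S \<subseteq> carrier M" "submodule H K N"
    "\<And>x. x \<in> S \<Longrightarrow> f x \<in> H" "x \<in> lspan K M S"
  shows "f x \<in> H"
proof -
  have "lspan K M S \<subseteq> {x \<in> carrier M. f x \<in> H}"
    using assms by (intro lspan_least lin_vimage_submodule) auto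
  then show ?thesis using assms by auto
qed

lemma lin_eq_on_span:
  assumes "module K M" "module K N" "lin K M N f" "lin K M N g" "S \<subseteq> carrier M"
    "\<And>x. x \<in> S \<Longrightarrow> f x = g x" "x \<in> lspan K M S"
  shows "f x = g x"
  using assms(1,5,7)
proof (induction rule: lspan_induct)
  case zero then show ?case using assms by (simp add: lin_zero[of K M N])
qed (use assms in \<open>auto simp: lin_add[OF assms(3)] lin_add[OF assms(4)] lin_smult[OF assms(3)] lin_smult[OF assms(4)]\<close>)

definition bilin where
  "bilin K M N P \<beta> \<longleftrightarrow> (\<forall>y\<in>carrier N. lin K M P (\<lambda>x. \<beta> x y)) \<and> (\<forall>x\<in>carrier M. lin K N P (\<beta> x))"

lemma bilin_lspan:
  assumes "module K M" "module K N" "module K P" "bilin K M N P \<beta>" "S \<subseteq> carrier M" "S' \<subseteq> carrier N"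
    "submodule H K P" "\<And>x y. x \<in> S \<Longrightarrow> y \<in> S' \<Longrightarrow> \<beta> x y \<in> H"
    "x \<in> lspan K M S" "y \<in> lspan K N S'"
  shows "\<beta> x y \<in> H"
proof -
  have x: "x \<in> carrier M" and y: "y \<in> carrier N"
    using assms lspan_carrier[of K] by blast+
  have 1: "\<beta> x' y \<in> H" if "x' \<in> S" for x'
  proof (rule lin_span_mem[OF assms(2,3) _ assms(6,7) _ assms(10)])
    show "lin K N P (\<beta> x')" using assms(4,5) that by (auto simp: bilin_def)
  qed (rule assms(8)[OF that])
  show ?thesis
  proof (rule lin_span_mem[OF assms(1,3) _ assms(5,7) 1 assms(9)])
    show "lin K M P (\<lambda>x. \<beta> x y)" using assms(4) y by (auto simp: bilin_def)
  qed
qed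

section \<open>Quotients\<close>

lemma submodule_abelian_subgroup:
  assumes "module K M" "submodule N K M"
  shows "abelian_subgroup N M"
proof -
  interpret M: module K M by fact
  show ?thesis
    using submodule.axioms(1)[OF assms(2)]
    by (intro abelian_subgroupI3 additive_subgroup.intro M.abelian_group_axioms)
qed

lemma ring_extend_simps [simp]:
  "carrier (ring.extend R m) = carrier R" "mult (ring.extend R m) = mult R"
  "one (ring.extend R m) = one R" "zero (ring.extend R m) = zero R"
  "add (ring.extend R m) = add R" "ring.more (ring.extend R m) = m"
  by (simp_all add: ring.defs)

lemma quot_simps:
  "carrier (quot M N) = (\<lambda>x. N +>\<^bsub>M\<^esub> x) ` carrier M"
  "zero (quot M N) = N" "add (quot M N) = set_add M"
  "one (quot M N) = N +>\<^bsub>M\<^esub> \<one>\<^bsub>M\<^esub>" "mult (quot M N) = rcoset_mult M N"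
  "smult (quot M N) c X = (\<Union>x\<in>X. N +>\<^bsub>M\<^esub> (c \<odot>\<^bsub>M\<^esub> x))"
  by (auto simp: quot_def FactRing_def A_RCOSETS_def' ring.defs module.defs)

lemma quot_carrierE:
  assumes "X \<in> carrier (quot M N)"
  obtains x where "x \<in> carrier M" "X = N +>\<^bsub>M\<^esub> x"
  using assms by (auto simp: quot_simps)

text \<open>
  The scalar action of \<^const>\<open>quot\<close> is a union over all representatives; all members of that union
  coincide.
\<close>

lemma quot_smult:
  assumes "module K M" "submodule N K M" "c \<in> carrier K" "x \<in> carrier M"
  shows "c \<odot>\<^bsub>quot M N\<^esub> (N +>\<^bsub>M\<^esub> x) = N +>\<^bsub>M\<^esub> (c \<odot>\<^bsub>M\<^esub> x)"
proof -
  interpret M: module K M by fact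
  interpret N: abelian_subgroup N M by (rule submodule_abelian_subgroup[OF assms(1,2)])
  have "N +>\<^bsub>M\<^esub> (c \<odot>\<^bsub>M\<^esub> y) = N +>\<^bsub>M\<^esub> (c \<odot>\<^bsub>M\<^esub> x)" if y: "y \<in> N +>\<^bsub>M\<^esub> x" for y
  proof -
    obtain h where h: "h \<in> N" "y = h \<oplus>\<^bsub>M\<^esub> x" using y by (auto simp: a_r_coset_def')
    have hc: "h \<in> carrier M" using h by auto
    have "c \<odot>\<^bsub>M\<^esub> y = c \<odot>\<^bsub>M\<^esub> h \<oplus>\<^bsub>M\<^esub> c \<odot>\<^bsub>M\<^esub> x" using h hc assms by (simp add: M.smult_r_distr)
    then have "c \<odot>\<^bsub>M\<^esub> y \<in> N +>\<^bsub>M\<^esub> (c \<odot>\<^bsub>M\<^esub> x)"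
      using submodule_smult[OF assms(1,2,3) h(1)] by (auto simp: a_r_coset_def')
    then show ?thesis using N.a_repr_independence'[of "c \<odot>\<^bsub>M\<^esub> y" "c \<odot>\<^bsub>M\<^esub> x"] assms by auto
  qed
  moreover have "x \<in> N +>\<^bsub>M\<^esub> x" using N.a_rcos_self assms by simp
  ultimately have "(\<Union>y\<in>N +>\<^bsub>M\<^esub> x. N +>\<^bsub>M\<^esub> (c \<odot>\<^bsub>M\<^esub> y)) = N +>\<^bsub>M\<^esub> (c \<odot>\<^bsub>M\<^esub> x)"
    by blast
  then show ?thesis by (simp only: quot_simps)
qed

lemma quot_add:
  assumes "module K M" "submodule N K M" "x \<in> carrier M" "y \<in> carrier M"
  shows "(N +>\<^bsub>M\<^esub> x) \<oplus>\<^bsub>quot M N\<^esub> (N +>\<^bsub>M\<^esub> y) = N +>\<^bsub>M\<^esub> (x \<oplus>\<^bsub>M\<^esub> y)"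
  using abelian_subgroup.a_rcos_sum[OF submodule_abelian_subgroup[OF assms(1,2)] assms(3,4)]
  by (simp add: quot_simps)

lemma quot_module:
  assumes "module K M" "submodule N K M"
  shows "module K (quot M N)"
proof -
  interpret M: module K M by fact
  interpret N: abelian_subgroup N M by (rule submodule_abelian_subgroup[OF assms(1,2)])
  show ?thesis
  proof (rule moduleI)
    show "cring K" by (rule M.R.cring_axioms)
    have inv: "\<exists>Y\<in>carrier (quot M N). Y \<oplus>\<^bsub>quot M N\<^esub> X = \<zero>\<^bsub>quot M N\<^esub>"
      if X: "X \<in> carrier (quot M N)" for X
    proof -
      obtain x where x: "x \<in> carrier M" "X = N +>\<^bsub>M\<^esub> x" using X by (rule quot_carrierE)
      then have "(N +>\<^bsub>M\<^esub> (\<ominus>\<^bsub>M\<^esub> x)) \<oplus>\<^bsub>quot M N\<^esub> X = \<zero>\<^bsub>quot M N\<^esub>"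
        using N.a_subset by (simp add: quot_add[OF assms] M.l_neg quot_simps(2))
      then show ?thesis using x by (auto simp: quot_simps(1))
    qed
    have z: "\<zero>\<^bsub>quot M N\<^esub> = N +>\<^bsub>M\<^esub> \<zero>\<^bsub>M\<^esub>" using N.a_subset by (simp add: quot_simps)
    show "abelian_group (quot M N)"
      by (rule abelian_groupI[OF _ _ _ _ _ inv])
         (auto simp: quot_simps(1) z quot_add[OF assms] M.a_ac)
  qed (auto simp: quot_simps(1) quot_smult[OF assms] quot_add[OF assms] M.smult_l_distr
        M.smult_r_distr M.smult_assoc1)
qed

lemma quot_proj_lin:
  assumes "module K M" "submodule N K M"
  shows "lin K M (quot M N) (\<lambda>x. N +>\<^bsub>M\<^esub> x)"
  by (rule linI) (auto simp: quot_simps(1) quot_smult[OF assms] quot_add[OF assms])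

lemma quot_eq_zero_iff:
  assumes "module K M" "submodule N K M" "x \<in> carrier M"
  shows "N +>\<^bsub>M\<^esub> x = N \<longleftrightarrow> x \<in> N"
proof -
  interpret M: module K M by fact
  interpret N: abelian_subgroup N M by (rule submodule_abelian_subgroup[OF assms(1,2)])
  show ?thesis using N.a_rcos_const N.a_rcos_self[OF assms(3)] by auto
qed

lemma quot_proj_eqI:
  assumes "module K M" "submodule N K M" "x \<in> carrier M" "y \<in> carrier M" "x \<ominus>\<^bsub>M\<^esub> y \<in> N"
  shows "N +>\<^bsub>M\<^esub> x = N +>\<^bsub>M\<^esub> y"
proof -
  interpret M: module K M by fact
  interpret N: abelian_subgroup N M by (rule submodule_abelian_subgroup[OF assms(1,2)])
  have "x = (x \<ominus>\<^bsub>M\<^esub> y) \<oplus>\<^bsub>M\<^esub> y" using assms by (simp add: M.minus_eq M.a_assoc M.l_neg)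
  then have "x \<in> N +>\<^bsub>M\<^esub> y" using assms(5) by (auto simp: a_r_coset_def')
  then show ?thesis using N.a_repr_independence' assms by auto
qed

lemma quot_proj_eqD:
  fixes K :: "'k ring" and M :: "('k, 'm) module"
  assumes "module K M" "submodule N K M" "x \<in> carrier M" "y \<in> carrier M" "N +>\<^bsub>M\<^esub> x = N +>\<^bsub>M\<^esub> y"
  shows "x \<ominus>\<^bsub>M\<^esub> y \<in> N"
proof -
  interpret M: module K M by fact
  interpret Q: module K "quot M N" by (rule quot_module[OF assms(1,2)])
  have "N +>\<^bsub>M\<^esub> (x \<ominus>\<^bsub>M\<^esub> y) = (N +>\<^bsub>M\<^esub> x) \<ominus>\<^bsub>quot M N\<^esub> (N +>\<^bsub>M\<^esub> y)"
    using lin_minus[OF assms(1) Q.module_axioms quot_proj_lin[OF assms(1,2)] assms(3,4)] .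
  also have "\<dots> = \<zero>\<^bsub>quot M N\<^esub>"
    unfolding assms(5) using assms(4) diff_eq_zero_iff[OF Q.module_axioms] by (simp add: quot_simps(1))
  finally have "N +>\<^bsub>M\<^esub> (x \<ominus>\<^bsub>M\<^esub> y) = N" by (simp add: quot_simps)
  then show ?thesis using quot_eq_zero_iff[OF assms(1,2)] assms by auto
qed

lemma quot_lift:
  assumes "module K M" "submodule N K M" "module K P" "lin K M P f" "\<And>x. x \<in> N \<Longrightarrow> f x = \<zero>\<^bsub>P\<^esub>"
  shows "\<exists>h. lin K (quot M N) P h \<and> (\<forall>x\<in>carrier M. h (N +>\<^bsub>M\<^esub> x) = f x)"
proof -
  interpret M: module K M by fact
  interpret P: module K P by fact
  define h where "h X = f (SOME x. x \<in> carrier M \<and> N +>\<^bsub>M\<^esub> x = X)" for X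
  have h: "h (N +>\<^bsub>M\<^esub> x) = f x" if x: "x \<in> carrier M" for x
  proof -
    define y where "y = (SOME y. y \<in> carrier M \<and> N +>\<^bsub>M\<^esub> y = N +>\<^bsub>M\<^esub> x)"
    have y: "y \<in> carrier M \<and> N +>\<^bsub>M\<^esub> y = N +>\<^bsub>M\<^esub> x"
      unfolding y_def by (rule someI[of _ x]) (use x in auto)
    then have "f (y \<ominus>\<^bsub>M\<^esub> x) = \<zero>\<^bsub>P\<^esub>" using assms(5) quot_proj_eqD[OF assms(1,2)] x by auto
    then have "f y \<ominus>\<^bsub>P\<^esub> f x = \<zero>\<^bsub>P\<^esub>" using lin_minus[OF assms(1,3,4)] x y by auto
    then have "f y = f x" using x y lin_closed[OF assms(4)] by (simp add: diff_eq_zero_iff[OF assms(3)])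
    then show ?thesis by (simp add: h_def y_def)
  qed
  have "lin K (quot M N) P h"
    by (rule linI) (auto simp: quot_simps(1) quot_smult[OF assms(1,2)] quot_add[OF assms(1,2)] h
        lin_closed[OF assms(4)] lin_add[OF assms(4)] lin_smult[OF assms(4)])
  then show ?thesis using h by auto
qed

section \<open>Free modules and tensor products\<close>

lemma free_module_simps [simp]:
  "carrier (free_module K S) = {f. range f \<subseteq> carrier K \<and> finite {x. f x \<noteq> \<zero>\<^bsub>K\<^esub>} \<and> {x. f x \<noteq> \<zero>\<^bsub>K\<^esub>} \<subseteq> S}"
  "zero (free_module K S) = (\<lambda>x. \<zero>\<^bsub>K\<^esub>)"
  "add (free_module K S) = (\<lambda>f g x. f x \<oplus>\<^bsub>K\<^esub> g x)"
  "smult (free_module K S) = (\<lambda>c f x. c \<otimes>\<^bsub>K\<^esub> f x)"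
  by (simp_all add: free_module_def)

lemma free_module_carrierI:
  assumes "\<And>x. f x \<in> carrier K" "\<And>x. x \<notin> B \<Longrightarrow> f x = \<zero>\<^bsub>K\<^esub>" "finite B" "B \<subseteq> S"
  shows "f \<in> carrier (free_module K S)"
proof -
  have "{x. f x \<noteq> \<zero>\<^bsub>K\<^esub>} \<subseteq> B" using assms by auto
  then show ?thesis using assms finite_subset by auto
qed

lemma free_module_module:
  assumes "cring K"
  shows "module K (free_module K S)"
proof -
  interpret K: cring K by fact
  let ?F = "free_module K S"
  have add: "f \<oplus>\<^bsub>?F\<^esub> g \<in> carrier ?F" if f: "f \<in> carrier ?F" and g: "g \<in> carrier ?F" for f g
    by (rule free_module_carrierI[where B="{x. f x \<noteq> \<zero>\<^bsub>K\<^esub>} \<union> {x. g x \<noteq> \<zero>\<^bsub>K\<^esub>}"])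
       (use f g in \<open>auto simp: image_subset_iff\<close>)
  have smult: "c \<odot>\<^bsub>?F\<^esub> f \<in> carrier ?F" if c: "c \<in> carrier K" and f: "f \<in> carrier ?F" for c f
    by (rule free_module_carrierI[where B="{x. f x \<noteq> \<zero>\<^bsub>K\<^esub>}"])
       (use c f in \<open>auto simp: image_subset_iff\<close>)
  have inv: "\<exists>g\<in>carrier ?F. g \<oplus>\<^bsub>?F\<^esub> f = \<zero>\<^bsub>?F\<^esub>" if f: "f \<in> carrier ?F" for f
  proof
    show "(\<ominus>\<^bsub>K\<^esub> \<one>\<^bsub>K\<^esub>) \<odot>\<^bsub>?F\<^esub> f \<in> carrier ?F" using f by (intro smult) auto
    show "((\<ominus>\<^bsub>K\<^esub> \<one>\<^bsub>K\<^esub>) \<odot>\<^bsub>?F\<^esub> f) \<oplus>\<^bsub>?F\<^esub> f = \<zero>\<^bsub>?F\<^esub>"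
      using f by (auto simp: image_subset_iff fun_eq_iff K.l_minus K.l_neg)
  qed
  show ?thesis
  proof (rule moduleI)
    show "cring K" by fact
    show "abelian_group ?F"
    proof (rule abelian_groupI)
      fix f g h assume fgh: "f \<in> carrier ?F" "g \<in> carrier ?F" "h \<in> carrier ?F"
      show "f \<oplus>\<^bsub>?F\<^esub> g \<in> carrier ?F" using add fgh by blast
      show "f \<oplus>\<^bsub>?F\<^esub> g \<oplus>\<^bsub>?F\<^esub> h = f \<oplus>\<^bsub>?F\<^esub> (g \<oplus>\<^bsub>?F\<^esub> h)"
        using fgh by (auto simp: image_subset_iff fun_eq_iff K.a_assoc)
      show "f \<oplus>\<^bsub>?F\<^esub> g = g \<oplus>\<^bsub>?F\<^esub> f"
        using fgh by (auto simp: image_subset_iff fun_eq_iff K.a_comm)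
      show "\<zero>\<^bsub>?F\<^esub> \<oplus>\<^bsub>?F\<^esub> f = f"
        using fgh by (auto simp: image_subset_iff fun_eq_iff)
      show "\<exists>g\<in>carrier ?F. g \<oplus>\<^bsub>?F\<^esub> f = \<zero>\<^bsub>?F\<^esub>" using inv fgh by blast
    qed auto
    fix c d f g assume fgh: "f \<in> carrier ?F" "g \<in> carrier ?F" "c \<in> carrier K" "d \<in> carrier K"
    show "c \<odot>\<^bsub>?F\<^esub> f \<in> carrier ?F" using smult fgh by blast
    show "(c \<oplus>\<^bsub>K\<^esub> d) \<odot>\<^bsub>?F\<^esub> f = c \<odot>\<^bsub>?F\<^esub> f \<oplus>\<^bsub>?F\<^esub> d \<odot>\<^bsub>?F\<^esub> f"
      using fgh by (auto simp: image_subset_iff fun_eq_iff K.l_distr)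
    show "c \<odot>\<^bsub>?F\<^esub> (f \<oplus>\<^bsub>?F\<^esub> g) = c \<odot>\<^bsub>?F\<^esub> f \<oplus>\<^bsub>?F\<^esub> c \<odot>\<^bsub>?F\<^esub> g"
      using fgh by (auto simp: image_subset_iff fun_eq_iff K.r_distr)
    show "(c \<otimes>\<^bsub>K\<^esub> d) \<odot>\<^bsub>?F\<^esub> f = c \<odot>\<^bsub>?F\<^esub> (d \<odot>\<^bsub>?F\<^esub> f)"
      using fgh by (auto simp: image_subset_iff fun_eq_iff K.m_assoc)
  next
    fix f assume fgh: "f \<in> carrier ?F"
    show "\<one>\<^bsub>K\<^esub> \<odot>\<^bsub>?F\<^esub> f = f"
      using fgh by (auto simp: image_subset_iff fun_eq_iff)
  qed
qed

lemma basis_vec_carrier: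
  assumes "cring K" "x \<in> S"
  shows "basis_vec K x \<in> carrier (free_module K S)"
proof -
  interpret K: cring K by fact
  show ?thesis
    by (rule free_module_carrierI[where B="{x}"]) (use assms in \<open>auto simp: basis_vec_def\<close>)
qed

lemma free_module_span:
  assumes "cring K"
  shows "lspan K (free_module K S) (basis_vec K ` S) = carrier (free_module K S)"
proof -
  interpret K: cring K by fact
  let ?F = "free_module K S"
  interpret F: module K ?F by (rule free_module_module[OF assms])
  have sub: "basis_vec K ` S \<subseteq> carrier ?F" by (intro image_subsetI basis_vec_carrier[OF assms])
  note sm = lspan_submodule[OF F.module_axioms sub]
  have "f \<in> lspan K ?F (basis_vec K ` S)"
    if "finite B" "f \<in> carrier ?F" "{x. f x \<noteq> \<zero>\<^bsub>K\<^esub>} \<subseteq> B" for B f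
    using that
  proof (induction B arbitrary: f rule: finite_induct)
    case empty
    then have "f = \<zero>\<^bsub>?F\<^esub>" by auto
    then show ?case using submodule_zero[OF F.module_axioms sm] by simp
  next
    case (insert b B)
    show ?case
    proof (cases "f b = \<zero>\<^bsub>K\<^esub>")
      case True
      then show ?thesis using insert by (intro insert.IH) auto
    next
      case False
      define g where "g = f(b := \<zero>\<^bsub>K\<^esub>)"
      have bS: "b \<in> S" and fK: "\<And>x. f x \<in> carrier K" using insert.prems False by (auto simp: image_subset_iff)
      have g: "g \<in> carrier ?F"
        by (rule free_module_carrierI[where B="{x. f x \<noteq> \<zero>\<^bsub>K\<^esub>}"])
           (use insert.prems fK in \<open>auto simp: g_def\<close>)
      have "g \<in> lspan K ?F (basis_vec K ` S)"
        by (rule insert.IH[OF g]) (use insert.prems in \<open>auto simp: g_def\<close>)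
      moreover have "f b \<odot>\<^bsub>?F\<^esub> basis_vec K b \<in> lspan K ?F (basis_vec K ` S)"
        using bS fK by (intro submodule_smult[OF F.module_axioms sm] lspan_base) auto
      ultimately have "f b \<odot>\<^bsub>?F\<^esub> basis_vec K b \<oplus>\<^bsub>?F\<^esub> g \<in> lspan K ?F (basis_vec K ` S)"
        using submodule_add[OF F.module_axioms sm] by blast
      also have "f b \<odot>\<^bsub>?F\<^esub> basis_vec K b \<oplus>\<^bsub>?F\<^esub> g = f"
        using fK by (auto simp: g_def basis_vec_def fun_eq_iff)
      finally show ?thesis .
    qed
  qed
  then show ?thesis using lspan_carrier[OF F.module_axioms sub] by auto
qed

text \<open>
  The extension is the sum over the support. As supports of sums and multiples vary, the proof
  evaluates it over any finite set between the support and \<open>S\<close>.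
\<close>

lemma free_module_universal:
  assumes "module K P" "\<And>x. x \<in> S \<Longrightarrow> \<phi> x \<in> carrier P"
  shows "\<exists>h. lin K (free_module K S) P h \<and> (\<forall>x\<in>S. h (basis_vec K x) = \<phi> x)"
proof -
  interpret P: module K P by fact
  let ?F = "free_module K S"
  interpret F: module K ?F by (rule free_module_module[OF P.R.cring_axioms])
  define h where "h f = (\<Oplus>\<^bsub>P\<^esub>x\<in>{x. f x \<noteq> \<zero>\<^bsub>K\<^esub>}. f x \<odot>\<^bsub>P\<^esub> \<phi> x)" for f
  have h: "h f = (\<Oplus>\<^bsub>P\<^esub>x\<in>B. f x \<odot>\<^bsub>P\<^esub> \<phi> x)"
    if "finite B" "f \<in> carrier ?F" "{x. f x \<noteq> \<zero>\<^bsub>K\<^esub>} \<subseteq> B" "B \<subseteq> S" for B f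
    unfolding h_def using that assms(2)
    by (intro P.add.finprod_mono_neutral_cong_left) (auto simp: image_subset_iff subset_iff)
  have "lin K ?F P h"
  proof (rule linI)
    fix f assume f: "f \<in> carrier ?F"
    show "h f \<in> carrier P" unfolding h_def using f assms(2)
      by (intro P.finsum_closed) (auto simp: image_subset_iff subset_iff)
    fix c assume c: "c \<in> carrier K"
    show "h (c \<odot>\<^bsub>?F\<^esub> f) = c \<odot>\<^bsub>P\<^esub> h f"
    proof -
      let ?B = "{x. f x \<noteq> \<zero>\<^bsub>K\<^esub>}"
      have B: "finite ?B" "?B \<subseteq> S" and fK: "\<And>x. f x \<in> carrier K" using f by (auto simp: image_subset_iff)
      have "h (c \<odot>\<^bsub>?F\<^esub> f) = (\<Oplus>\<^bsub>P\<^esub>x\<in>?B. (c \<odot>\<^bsub>?F\<^esub> f) x \<odot>\<^bsub>P\<^esub> \<phi> x)"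
        using f c B F.smult_closed[OF c f] by (intro h) auto
      also have "\<dots> = (\<Oplus>\<^bsub>P\<^esub>x\<in>?B. c \<odot>\<^bsub>P\<^esub> (f x \<odot>\<^bsub>P\<^esub> \<phi> x))"
        using B fK c assms(2) by (intro P.finsum_cong') (auto simp: P.smult_assoc1 subset_iff)
      also have "\<dots> = c \<odot>\<^bsub>P\<^esub> h f"
        unfolding h_def using B fK c assms(2) by (intro P.finsum_smult_ldistr[symmetric]) (auto simp: subset_iff)
      finally show ?thesis .
    qed
  next
    fix f g assume f: "f \<in> carrier ?F" and g: "g \<in> carrier ?F"
    show "h (f \<oplus>\<^bsub>?F\<^esub> g) = h f \<oplus>\<^bsub>P\<^esub> h g"
    proof -
      let ?B = "{x. f x \<noteq> \<zero>\<^bsub>K\<^esub>} \<union> {x. g x \<noteq> \<zero>\<^bsub>K\<^esub>}"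
      have B: "finite ?B" "?B \<subseteq> S" and fK: "\<And>x. f x \<in> carrier K" "\<And>x. g x \<in> carrier K"
        using f g by (auto simp: image_subset_iff)
      have "h (f \<oplus>\<^bsub>?F\<^esub> g) = (\<Oplus>\<^bsub>P\<^esub>x\<in>?B. (f \<oplus>\<^bsub>?F\<^esub> g) x \<odot>\<^bsub>P\<^esub> \<phi> x)"
        using f g B fK F.add.m_closed[OF f g] by (intro h) auto
      also have "\<dots> = (\<Oplus>\<^bsub>P\<^esub>x\<in>?B. (f x \<odot>\<^bsub>P\<^esub> \<phi> x) \<oplus>\<^bsub>P\<^esub> (g x \<odot>\<^bsub>P\<^esub> \<phi> x))"
        using B fK assms(2) by (intro P.finsum_cong') (auto simp: P.smult_l_distr subset_iff)
      also have "\<dots> = (\<Oplus>\<^bsub>P\<^esub>x\<in>?B. f x \<odot>\<^bsub>P\<^esub> \<phi> x) \<oplus>\<^bsub>P\<^esub> (\<Oplus>\<^bsub>P\<^esub>x\<in>?B. g x \<odot>\<^bsub>P\<^esub> \<phi> x)"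
        using B fK assms(2) by (intro P.finsum_addf) (auto simp: subset_iff)
      also have "\<dots> = h f \<oplus>\<^bsub>P\<^esub> h g" using h[OF B(1) f] h[OF B(1) g] B by auto
      finally show ?thesis .
    qed
  qed
  moreover have "h (basis_vec K x) = \<phi> x" if x: "x \<in> S" for x
  proof -
    have "h (basis_vec K x) = (\<Oplus>\<^bsub>P\<^esub>y\<in>{x}. basis_vec K x y \<odot>\<^bsub>P\<^esub> \<phi> y)"
      using x basis_vec_carrier[OF P.R.cring_axioms x] by (intro h) (auto simp: basis_vec_def split: if_splits)
    then show ?thesis using assms(2)[OF x] P.smult_one by (simp add: basis_vec_def)
  qed
  ultimately show ?thesis by blast
qed


text \<open>
  The generators of \<^const>\<open>tensor_rels\<close>, named so that membership and vanishing can be stated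
  separately from their span.
\<close>

definition tensor_relators ::
  "'k ring \<Rightarrow> ('k, 'm) module \<Rightarrow> ('k, 'n) module \<Rightarrow> ('m \<times> 'n \<Rightarrow> 'k) set" where
  "tensor_relators K M N = (let F = free_module K (carrier M \<times> carrier N); e = basis_vec K in
       {e (x \<oplus>\<^bsub>M\<^esub> x', y) \<ominus>\<^bsub>F\<^esub> (e (x, y) \<oplus>\<^bsub>F\<^esub> e (x', y)) | x x' y.
          x \<in> carrier M \<and> x' \<in> carrier M \<and> y \<in> carrier N} \<union>
       {e (x, y \<oplus>\<^bsub>N\<^esub> y') \<ominus>\<^bsub>F\<^esub> (e (x, y) \<oplus>\<^bsub>F\<^esub> e (x, y')) | x y y'.
          x \<in> carrier M \<and> y \<in> carrier N \<and> y' \<in> carrier N} \<union>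
       {e (c \<odot>\<^bsub>M\<^esub> x, y) \<ominus>\<^bsub>F\<^esub> (c \<odot>\<^bsub>F\<^esub> e (x, y)) | c x y.
          c \<in> carrier K \<and> x \<in> carrier M \<and> y \<in> carrier N} \<union>
       {e (x, c \<odot>\<^bsub>N\<^esub> y) \<ominus>\<^bsub>F\<^esub> (c \<odot>\<^bsub>F\<^esub> e (x, y)) | c x y.
          c \<in> carrier K \<and> x \<in> carrier M \<and> y \<in> carrier N})"

lemma tensor_rels_eq:
  "tensor_rels K M N = lspan K (free_module K (carrier M \<times> carrier N)) (tensor_relators K M N)"
  by (simp only: tensor_rels_def tensor_relators_def Let_def)

lemma tensor_relators_lin:
  fixes K :: "'k ring" and M :: "('k, 'm) module" and N :: "('k, 'n) module"
  assumes "module K M" "module K N" "module K Q"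
    and h: "lin K (free_module K (carrier M \<times> carrier N)) Q h"
    and \<beta>: "\<And>x y. x \<in> carrier M \<Longrightarrow> y \<in> carrier N \<Longrightarrow> h (basis_vec K (x, y)) = \<beta> x y"
    and bil: "bilin K M N Q \<beta>"
    and r: "r \<in> tensor_relators K M N"
  shows "h r = \<zero>\<^bsub>Q\<^esub>"
proof -
  let ?F = "free_module K (carrier M \<times> carrier N)"
  interpret M: module K M by fact
  interpret N: module K N by fact
  have F: "module K ?F" by (rule free_module_module[OF M.R.cring_axioms])
  interpret F: module K ?F by (rule F)
  have e: "basis_vec K (x, y) \<in> carrier ?F" if "x \<in> carrier M" "y \<in> carrier N" for x y
    using basis_vec_carrier[OF M.R.cring_axioms, of "(x, y)" "carrier M \<times> carrier N"] that by blast
  have l: "lin K M Q (\<lambda>x. \<beta> x y)" if "y \<in> carrier N" for y using bil that by (simp add: bilin_def)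
  have l': "lin K N Q (\<beta> x)" if "x \<in> carrier M" for x using bil that by (simp add: bilin_def)
  have add: "h (a \<ominus>\<^bsub>?F\<^esub> (b \<oplus>\<^bsub>?F\<^esub> b')) = \<zero>\<^bsub>Q\<^esub>"
    if "a \<in> carrier ?F" "b \<in> carrier ?F" "b' \<in> carrier ?F" "h a = h b \<oplus>\<^bsub>Q\<^esub> h b'" for a b b'
  proof -
    have "h (a \<ominus>\<^bsub>?F\<^esub> (b \<oplus>\<^bsub>?F\<^esub> b')) = h a \<ominus>\<^bsub>Q\<^esub> (h b \<oplus>\<^bsub>Q\<^esub> h b')"
      using lin_minus[OF F assms(3) h that(1) F.add.m_closed[OF that(2,3)]] lin_add[OF h that(2,3)] by simp
    also have "\<dots> = \<zero>\<^bsub>Q\<^esub>"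
      using diff_eq_zero_iff[OF assms(3) lin_closed[OF h that(1)] lin_closed[OF h that(1)]] that(4) by simp
    finally show ?thesis .
  qed
  have sm: "h (a \<ominus>\<^bsub>?F\<^esub> (c \<odot>\<^bsub>?F\<^esub> b)) = \<zero>\<^bsub>Q\<^esub>"
    if "a \<in> carrier ?F" "b \<in> carrier ?F" "c \<in> carrier K" "h a = c \<odot>\<^bsub>Q\<^esub> h b" for a b c
  proof -
    have "h (a \<ominus>\<^bsub>?F\<^esub> (c \<odot>\<^bsub>?F\<^esub> b)) = h a \<ominus>\<^bsub>Q\<^esub> (c \<odot>\<^bsub>Q\<^esub> h b)"
      using lin_minus[OF F assms(3) h that(1) F.smult_closed[OF that(3,2)]] lin_smult[OF h that(3,2)] by simp
    also have "\<dots> = \<zero>\<^bsub>Q\<^esub>"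
      using diff_eq_zero_iff[OF assms(3) lin_closed[OF h that(1)] lin_closed[OF h that(1)]] that(4) by simp
    finally show ?thesis .
  qed
  from r[unfolded tensor_relators_def Let_def Un_iff mem_Collect_eq] consider
     (1) x x' y where "x \<in> carrier M" "x' \<in> carrier M" "y \<in> carrier N"
       "r = basis_vec K (x \<oplus>\<^bsub>M\<^esub> x', y) \<ominus>\<^bsub>?F\<^esub> (basis_vec K (x, y) \<oplus>\<^bsub>?F\<^esub> basis_vec K (x', y))"
   | (2) x y y' where "x \<in> carrier M" "y \<in> carrier N" "y' \<in> carrier N"
       "r = basis_vec K (x, y \<oplus>\<^bsub>N\<^esub> y') \<ominus>\<^bsub>?F\<^esub> (basis_vec K (x, y) \<oplus>\<^bsub>?F\<^esub> basis_vec K (x, y'))"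
   | (3) c x y where "c \<in> carrier K" "x \<in> carrier M" "y \<in> carrier N"
       "r = basis_vec K (c \<odot>\<^bsub>M\<^esub> x, y) \<ominus>\<^bsub>?F\<^esub> (c \<odot>\<^bsub>?F\<^esub> basis_vec K (x, y))"
   | (4) c x y where "c \<in> carrier K" "x \<in> carrier M" "y \<in> carrier N"
       "r = basis_vec K (x, c \<odot>\<^bsub>N\<^esub> y) \<ominus>\<^bsub>?F\<^esub> (c \<odot>\<^bsub>?F\<^esub> basis_vec K (x, y))"
    by (elim disjE exE conjE) metis+
  then show ?thesis
  proof cases
    case 1
    show ?thesis unfolding 1(4)
      using 1(1-3) lin_add[OF l[OF 1(3)] 1(1,2)] by (intro add e) (simp_all add: \<beta>)
  next
    case 2
    show ?thesis unfolding 2(4)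
      using 2(1-3) lin_add[OF l'[OF 2(1)] 2(2,3)] by (intro add e) (simp_all add: \<beta>)
  next
    case 3
    show ?thesis unfolding 3(4)
      using 3(1-3) lin_smult[OF l[OF 3(3)] 3(1,2)] by (intro sm e) (simp_all add: \<beta>)
  next
    case 4
    show ?thesis unfolding 4(4)
      using 4(1-3) lin_smult[OF l'[OF 4(2)] 4(1,3)] by (intro sm e) (simp_all add: \<beta>)
  qed
qed

lemma tensor_relators_carrier:
  fixes K :: "'k ring" and M :: "('k, 'm) module" and N :: "('k, 'n) module"
  assumes "module K M" "module K N"
  shows "tensor_relators K M N \<subseteq> carrier (free_module K (carrier M \<times> carrier N))" (is "_ \<subseteq> carrier ?F")
proof -
  interpret M: module K M by fact
  interpret N: module K N by fact
  interpret F: module K ?F by (rule free_module_module[OF M.R.cring_axioms])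
  have e: "basis_vec K (x, y) \<in> carrier ?F" if "x \<in> carrier M" "y \<in> carrier N" for x y
    using basis_vec_carrier[OF M.R.cring_axioms, of "(x, y)" "carrier M \<times> carrier N"] that by blast
  show ?thesis
    unfolding tensor_relators_def Let_def
    by (intro Un_least subsetI; elim CollectE exE conjE; hypsubst;
        intro F.minus_closed F.add.m_closed F.smult_closed e M.add.m_closed N.add.m_closed
              M.smult_closed N.smult_closed; assumption)
qed

lemma tensor_rels_submodule:
  fixes K :: "'k ring" and M :: "('k, 'm) module" and N :: "('k, 'n) module"
  assumes "module K M" "module K N"
  shows "submodule (tensor_rels K M N) K (free_module K (carrier M \<times> carrier N))"
  unfolding tensor_rels_eq
  using assms by (intro lspan_submodule free_module_module tensor_relators_carrier)
    (auto simp: module_def)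

lemma tensor_module:
  fixes K :: "'k ring" and M :: "('k, 'm) module" and N :: "('k, 'n) module"
  assumes "module K M" "module K N"
  shows "module K (tensor K M N)"
  unfolding tensor_def
  using assms by (intro quot_module tensor_rels_submodule free_module_module)
    (auto simp: module_def)

lemma tens_closed:
  fixes K :: "'k ring" and M :: "('k, 'm) module" and N :: "('k, 'n) module"
  assumes "module K M" "module K N" "x \<in> carrier M" "y \<in> carrier N"
  shows "tens K M N x y \<in> carrier (tensor K M N)"
proof -
  have "basis_vec K (x, y) \<in> carrier (free_module K (carrier M \<times> carrier N))"
    using assms basis_vec_carrier[of K "(x, y)" "carrier M \<times> carrier N"] by (auto simp: module_def)
  then show ?thesis by (simp only: tens_def tensor_def quot_simps) (rule imageI)
qed

lemma tensor_relators_mem: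
  fixes K M N
  defines "F \<equiv> free_module K (carrier M \<times> carrier N)" and "e \<equiv> basis_vec K"
  shows "x \<in> carrier M \<Longrightarrow> x' \<in> carrier M \<Longrightarrow> y \<in> carrier N \<Longrightarrow>
      e (x \<oplus>\<^bsub>M\<^esub> x', y) \<ominus>\<^bsub>F\<^esub> (e (x, y) \<oplus>\<^bsub>F\<^esub> e (x', y)) \<in> tensor_relators K M N"
    and "x \<in> carrier M \<Longrightarrow> y \<in> carrier N \<Longrightarrow> y' \<in> carrier N \<Longrightarrow>
      e (x, y \<oplus>\<^bsub>N\<^esub> y') \<ominus>\<^bsub>F\<^esub> (e (x, y) \<oplus>\<^bsub>F\<^esub> e (x, y')) \<in> tensor_relators K M N"
    and "c \<in> carrier K \<Longrightarrow> x \<in> carrier M \<Longrightarrow> y \<in> carrier N \<Longrightarrow>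
      e (c \<odot>\<^bsub>M\<^esub> x, y) \<ominus>\<^bsub>F\<^esub> (c \<odot>\<^bsub>F\<^esub> e (x, y)) \<in> tensor_relators K M N"
    and "c \<in> carrier K \<Longrightarrow> x \<in> carrier M \<Longrightarrow> y \<in> carrier N \<Longrightarrow>
      e (x, c \<odot>\<^bsub>N\<^esub> y) \<ominus>\<^bsub>F\<^esub> (c \<odot>\<^bsub>F\<^esub> e (x, y)) \<in> tensor_relators K M N"
  unfolding tensor_relators_def Let_def F_def e_def by blast+

lemma tens_bilin:
  fixes K :: "'k ring" and M :: "('k, 'm) module" and N :: "('k, 'n) module"
  assumes "module K M" "module K N"
  shows "bilin K M N (tensor K M N) (tens K M N)"
proof -
  let ?F = "free_module K (carrier M \<times> carrier N)"
  let ?e = "basis_vec K" and ?R = "tensor_rels K M N"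
  interpret M: module K M by fact
  interpret N: module K N by fact
  have F: "module K ?F" by (rule free_module_module[OF M.R.cring_axioms])
  interpret F: module K ?F by (rule F)
  note S = tensor_rels_submodule[OF assms]
  have e: "?e (x, y) \<in> carrier ?F" if "x \<in> carrier M" "y \<in> carrier N" for x y
    using basis_vec_carrier[OF M.R.cring_axioms, of "(x, y)" "carrier M \<times> carrier N"] that by blast
  have rel: "r \<in> tensor_relators K M N \<Longrightarrow> r \<in> ?R" for r
    unfolding tensor_rels_eq by (rule lspan_base)
  have add: "?R +>\<^bsub>?F\<^esub> a = (?R +>\<^bsub>?F\<^esub> b) \<oplus>\<^bsub>tensor K M N\<^esub> (?R +>\<^bsub>?F\<^esub> c)"
    if "a \<in> carrier ?F" "b \<in> carrier ?F" "c \<in> carrier ?F" "a \<ominus>\<^bsub>?F\<^esub> (b \<oplus>\<^bsub>?F\<^esub> c) \<in> ?R" for a b c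
    using quot_proj_eqI[OF F S that(1) F.add.m_closed[OF that(2,3)] that(4)] quot_add[OF F S that(2,3)]
    by (simp only: tensor_def)
  have sm: "?R +>\<^bsub>?F\<^esub> a = c \<odot>\<^bsub>tensor K M N\<^esub> (?R +>\<^bsub>?F\<^esub> b)"
    if "a \<in> carrier ?F" "b \<in> carrier ?F" "c \<in> carrier K" "a \<ominus>\<^bsub>?F\<^esub> (c \<odot>\<^bsub>?F\<^esub> b) \<in> ?R" for a b c
    using quot_proj_eqI[OF F S that(1) F.smult_closed[OF that(3,2)] that(4)] quot_smult[OF F S that(3,2)]
    by (simp only: tensor_def)
  show ?thesis unfolding bilin_def
  proof (intro conjI ballI linI)
    show "tens K M N x y \<in> carrier (tensor K M N)" "tens K M N x y \<in> carrier (tensor K M N)"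
      if "x \<in> carrier M" "y \<in> carrier N" for x y
      using tens_closed[OF assms that] by auto
    show "tens K M N (x \<oplus>\<^bsub>M\<^esub> x') y = tens K M N x y \<oplus>\<^bsub>tensor K M N\<^esub> tens K M N x' y"
      if "x \<in> carrier M" "x' \<in> carrier M" "y \<in> carrier N" for x x' y
      unfolding tens_def
      by (rule add[OF e e e rel[OF tensor_relators_mem(1)]]) (simp_all add: that)
    show "tens K M N x (y \<oplus>\<^bsub>N\<^esub> y') = tens K M N x y \<oplus>\<^bsub>tensor K M N\<^esub> tens K M N x y'"
      if "x \<in> carrier M" "y \<in> carrier N" "y' \<in> carrier N" for x y y'
      unfolding tens_def
      by (rule add[OF e e e rel[OF tensor_relators_mem(2)]]) (simp_all add: that)
    show "tens K M N (c \<odot>\<^bsub>M\<^esub> x) y = c \<odot>\<^bsub>tensor K M N\<^esub> tens K M N x y"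
      if "c \<in> carrier K" "x \<in> carrier M" "y \<in> carrier N" for c x y
      unfolding tens_def
      by (rule sm[OF e e _ rel[OF tensor_relators_mem(3)]]) (simp_all add: that)
    show "tens K M N x (c \<odot>\<^bsub>N\<^esub> y) = c \<odot>\<^bsub>tensor K M N\<^esub> tens K M N x y"
      if "c \<in> carrier K" "x \<in> carrier M" "y \<in> carrier N" for c x y
      unfolding tens_def
      by (rule sm[OF e e _ rel[OF tensor_relators_mem(4)]]) (simp_all add: that)
  qed
qed

abbreviation pure_tensors where
  "pure_tensors K M N \<equiv> {tens K M N x y | x y. x \<in> carrier M \<and> y \<in> carrier N}"

lemma pure_tensors_carrier:
  fixes K :: "'k ring" and M :: "('k, 'm) module" and N :: "('k, 'n) module"
  assumes "module K M" "module K N"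
  shows "pure_tensors K M N \<subseteq> carrier (tensor K M N)"
  using tens_closed[OF assms] by blast

lemma tensor_span:
  fixes K :: "'k ring" and M :: "('k, 'm) module" and N :: "('k, 'n) module"
  assumes "module K M" "module K N"
  shows "lspan K (tensor K M N) (pure_tensors K M N) = carrier (tensor K M N)"
proof (intro equalityI subsetI)
  let ?F = "free_module K (carrier M \<times> carrier N)" and ?T = "tensor K M N"
  have cr: "cring K" using assms by (simp add: module_def)
  note F = free_module_module[OF cr]
  note T = tensor_module[OF assms]
  have pc: "pure_tensors K M N \<subseteq> carrier ?T"
    by (rule pure_tensors_carrier[OF assms])
  show "x \<in> carrier ?T" if "x \<in> lspan K ?T (pure_tensors K M N)" for x
    using lspan_carrier[OF T pc] that by blast
  fix X assume "X \<in> carrier ?T"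
  then obtain f where f: "f \<in> carrier ?F" "X = tensor_rels K M N +>\<^bsub>?F\<^esub> f"
    unfolding tensor_def by (rule quot_carrierE)
  have "tensor_rels K M N +>\<^bsub>?F\<^esub> f \<in> lspan K ?T (pure_tensors K M N)"
  proof (rule lin_span_mem[OF F T, where f="\<lambda>f. tensor_rels K M N +>\<^bsub>?F\<^esub> f"])
    show "lin K ?F ?T (\<lambda>f. tensor_rels K M N +>\<^bsub>?F\<^esub> f)"
      unfolding tensor_def by (rule quot_proj_lin[OF F tensor_rels_submodule[OF assms]])
    show "basis_vec K ` (carrier M \<times> carrier N) \<subseteq> carrier ?F"
      by (intro image_subsetI basis_vec_carrier[OF cr])
    show "submodule (lspan K ?T (pure_tensors K M N)) K ?T"
      by (rule lspan_submodule[OF T pc])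
    show "f \<in> lspan K ?F (basis_vec K ` (carrier M \<times> carrier N))"
      using f(1) by (simp only: free_module_span[OF cr])
    fix b assume "b \<in> basis_vec K ` (carrier M \<times> carrier N)"
    then obtain x y where "b = basis_vec K (x, y)" "x \<in> carrier M" "y \<in> carrier N" by blast
    then have "tensor_rels K M N +>\<^bsub>?F\<^esub> b \<in> pure_tensors K M N" by (auto simp: tens_def)
    then show "tensor_rels K M N +>\<^bsub>?F\<^esub> b \<in> lspan K ?T (pure_tensors K M N)"
      by (rule lspan_base)
  qed
  then show "X \<in> lspan K ?T (pure_tensors K M N)" by (simp only: f)
qed

lemma tensor_lift:
  fixes K :: "'k ring" and M :: "('k, 'm) module" and N :: "('k, 'n) module"
  assumes "module K M" "module K N" "module K P" "bilin K M N P \<beta>"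
  shows "\<exists>h. lin K (tensor K M N) P h \<and>
           (\<forall>x\<in>carrier M. \<forall>y\<in>carrier N. h (tens K M N x y) = \<beta> x y)"
proof -
  let ?F = "free_module K (carrier M \<times> carrier N)"
  have cr: "cring K" using assms by (simp add: module_def)
  note F = free_module_module[OF cr]
  have cl: "\<beta> x y \<in> carrier P" if "x \<in> carrier M" "y \<in> carrier N" for x y
    using assms(4) that lin_closed[of K N P "\<beta> x" y] by (simp add: bilin_def)
  have "\<exists>h. lin K ?F P h \<and>
     (\<forall>p\<in>carrier M \<times> carrier N. h (basis_vec K p) = (\<lambda>(x, y). \<beta> x y) p)"
    using cl by (intro free_module_universal[OF assms(3)]) auto
  then obtain h where h: "lin K ?F P h"
    and hv: "\<And>x y. x \<in> carrier M \<Longrightarrow> y \<in> carrier N \<Longrightarrow> h (basis_vec K (x, y)) = \<beta> x y"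
    by auto
  have "h r = \<zero>\<^bsub>P\<^esub>" if "r \<in> tensor_rels K M N" for r
  proof -
    have "h r \<in> {\<zero>\<^bsub>P\<^esub>}"
    proof (rule lin_span_mem[OF F assms(3) h tensor_relators_carrier[OF assms(1,2)] zero_submodule[OF assms(3)]])
      show "r \<in> lspan K ?F (tensor_relators K M N)" using that by (simp only: tensor_rels_eq)
    qed (simp add: tensor_relators_lin[OF assms(1-3) h hv assms(4)])
    then show ?thesis by simp
  qed
  then obtain g where g: "lin K (quot ?F (tensor_rels K M N)) P g"
    "\<And>x. x \<in> carrier ?F \<Longrightarrow> g (tensor_rels K M N +>\<^bsub>?F\<^esub> x) = h x"
    using quot_lift[OF F tensor_rels_submodule[OF assms(1,2)] assms(3) h] by metis
  have "g (tens K M N x y) = \<beta> x y" if "x \<in> carrier M" "y \<in> carrier N" for x y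
  proof -
    have "basis_vec K (x, y) \<in> carrier ?F"
      using basis_vec_carrier[OF cr, of "(x, y)" "carrier M \<times> carrier N"] that by blast
    then show ?thesis using g(2) hv[OF that] by (simp only: tens_def)
  qed
  with g(1) show ?thesis unfolding tensor_def by blast
qed

lemma tensor_lin_eq:
  fixes K :: "'k ring" and M :: "('k, 'm) module" and N :: "('k, 'n) module"
  assumes "module K M" "module K N" "module K P"
    "lin K (tensor K M N) P f" "lin K (tensor K M N) P g"
    "\<And>x y. x \<in> carrier M \<Longrightarrow> y \<in> carrier N \<Longrightarrow> f (tens K M N x y) = g (tens K M N x y)"
    "z \<in> carrier (tensor K M N)"
  shows "f z = g z"
proof (rule lin_eq_on_span[OF tensor_module[OF assms(1,2)] assms(3-5) pure_tensors_carrier[OF assms(1,2)]])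
  show "z \<in> lspan K (tensor K M N) (pure_tensors K M N)"
    using assms(7) by (simp only: tensor_span[OF assms(1,2)])
qed (use assms(6) in blast)

lemma tens_lin1:
  fixes K :: "'k ring" and M :: "('k, 'm) module" and N :: "('k, 'n) module"
  assumes "module K M" "module K N" "y \<in> carrier N"
  shows "lin K M (tensor K M N) (\<lambda>x. tens K M N x y)"
  using tens_bilin[OF assms(1,2)] assms(3) by (simp add: bilin_def)

lemma tens_lin2:
  fixes K :: "'k ring" and M :: "('k, 'm) module" and N :: "('k, 'n) module"
  assumes "module K M" "module K N" "x \<in> carrier M"
  shows "lin K N (tensor K M N) (\<lambda>y. tens K M N x y)"
  using tens_bilin[OF assms(1,2)] assms(3) by (simp add: bilin_def)

lemma lin_restrict:
  assumes "module K M" "lin K M N f"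
  shows "restrict f (carrier M) \<in> linear_maps K M N"
  using lin_cong[OF assms(1,2), of "restrict f (carrier M)"] by (simp add: linear_maps_iff)

lemma tensor_map_props:
  fixes K :: "'k ring" and M :: "('k, 'm) module" and N :: "('k, 'n) module"
    and P :: "('k, 'p) module" and Q :: "('k, 'q) module"
  assumes m: "module K M" "module K N" "module K P" "module K Q" and f: "lin K M P f" and g: "lin K N Q g"
  shows tensor_map_lin: "lin K (tensor K M N) (tensor K P Q) (tensor_map K M N P Q f g)"
    and tensor_map_tens: "\<And>x y. x \<in> carrier M \<Longrightarrow> y \<in> carrier N \<Longrightarrow>
       tensor_map K M N P Q f g (tens K M N x y) = tens K P Q (f x) (g y)"
proof -
  let ?P = "\<lambda>h. h \<in> linear_maps K (tensor K M N) (tensor K P Q) \<and>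
     (\<forall>x\<in>carrier M. \<forall>y\<in>carrier N. h (tens K M N x y) = tens K P Q (f x) (g y))"
  note T = tensor_module[OF m(1,2)] and T' = tensor_module[OF m(3,4)]
  have "bilin K M N (tensor K P Q) (\<lambda>x y. tens K P Q (f x) (g y))"
    unfolding bilin_def
    using lin_comp[OF f tens_lin1[OF m(3,4)]] lin_comp[OF g tens_lin2[OF m(3,4)]] lin_closed[OF f] lin_closed[OF g]
    by blast
  from tensor_lift[OF m(1,2) T' this] obtain h where
    h: "lin K (tensor K M N) (tensor K P Q) h"
       "\<And>x y. x \<in> carrier M \<Longrightarrow> y \<in> carrier N \<Longrightarrow> h (tens K M N x y) = tens K P Q (f x) (g y)" by blast
  have ex: "?P (restrict h (carrier (tensor K M N)))"
    using lin_restrict[OF T h(1)] h(2) tens_closed[OF m(1,2)] by simp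
  have un: "h = h'" if "?P h" "?P h'" for h h'
  proof (rule extensionalityI)
    show "h \<in> extensional (carrier (tensor K M N))" "h' \<in> extensional (carrier (tensor K M N))"
      using that by (simp_all add: linear_maps_iff)
    show "h z = h' z" if "z \<in> carrier (tensor K M N)" for z
      by (rule tensor_lin_eq[OF m(1,2) T' _ _ _ that])
         (use \<open>?P h\<close> \<open>?P h'\<close> in \<open>simp_all add: linear_maps_iff\<close>)
  qed
  have "?P (tensor_map K M N P Q f g)"
    unfolding tensor_map_def by (rule theI[where P="?P", OF ex un[OF _ ex]])
  then show "lin K (tensor K M N) (tensor K P Q) (tensor_map K M N P Q f g)"
    "\<And>x y. x \<in> carrier M \<Longrightarrow> y \<in> carrier N \<Longrightarrow>
       tensor_map K M N P Q f g (tens K M N x y) = tens K P Q (f x) (g y)"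
    by (simp_all add: linear_maps_iff)
qed

text \<open>
  Linear maps out of a triple tensor product are the same as trilinear maps. The version for the
  other bracketing is needed to invert \<^const>\<open>tensor_assoc\<close>.
\<close>

lemma tensor3_lift:
  fixes K :: "'k ring" and M :: "('k, 'm) module" and N :: "('k, 'n) module" and P :: "('k, 'p) module"
  assumes m: "module K M" "module K N" "module K P" "module K Q"
    and l1: "\<And>y z. y \<in> carrier N \<Longrightarrow> z \<in> carrier P \<Longrightarrow> lin K M Q (\<lambda>x. \<tau> x y z)"
    and l2: "\<And>x z. x \<in> carrier M \<Longrightarrow> z \<in> carrier P \<Longrightarrow> lin K N Q (\<lambda>y. \<tau> x y z)"
    and l3: "\<And>x y. x \<in> carrier M \<Longrightarrow> y \<in> carrier N \<Longrightarrow> lin K P Q (\<lambda>z. \<tau> x y z)"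
  shows "\<exists>h. lin K (tensor K (tensor K M N) P) Q h \<and> (\<forall>x\<in>carrier M. \<forall>y\<in>carrier N. \<forall>z\<in>carrier P.
           h (tens K (tensor K M N) P (tens K M N x y) z) = \<tau> x y z)"
proof -
  interpret Q: module K Q by fact
  let ?T = "tensor K M N"
  note T = tensor_module[OF m(1,2)]
  have "\<exists>g. lin K ?T Q g \<and> (\<forall>x\<in>carrier M. \<forall>y\<in>carrier N. g (tens K M N x y) = \<tau> x y z)"
    if "z \<in> carrier P" for z
    using l1 l2 that by (intro tensor_lift[OF m(1,2,4)]) (simp add: bilin_def)
  then obtain g where g: "\<And>z. z \<in> carrier P \<Longrightarrow> lin K ?T Q (g z)"
    and gv: "\<And>x y z. x \<in> carrier M \<Longrightarrow> y \<in> carrier N \<Longrightarrow> z \<in> carrier P \<Longrightarrow> g z (tens K M N x y) = \<tau> x y z"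
    by metis
  have "bilin K ?T P Q (\<lambda>t z. g z t)"
    unfolding bilin_def
  proof (intro conjI ballI linI)
    show "g z t \<in> carrier Q" "g z t \<in> carrier Q" if "t \<in> carrier ?T" "z \<in> carrier P" for t z
      using lin_closed[OF g[OF that(2)] that(1)] by auto
    show "g z (t \<oplus>\<^bsub>?T\<^esub> t') = g z t \<oplus>\<^bsub>Q\<^esub> g z t'" if "t \<in> carrier ?T" "t' \<in> carrier ?T" "z \<in> carrier P" for t t' z
      using lin_add[OF g[OF that(3)] that(1,2)] .
    show "g z (c \<odot>\<^bsub>?T\<^esub> t) = c \<odot>\<^bsub>Q\<^esub> g z t" if "t \<in> carrier ?T" "c \<in> carrier K" "z \<in> carrier P" for t c z
      using lin_smult[OF g[OF that(3)] that(2,1)] .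
    show "g (z \<oplus>\<^bsub>P\<^esub> z') t = g z t \<oplus>\<^bsub>Q\<^esub> g z' t" if t: "t \<in> carrier ?T" "z \<in> carrier P" "z' \<in> carrier P" for t z z'
    proof (rule tensor_lin_eq[OF m(1,2,4) _ _ _ t(1)])
      have zz: "z \<oplus>\<^bsub>P\<^esub> z' \<in> carrier P" using t m(3) by (simp add: module_def abelian_groupE)
      show "lin K ?T Q (g (z \<oplus>\<^bsub>P\<^esub> z'))" by (rule g[OF zz])
      show "lin K ?T Q (\<lambda>t. g z t \<oplus>\<^bsub>Q\<^esub> g z' t)" by (rule lin_plus[OF T m(4) g[OF t(2)] g[OF t(3)]])
      show "g (z \<oplus>\<^bsub>P\<^esub> z') (tens K M N x y) = g z (tens K M N x y) \<oplus>\<^bsub>Q\<^esub> g z' (tens K M N x y)"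
        if "x \<in> carrier M" "y \<in> carrier N" for x y
        using lin_add[OF l3[OF that] t(2,3)] by (simp add: gv that t zz)
    qed
    show "g (c \<odot>\<^bsub>P\<^esub> z) t = c \<odot>\<^bsub>Q\<^esub> g z t" if t: "t \<in> carrier ?T" "c \<in> carrier K" "z \<in> carrier P" for t c z
    proof (rule tensor_lin_eq[OF m(1,2,4) _ _ _ t(1)])
      have zz: "c \<odot>\<^bsub>P\<^esub> z \<in> carrier P" using t m(3) by (simp add: module.smult_closed)
      show "lin K ?T Q (g (c \<odot>\<^bsub>P\<^esub> z))" by (rule g[OF zz])
      show "lin K ?T Q (\<lambda>t. c \<odot>\<^bsub>Q\<^esub> g z t)" by (rule lin_scale[OF T m(4) g[OF t(3)] t(2)])
      show "g (c \<odot>\<^bsub>P\<^esub> z) (tens K M N x y) = c \<odot>\<^bsub>Q\<^esub> g z (tens K M N x y)"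
        if "x \<in> carrier M" "y \<in> carrier N" for x y
        using lin_smult[OF l3[OF that] t(2,3)] by (simp add: gv that t zz)
    qed
  qed
  from tensor_lift[OF T m(3,4) this] show ?thesis using gv tens_closed[OF m(1,2)] by auto
qed

lemma tensor3_lift':
  fixes K :: "'k ring" and M :: "('k, 'm) module" and N :: "('k, 'n) module" and P :: "('k, 'p) module"
  assumes m: "module K M" "module K N" "module K P" "module K Q"
    and l1: "\<And>y z. y \<in> carrier N \<Longrightarrow> z \<in> carrier P \<Longrightarrow> lin K M Q (\<lambda>x. \<tau> x y z)"
    and l2: "\<And>x z. x \<in> carrier M \<Longrightarrow> z \<in> carrier P \<Longrightarrow> lin K N Q (\<lambda>y. \<tau> x y z)"
    and l3: "\<And>x y. x \<in> carrier M \<Longrightarrow> y \<in> carrier N \<Longrightarrow> lin K P Q (\<lambda>z. \<tau> x y z)"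
  shows "\<exists>h. lin K (tensor K M (tensor K N P)) Q h \<and> (\<forall>x\<in>carrier M. \<forall>y\<in>carrier N. \<forall>z\<in>carrier P.
           h (tens K M (tensor K N P) x (tens K N P y z)) = \<tau> x y z)"
proof -
  interpret Q: module K Q by fact
  let ?T = "tensor K N P"
  note T = tensor_module[OF m(2,3)]
  have "\<exists>g. lin K ?T Q g \<and> (\<forall>y\<in>carrier N. \<forall>z\<in>carrier P. g (tens K N P y z) = \<tau> x y z)"
    if "x \<in> carrier M" for x
    using l3 l2 that by (intro tensor_lift[OF m(2,3,4)]) (simp add: bilin_def)
  then obtain g where g: "\<And>x. x \<in> carrier M \<Longrightarrow> lin K ?T Q (g x)"
    and gv: "\<And>x y z. x \<in> carrier M \<Longrightarrow> y \<in> carrier N \<Longrightarrow> z \<in> carrier P \<Longrightarrow> g x (tens K N P y z) = \<tau> x y z"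
    by metis
  have "bilin K M ?T Q g"
    unfolding bilin_def
  proof (intro conjI ballI linI)
    show "g x t \<in> carrier Q" "g x t \<in> carrier Q" if "t \<in> carrier ?T" "x \<in> carrier M" for t x
      using lin_closed[OF g[OF that(2)] that(1)] by auto
    show "g x (t \<oplus>\<^bsub>?T\<^esub> t') = g x t \<oplus>\<^bsub>Q\<^esub> g x t'" if "x \<in> carrier M" "t \<in> carrier ?T" "t' \<in> carrier ?T" for t t' x
      using lin_add[OF g[OF that(1)] that(2,3)] .
    show "g x (c \<odot>\<^bsub>?T\<^esub> t) = c \<odot>\<^bsub>Q\<^esub> g x t" if "x \<in> carrier M" "c \<in> carrier K" "t \<in> carrier ?T" for t c x
      using lin_smult[OF g[OF that(1)] that(2,3)] .
    show "g (x \<oplus>\<^bsub>M\<^esub> x') t = g x t \<oplus>\<^bsub>Q\<^esub> g x' t" if t: "t \<in> carrier ?T" "x \<in> carrier M" "x' \<in> carrier M" for t x x'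
    proof (rule tensor_lin_eq[OF m(2-4) _ _ _ t(1)])
      have zz: "x \<oplus>\<^bsub>M\<^esub> x' \<in> carrier M" using t m(1) by (simp add: module_def abelian_groupE)
      show "lin K ?T Q (g (x \<oplus>\<^bsub>M\<^esub> x'))" by (rule g[OF zz])
      show "lin K ?T Q (\<lambda>t. g x t \<oplus>\<^bsub>Q\<^esub> g x' t)" by (rule lin_plus[OF T m(4) g[OF t(2)] g[OF t(3)]])
      show "g (x \<oplus>\<^bsub>M\<^esub> x') (tens K N P y z) = g x (tens K N P y z) \<oplus>\<^bsub>Q\<^esub> g x' (tens K N P y z)"
        if "y \<in> carrier N" "z \<in> carrier P" for y z
        using lin_add[OF l1[OF that] t(2,3)] by (simp add: gv that t zz)
    qed
    show "g (c \<odot>\<^bsub>M\<^esub> x) t = c \<odot>\<^bsub>Q\<^esub> g x t" if t: "t \<in> carrier ?T" "c \<in> carrier K" "x \<in> carrier M" for t c x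
    proof (rule tensor_lin_eq[OF m(2-4) _ _ _ t(1)])
      have zz: "c \<odot>\<^bsub>M\<^esub> x \<in> carrier M" using t m(1) by (simp add: module.smult_closed)
      show "lin K ?T Q (g (c \<odot>\<^bsub>M\<^esub> x))" by (rule g[OF zz])
      show "lin K ?T Q (\<lambda>t. c \<odot>\<^bsub>Q\<^esub> g x t)" by (rule lin_scale[OF T m(4) g[OF t(3)] t(2)])
      show "g (c \<odot>\<^bsub>M\<^esub> x) (tens K N P y z) = c \<odot>\<^bsub>Q\<^esub> g x (tens K N P y z)"
        if "y \<in> carrier N" "z \<in> carrier P" for y z
        using lin_smult[OF l1[OF that] t(2,3)] by (simp add: gv that t zz)
    qed
  qed
  from tensor_lift[OF m(1) T m(4) this] show ?thesis using gv tens_closed[OF m(2,3)] by auto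
qed

lemma tensor3_lin_eq:
  fixes K :: "'k ring" and M :: "('k, 'm) module" and N :: "('k, 'n) module" and P :: "('k, 'p) module"
  assumes m: "module K M" "module K N" "module K P" "module K Q"
    and f: "lin K (tensor K (tensor K M N) P) Q f" and g: "lin K (tensor K (tensor K M N) P) Q g"
    and eq: "\<And>x y z. x \<in> carrier M \<Longrightarrow> y \<in> carrier N \<Longrightarrow> z \<in> carrier P \<Longrightarrow>
      f (tens K (tensor K M N) P (tens K M N x y) z) = g (tens K (tensor K M N) P (tens K M N x y) z)"
    and u: "u \<in> carrier (tensor K (tensor K M N) P)"
  shows "f u = g u"
proof (rule tensor_lin_eq[OF tensor_module[OF m(1,2)] m(3,4) f g _ u])
  fix t z assume t: "t \<in> carrier (tensor K M N)" and z: "z \<in> carrier P"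
  note l = tens_lin1[OF tensor_module[OF m(1,2)] m(3) z]
  show "f (tens K (tensor K M N) P t z) = g (tens K (tensor K M N) P t z)"
    by (rule tensor_lin_eq[OF m(1,2,4) lin_comp[OF l f] lin_comp[OF l g] eq[OF _ _ z] t])
qed

lemma tensor3_lin_eq':
  fixes K :: "'k ring" and M :: "('k, 'm) module" and N :: "('k, 'n) module" and P :: "('k, 'p) module"
  assumes m: "module K M" "module K N" "module K P" "module K Q"
    and f: "lin K (tensor K M (tensor K N P)) Q f" and g: "lin K (tensor K M (tensor K N P)) Q g"
    and eq: "\<And>x y z. x \<in> carrier M \<Longrightarrow> y \<in> carrier N \<Longrightarrow> z \<in> carrier P \<Longrightarrow>
      f (tens K M (tensor K N P) x (tens K N P y z)) = g (tens K M (tensor K N P) x (tens K N P y z))"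
    and u: "u \<in> carrier (tensor K M (tensor K N P))"
  shows "f u = g u"
proof (rule tensor_lin_eq[OF m(1) tensor_module[OF m(2,3)] m(4) f g _ u])
  fix x t assume t: "t \<in> carrier (tensor K N P)" and x: "x \<in> carrier M"
  note l = tens_lin2[OF m(1) tensor_module[OF m(2,3)] x]
  show "f (tens K M (tensor K N P) x t) = g (tens K M (tensor K N P) x t)"
    by (rule tensor_lin_eq[OF m(2,3,4) lin_comp[OF l f] lin_comp[OF l g] eq[OF x] t])
qed

text \<open>
  The universal property of the other bracketing yields a linear two-sided inverse, which agrees
  with \<^const>\<open>inv_into\<close> on the carrier.
\<close>

lemma tensor_assoc_props:
  fixes K :: "'k ring" and M :: "('k, 'm) module" and N :: "('k, 'n) module" and P :: "('k, 'p) module"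
  assumes m: "module K M" "module K N" "module K P"
  defines "L \<equiv> tensor K (tensor K M N) P" and "L' \<equiv> tensor K M (tensor K N P)"
  shows tensor_assoc_lin: "lin K L L' (tensor_assoc K M N P)"
    and tensor_assoc_tens: "\<And>x y z. x \<in> carrier M \<Longrightarrow> y \<in> carrier N \<Longrightarrow> z \<in> carrier P \<Longrightarrow>
       tensor_assoc K M N P (tens K (tensor K M N) P (tens K M N x y) z) =
         tens K M (tensor K N P) x (tens K N P y z)"
    and tensor_assoc_inv_lin: "lin K L' L (inv_into (carrier L) (tensor_assoc K M N P))"
    and tensor_assoc_inv_tens: "\<And>x y z. x \<in> carrier M \<Longrightarrow> y \<in> carrier N \<Longrightarrow> z \<in> carrier P \<Longrightarrow>
       inv_into (carrier L) (tensor_assoc K M N P) (tens K M (tensor K N P) x (tens K N P y z)) =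
         tens K (tensor K M N) P (tens K M N x y) z"
proof -
  let ?p = "\<lambda>x y z. tens K (tensor K M N) P (tens K M N x y) z"
  let ?p' = "\<lambda>x y z. tens K M (tensor K N P) x (tens K N P y z)"
  let ?P = "\<lambda>h. h \<in> linear_maps K L L' \<and>
     (\<forall>x\<in>carrier M. \<forall>y\<in>carrier N. \<forall>z\<in>carrier P. h (?p x y z) = ?p' x y z)"
  note T1 = tensor_module[OF m(1,2)] and T2 = tensor_module[OF m(2,3)]
  have L: "module K L" unfolding L_def by (rule tensor_module[OF T1 m(3)])
  have L': "module K L'" unfolding L'_def by (rule tensor_module[OF m(1) T2])
  have pc: "?p x y z \<in> carrier L" if "x \<in> carrier M" "y \<in> carrier N" "z \<in> carrier P" for x y z
    unfolding L_def using tens_closed[OF T1 m(3) tens_closed[OF m(1,2) that(1,2)] that(3)] .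
  have pc': "?p' x y z \<in> carrier L'" if "x \<in> carrier M" "y \<in> carrier N" "z \<in> carrier P" for x y z
    unfolding L'_def using tens_closed[OF m(1) T2 that(1) tens_closed[OF m(2,3) that(2,3)]] .
  have "\<exists>h. lin K L L' h \<and> (\<forall>x\<in>carrier M. \<forall>y\<in>carrier N. \<forall>z\<in>carrier P. h (?p x y z) = ?p' x y z)"
    unfolding L_def
  proof (rule tensor3_lift[OF m L'])
    show "lin K M L' (\<lambda>x. ?p' x y z)" if "y \<in> carrier N" "z \<in> carrier P" for y z
      unfolding L'_def using tens_lin1[OF m(1) T2] tens_closed[OF m(2,3) that] by blast
    show "lin K N L' (\<lambda>y. ?p' x y z)" if "x \<in> carrier M" "z \<in> carrier P" for x z
      unfolding L'_def using lin_comp[OF tens_lin1[OF m(2,3) that(2)] tens_lin2[OF m(1) T2 that(1)]] .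
    show "lin K P L' (\<lambda>z. ?p' x y z)" if "x \<in> carrier M" "y \<in> carrier N" for x y
      unfolding L'_def using lin_comp[OF tens_lin2[OF m(2,3) that(2)] tens_lin2[OF m(1) T2 that(1)]] .
  qed
  then obtain h where h: "lin K L L' h" "\<And>x y z. x \<in> carrier M \<Longrightarrow> y \<in> carrier N \<Longrightarrow> z \<in> carrier P \<Longrightarrow>
     h (?p x y z) = ?p' x y z" by blast
  have ex: "?P (restrict h (carrier L))"
    using lin_restrict[OF L h(1)] h(2) pc by simp
  have un: "h = h'" if "?P h" "?P h'" for h h'
  proof (rule extensionalityI)
    show "h \<in> extensional (carrier L)" "h' \<in> extensional (carrier L)"
      using that by (simp_all add: linear_maps_iff)
    show "h z = h' z" if "z \<in> carrier L" for z
      by (rule tensor3_lin_eq[OF m L' _ _ _ that[unfolded L_def]])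
         (use \<open>?P h\<close> \<open>?P h'\<close> in \<open>simp_all add: linear_maps_iff L_def\<close>)
  qed
  let ?a = "tensor_assoc K M N P"
  have "?P ?a"
    unfolding tensor_assoc_def L_def[symmetric] L'_def[symmetric] by (rule theI[where P="?P", OF ex un[OF _ ex]])
  then show al: "lin K L L' ?a"
    and av: "\<And>x y z. x \<in> carrier M \<Longrightarrow> y \<in> carrier N \<Longrightarrow> z \<in> carrier P \<Longrightarrow> ?a (?p x y z) = ?p' x y z"
    by (simp_all add: linear_maps_iff)
  have "\<exists>h. lin K L' L h \<and> (\<forall>x\<in>carrier M. \<forall>y\<in>carrier N. \<forall>z\<in>carrier P. h (?p' x y z) = ?p x y z)"
    unfolding L'_def
  proof (rule tensor3_lift'[OF m L])
    show "lin K M L (\<lambda>x. ?p x y z)" if "y \<in> carrier N" "z \<in> carrier P" for y z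
      unfolding L_def using lin_comp[OF tens_lin1[OF m(1,2) that(1)] tens_lin1[OF T1 m(3) that(2)]] .
    show "lin K N L (\<lambda>y. ?p x y z)" if "x \<in> carrier M" "z \<in> carrier P" for x z
      unfolding L_def using lin_comp[OF tens_lin2[OF m(1,2) that(1)] tens_lin1[OF T1 m(3) that(2)]] .
    show "lin K P L (\<lambda>z. ?p x y z)" if "x \<in> carrier M" "y \<in> carrier N" for x y
      unfolding L_def using tens_lin2[OF T1 m(3)] tens_closed[OF m(1,2) that] by blast
  qed
  then obtain b where b: "lin K L' L b" and bv: "\<And>x y z. x \<in> carrier M \<Longrightarrow> y \<in> carrier N \<Longrightarrow> z \<in> carrier P \<Longrightarrow>
     b (?p' x y z) = ?p x y z" by blast
  have ba: "b (?a u) = u" if "u \<in> carrier L" for u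
    by (rule tensor3_lin_eq[OF m L, where f="\<lambda>u. b (?a u)" and g="\<lambda>u. u"])
       (use lin_comp[OF al b] lin_id[of K L] that in \<open>simp_all add: av bv L_def\<close>)
  have ab: "?a (b u) = u" if "u \<in> carrier L'" for u
    by (rule tensor3_lin_eq'[OF m L', where f="\<lambda>u. ?a (b u)" and g="\<lambda>u. u"])
       (use lin_comp[OF b al] lin_id[of K L'] that in \<open>simp_all add: av bv L'_def\<close>)
  have inv: "inv_into (carrier L) ?a u = b u" if "u \<in> carrier L'" for u
  proof -
    have "inj_on ?a (carrier L)" by (rule inj_on_inverseI[where g=b]) (rule ba)
    from inv_into_f_f[OF this lin_closed[OF b that]] show ?thesis by (simp only: ab[OF that])
  qed
  show "lin K L' L (inv_into (carrier L) ?a)"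
    by (rule lin_cong[OF L' b]) (simp only: inv)
  show "\<And>x y z. x \<in> carrier M \<Longrightarrow> y \<in> carrier N \<Longrightarrow> z \<in> carrier P \<Longrightarrow>
       inv_into (carrier L) ?a (?p' x y z) = ?p x y z"
    by (simp only: inv[OF pc'] bv)
qed

section \<open>Extending linear maps over a field\<close>

text \<open>
  Zorn's lemma gives linear sections: among the subspaces of a linear relation \<open>P\<close> that contain \<open>H0\<close>
  and meet \<open>0 \<times> M\<close> trivially, a maximal one is the graph of a function on all of \<open>L\<close>. Taking for \<open>P\<close> the
  full relation and for \<open>H0\<close> the graph of a map on a subspace extends that map; taking
  \<open>P = {(x, m). e m = g x}\<close> and \<open>H0 = 0\<close> lifts \<open>g\<close> along \<open>e\<close>.
\<close>

lemma linear_section: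
  fixes L :: "('k, 'l, 'x) module_scheme" and M :: "('k, 'm, 'y) module_scheme"
  assumes K: "field K" and L: "module K L" and M: "module K M"
    and P_sub: "P \<subseteq> carrier L \<times> carrier M"
    and P_add: "\<And>x y m n. (x, m) \<in> P \<Longrightarrow> (y, n) \<in> P \<Longrightarrow> (x \<oplus>\<^bsub>L\<^esub> y, m \<oplus>\<^bsub>M\<^esub> n) \<in> P"
    and P_smult: "\<And>c x m. c \<in> carrier K \<Longrightarrow> (x, m) \<in> P \<Longrightarrow> (c \<odot>\<^bsub>L\<^esub> x, c \<odot>\<^bsub>M\<^esub> m) \<in> P"
    and P_total: "\<And>x. x \<in> carrier L \<Longrightarrow> \<exists>m. (x, m) \<in> P"
    and H_sub: "H0 \<subseteq> P"
    and H_zero: "(\<zero>\<^bsub>L\<^esub>, \<zero>\<^bsub>M\<^esub>) \<in> H0"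
    and H_add: "\<And>x y m n. (x, m) \<in> H0 \<Longrightarrow> (y, n) \<in> H0 \<Longrightarrow> (x \<oplus>\<^bsub>L\<^esub> y, m \<oplus>\<^bsub>M\<^esub> n) \<in> H0"
    and H_smult: "\<And>c x m. c \<in> carrier K \<Longrightarrow> (x, m) \<in> H0 \<Longrightarrow> (c \<odot>\<^bsub>L\<^esub> x, c \<odot>\<^bsub>M\<^esub> m) \<in> H0"
    and H_fun: "\<And>m. (\<zero>\<^bsub>L\<^esub>, m) \<in> H0 \<Longrightarrow> m = \<zero>\<^bsub>M\<^esub>"
  shows "\<exists>h. lin K L M h \<and> (\<forall>x\<in>carrier L. (x, h x) \<in> P) \<and> (\<forall>(x, m)\<in>H0. h x = m)"
proof -
  interpret K: field K by fact
  interpret L: module K L by fact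
  interpret M: module K M by fact
  define Z where "Z = {H. H0 \<subseteq> H \<and> H \<subseteq> P \<and>
    (\<forall>x y m n. (x, m) \<in> H \<longrightarrow> (y, n) \<in> H \<longrightarrow> (x \<oplus>\<^bsub>L\<^esub> y, m \<oplus>\<^bsub>M\<^esub> n) \<in> H) \<and>
    (\<forall>c x m. c \<in> carrier K \<longrightarrow> (x, m) \<in> H \<longrightarrow> (c \<odot>\<^bsub>L\<^esub> x, c \<odot>\<^bsub>M\<^esub> m) \<in> H) \<and>
    (\<forall>m. (\<zero>\<^bsub>L\<^esub>, m) \<in> H \<longrightarrow> m = \<zero>\<^bsub>M\<^esub>)}"
  have "\<exists>H\<in>Z. \<forall>X\<in>Z. H \<subseteq> X \<longrightarrow> X = H"
  proof (rule subset_Zorn_nonempty)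
    have "H0 \<in> Z" unfolding Z_def using H_sub H_add H_smult H_fun by simp
    then show "Z \<noteq> {}" by auto
    fix C assume C: "C \<noteq> {}" "subset.chain Z C"
    then have CZ: "\<And>X. X \<in> C \<Longrightarrow> X \<in> Z" by (auto simp: subset_chain_def)
    have ad: "(x \<oplus>\<^bsub>L\<^esub> y, m \<oplus>\<^bsub>M\<^esub> n) \<in> \<Union>C" if xm: "(x, m) \<in> \<Union>C" and yn: "(y, n) \<in> \<Union>C" for x y m n
    proof -
      obtain X Y where XY: "X \<in> C" "(x, m) \<in> X" "Y \<in> C" "(y, n) \<in> Y" using xm yn by (metis UnionE)
      then have "X \<subseteq> Y \<or> Y \<subseteq> X" using C(2) unfolding subset_chain_def by metis
      then obtain W where W: "W \<in> C" "(x, m) \<in> W" "(y, n) \<in> W" using XY by (metis subsetD)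
      then have "(x \<oplus>\<^bsub>L\<^esub> y, m \<oplus>\<^bsub>M\<^esub> n) \<in> W" using CZ[OF W(1)] unfolding Z_def by simp
      then show ?thesis using W(1) by (rule UnionI[rotated])
    qed
    have sm: "(c \<odot>\<^bsub>L\<^esub> x, c \<odot>\<^bsub>M\<^esub> m) \<in> \<Union>C" if c: "c \<in> carrier K" and xm: "(x, m) \<in> \<Union>C" for c x m
    proof -
      obtain X where X: "X \<in> C" "(x, m) \<in> X" using xm by (metis UnionE)
      then have "(c \<odot>\<^bsub>L\<^esub> x, c \<odot>\<^bsub>M\<^esub> m) \<in> X" using CZ[OF X(1)] c unfolding Z_def by simp
      then show ?thesis using X(1) by (rule UnionI[rotated])
    qed
    have fn: "m = \<zero>\<^bsub>M\<^esub>" if zm: "(\<zero>\<^bsub>L\<^esub>, m) \<in> \<Union>C" for m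
    proof -
      obtain X where X: "X \<in> C" "(\<zero>\<^bsub>L\<^esub>, m) \<in> X" using zm by (metis UnionE)
      then show ?thesis using CZ[OF X(1)] unfolding Z_def by simp
    qed
    obtain X where "X \<in> C" using C(1) by (meson ex_in_conv)
    then have "H0 \<subseteq> \<Union>C" using CZ[of X] unfolding Z_def by (simp add: Sup_upper2)
    moreover have "\<Union>C \<subseteq> P" using CZ unfolding Z_def by (simp add: Sup_least)
    ultimately show "\<Union>C \<in> Z" unfolding Z_def using ad sm fn by simp
  qed
  then obtain H where HZ: "H \<in> Z" and Hmax: "\<And>X. X \<in> Z \<Longrightarrow> H \<subseteq> X \<Longrightarrow> X = H" by metis
  have H0H: "H0 \<subseteq> H" and HP: "H \<subseteq> P"
    and Hadd: "\<And>x y m n. (x, m) \<in> H \<Longrightarrow> (y, n) \<in> H \<Longrightarrow> (x \<oplus>\<^bsub>L\<^esub> y, m \<oplus>\<^bsub>M\<^esub> n) \<in> H"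
    and Hsm: "\<And>c x m. c \<in> carrier K \<Longrightarrow> (x, m) \<in> H \<Longrightarrow> (c \<odot>\<^bsub>L\<^esub> x, c \<odot>\<^bsub>M\<^esub> m) \<in> H"
    and Hfun0: "\<And>m. (\<zero>\<^bsub>L\<^esub>, m) \<in> H \<Longrightarrow> m = \<zero>\<^bsub>M\<^esub>"
    using HZ unfolding Z_def by simp_all
  have Hc: "x \<in> carrier L \<and> m \<in> carrier M" if "(x, m) \<in> H" for x m
    using that HP P_sub by (meson SigmaD1 SigmaD2 subsetD)
  have Hfun: "m = n" if "(x, m) \<in> H" "(x, n) \<in> H" for x m n
  proof -
    have c: "x \<in> carrier L" "m \<in> carrier M" "n \<in> carrier M" using Hc that by metis+
    have "(x \<oplus>\<^bsub>L\<^esub> (\<ominus>\<^bsub>K\<^esub> \<one>\<^bsub>K\<^esub>) \<odot>\<^bsub>L\<^esub> x, m \<oplus>\<^bsub>M\<^esub> (\<ominus>\<^bsub>K\<^esub> \<one>\<^bsub>K\<^esub>) \<odot>\<^bsub>M\<^esub> n) \<in> H"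
      using that by (intro Hadd Hsm) simp_all
    then have "(\<zero>\<^bsub>L\<^esub>, m \<ominus>\<^bsub>M\<^esub> n) \<in> H"
      using c by (simp add: smult_minus_one[OF L] smult_minus_one[OF M] M.minus_eq L.r_neg)
    then show ?thesis using Hfun0 diff_eq_zero_iff[OF M c(2,3)] by simp
  qed
  have total: "\<exists>m. (x, m) \<in> H" if x: "x \<in> carrier L" for x
  proof (rule ccontr)
    assume no: "\<nexists>m. (x, m) \<in> H"
    obtain p where p: "(x, p) \<in> P" using P_total[OF x] by (elim exE)
    then have pc: "p \<in> carrier M" using P_sub by (meson SigmaD2 subsetD)
    \<comment> \<open>Adjoining one value at \<open>x\<close> keeps the relation functional, as \<open>x\<close> is independent of the domain of \<open>H\<close>.\<close>
    define H' where "H' = {(y \<oplus>\<^bsub>L\<^esub> c \<odot>\<^bsub>L\<^esub> x, m \<oplus>\<^bsub>M\<^esub> c \<odot>\<^bsub>M\<^esub> p) | y m c. (y, m) \<in> H \<and> c \<in> carrier K}"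
    have H'I: "(y \<oplus>\<^bsub>L\<^esub> c \<odot>\<^bsub>L\<^esub> x, m \<oplus>\<^bsub>M\<^esub> c \<odot>\<^bsub>M\<^esub> p) \<in> H'" if "(y, m) \<in> H" "c \<in> carrier K" for y m c
      unfolding H'_def mem_Collect_eq using that by metis
    have HH': "H \<subseteq> H'"
    proof (rule subrelI)
      fix y m assume ym: "(y, m) \<in> H"
      show "(y, m) \<in> H'" using H'I[OF ym K.zero_closed] Hc[OF ym] x pc by simp
    qed
    have "H' \<in> Z"
      unfolding Z_def mem_Collect_eq
    proof (intro conjI allI impI)
      show "H0 \<subseteq> H'" using H0H HH' by (rule order_trans)
      show "H' \<subseteq> P"
      proof
        fix z assume "z \<in> H'"
        then obtain y m c where "z = (y \<oplus>\<^bsub>L\<^esub> c \<odot>\<^bsub>L\<^esub> x, m \<oplus>\<^bsub>M\<^esub> c \<odot>\<^bsub>M\<^esub> p)" "(y, m) \<in> H" "c \<in> carrier K"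
          unfolding H'_def mem_Collect_eq by metis
        then show "z \<in> P" using HP p by (metis P_add P_smult subsetD)
      qed
    next
      fix y1 y2 m1 m2 assume "(y1, m1) \<in> H'" "(y2, m2) \<in> H'"
      then obtain z1 n1 c1 z2 n2 c2 where
        z: "y1 = z1 \<oplus>\<^bsub>L\<^esub> c1 \<odot>\<^bsub>L\<^esub> x" "m1 = n1 \<oplus>\<^bsub>M\<^esub> c1 \<odot>\<^bsub>M\<^esub> p" "(z1, n1) \<in> H" "c1 \<in> carrier K"
           "y2 = z2 \<oplus>\<^bsub>L\<^esub> c2 \<odot>\<^bsub>L\<^esub> x" "m2 = n2 \<oplus>\<^bsub>M\<^esub> c2 \<odot>\<^bsub>M\<^esub> p" "(z2, n2) \<in> H" "c2 \<in> carrier K"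
        unfolding H'_def mem_Collect_eq by (metis prod.inject)
      have c: "z1 \<in> carrier L" "z2 \<in> carrier L" "n1 \<in> carrier M" "n2 \<in> carrier M"
        using Hc z by metis+
      have "((z1 \<oplus>\<^bsub>L\<^esub> z2) \<oplus>\<^bsub>L\<^esub> (c1 \<oplus>\<^bsub>K\<^esub> c2) \<odot>\<^bsub>L\<^esub> x, (n1 \<oplus>\<^bsub>M\<^esub> n2) \<oplus>\<^bsub>M\<^esub> (c1 \<oplus>\<^bsub>K\<^esub> c2) \<odot>\<^bsub>M\<^esub> p) \<in> H'"
        using z by (intro H'I Hadd) simp_all
      then show "(y1 \<oplus>\<^bsub>L\<^esub> y2, m1 \<oplus>\<^bsub>M\<^esub> m2) \<in> H'"
        using z c x pc by (simp add: L.smult_l_distr M.smult_l_distr L.a_ac M.a_ac)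
    next
      fix c y m assume cK: "c \<in> carrier K" and "(y, m) \<in> H'"
      then obtain z n d where z: "y = z \<oplus>\<^bsub>L\<^esub> d \<odot>\<^bsub>L\<^esub> x" "m = n \<oplus>\<^bsub>M\<^esub> d \<odot>\<^bsub>M\<^esub> p" "(z, n) \<in> H" "d \<in> carrier K"
        unfolding H'_def mem_Collect_eq by (metis prod.inject)
      have "(c \<odot>\<^bsub>L\<^esub> z \<oplus>\<^bsub>L\<^esub> (c \<otimes>\<^bsub>K\<^esub> d) \<odot>\<^bsub>L\<^esub> x, c \<odot>\<^bsub>M\<^esub> n \<oplus>\<^bsub>M\<^esub> (c \<otimes>\<^bsub>K\<^esub> d) \<odot>\<^bsub>M\<^esub> p) \<in> H'"
        using z cK by (intro H'I Hsm) simp_all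
      then show "(c \<odot>\<^bsub>L\<^esub> y, c \<odot>\<^bsub>M\<^esub> m) \<in> H'"
        using z Hc[OF z(3)] cK x pc by (simp add: L.smult_r_distr M.smult_r_distr L.smult_assoc1 M.smult_assoc1)
    next
      fix m assume "(\<zero>\<^bsub>L\<^esub>, m) \<in> H'"
      then obtain z n d where z: "\<zero>\<^bsub>L\<^esub> = z \<oplus>\<^bsub>L\<^esub> d \<odot>\<^bsub>L\<^esub> x" "m = n \<oplus>\<^bsub>M\<^esub> d \<odot>\<^bsub>M\<^esub> p" "(z, n) \<in> H" "d \<in> carrier K"
        unfolding H'_def mem_Collect_eq by (metis prod.inject)
      have c: "z \<in> carrier L" "n \<in> carrier M" using Hc[OF z(3)] by simp_all
      have "d = \<zero>\<^bsub>K\<^esub>"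
      proof (rule ccontr)
        assume d: "d \<noteq> \<zero>\<^bsub>K\<^esub>"
        then have u: "d \<in> Units K" using z(4) K.field_Units by simp
        let ?i = "\<ominus>\<^bsub>K\<^esub> (inv\<^bsub>K\<^esub> d)"
        have i: "?i \<in> carrier K" "inv\<^bsub>K\<^esub> d \<in> carrier K" using u by simp_all
        have "z = \<ominus>\<^bsub>L\<^esub> (d \<odot>\<^bsub>L\<^esub> x)"
          using z(1,4) c(1) x by (metis L.minus_equality L.smult_closed)
        then have "?i \<odot>\<^bsub>L\<^esub> z = inv\<^bsub>K\<^esub> d \<odot>\<^bsub>L\<^esub> (d \<odot>\<^bsub>L\<^esub> x)"
          using i z(4) x by (simp add: L.smult_l_minus L.smult_r_minus)
        also have "\<dots> = x"
          using u i z(4) x by (simp add: L.smult_assoc1[symmetric])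
        finally have "(x, ?i \<odot>\<^bsub>M\<^esub> n) \<in> H" using Hsm[OF i(1) z(3)] by simp
        then show False using no by metis
      qed
      then show "m = \<zero>\<^bsub>M\<^esub>" using z c x pc Hfun0 by simp
    qed
    then have "H' = H" using Hmax HH' by metis
    moreover have "(\<zero>\<^bsub>L\<^esub> \<oplus>\<^bsub>L\<^esub> \<one>\<^bsub>K\<^esub> \<odot>\<^bsub>L\<^esub> x, \<zero>\<^bsub>M\<^esub> \<oplus>\<^bsub>M\<^esub> \<one>\<^bsub>K\<^esub> \<odot>\<^bsub>M\<^esub> p) \<in> H'"
      using H_zero H0H by (intro H'I) auto
    ultimately show False using no x pc by simp
  qed
  define h where "h x = (THE m. (x, m) \<in> H)" for x
  have hI: "h x = m" if "(x, m) \<in> H" for x m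
    unfolding h_def using that Hfun by (intro the_equality) auto
  have hH: "(x, h x) \<in> H" if "x \<in> carrier L" for x
    using total[OF that] hI by metis
  have "lin K L M h"
    by (rule linI) (use hH Hc Hadd Hsm hI in metis)+
  moreover have "\<forall>x\<in>carrier L. (x, h x) \<in> P" using hH HP by (meson subsetD)
  moreover have "\<forall>(x, m)\<in>H0. h x = m"
  proof (intro ballI case_prodI2)
    fix xm x m assume "xm \<in> H0" "xm = (x, m)"
    then have "(x, m) \<in> H" using H0H by (simp add: subsetD)
    then show "h x = m" by (rule hI)
  qed
  ultimately show ?thesis by (intro exI[of _ h] conjI)
qed

text \<open>
  The ring of scalars as a module over itself, the target of linear functionals.
\<close>

definition scalars :: "'k ring \<Rightarrow> ('k, 'k) module" where
  "scalars K = ring.extend K (module.fields (mult K))"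

lemma scalars_simps [simp]:
  "carrier (scalars K) = carrier K" "add (scalars K) = add K" "zero (scalars K) = zero K"
  "smult (scalars K) = mult K"
  by (simp_all add: scalars_def ring.defs module.defs)

lemma scalars_module:
  assumes "cring K"
  shows "module K (scalars K)"
proof -
  interpret K: cring K by fact
  show ?thesis
    by (rule moduleI[OF assms abelian_groupI])
       (auto simp: K.a_ac K.l_distr K.r_distr K.m_assoc intro: bexI[of _ "\<ominus>\<^bsub>K\<^esub> x" for x] K.l_neg)
qed

lemma exists_functional:
  fixes V :: "('k, 'v, 'x) module_scheme"
  assumes K: "field K" and V: "module K V" and v: "v \<in> carrier V" "v \<noteq> \<zero>\<^bsub>V\<^esub>"
  shows "\<exists>\<phi>. lin K V (scalars K) \<phi> \<and> \<phi> v = \<one>\<^bsub>K\<^esub>"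
proof -
  interpret K: field K by fact
  interpret V: module K V by fact
  let ?H = "{(c \<odot>\<^bsub>V\<^esub> v, c) | c. c \<in> carrier K}"
  have H: "(c \<odot>\<^bsub>V\<^esub> v, c) \<in> ?H" if "c \<in> carrier K" for c using that by blast
  have "\<exists>h. lin K V (scalars K) h \<and> (\<forall>x\<in>carrier V. (x, h x) \<in> carrier V \<times> carrier (scalars K)) \<and>
      (\<forall>(x, m)\<in>?H. h x = m)"
  proof (rule linear_section[OF K V scalars_module[OF K.cring_axioms]])
    show "\<exists>m. (x, m) \<in> carrier V \<times> carrier (scalars K)" if "x \<in> carrier V" for x
      using that by auto
    show "(\<zero>\<^bsub>V\<^esub>, \<zero>\<^bsub>scalars K\<^esub>) \<in> ?H" using H[of "\<zero>\<^bsub>K\<^esub>"] v(1) by simp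
    show "(x \<oplus>\<^bsub>V\<^esub> y, m \<oplus>\<^bsub>scalars K\<^esub> n) \<in> ?H" if "(x, m) \<in> ?H" "(y, n) \<in> ?H" for x y m n
      using that v(1) H[of "m \<oplus>\<^bsub>K\<^esub> n"] by (auto simp: V.smult_l_distr)
    show "(c \<odot>\<^bsub>V\<^esub> x, c \<odot>\<^bsub>scalars K\<^esub> m) \<in> ?H" if "c \<in> carrier K" "(x, m) \<in> ?H" for c x m
      using that v(1) H[of "c \<otimes>\<^bsub>K\<^esub> m"] by (auto simp: V.smult_assoc1)
    show "m = \<zero>\<^bsub>scalars K\<^esub>" if "(\<zero>\<^bsub>V\<^esub>, m) \<in> ?H" for m
    proof (rule ccontr)
      assume "m \<noteq> \<zero>\<^bsub>scalars K\<^esub>"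
      then have m: "m \<in> Units K" "m \<in> carrier K" "m \<odot>\<^bsub>V\<^esub> v = \<zero>\<^bsub>V\<^esub>" using that by (auto simp: K.field_Units)
      have "v = (inv\<^bsub>K\<^esub> m \<otimes>\<^bsub>K\<^esub> m) \<odot>\<^bsub>V\<^esub> v" using m v(1) by simp
      also have "\<dots> = inv\<^bsub>K\<^esub> m \<odot>\<^bsub>V\<^esub> (m \<odot>\<^bsub>V\<^esub> v)" using m v(1) by (intro V.smult_assoc1) simp_all
      finally show False using m v by simp
    qed
  qed (use v in auto)
  then obtain h where h: "lin K V (scalars K) h" "\<forall>(x, m)\<in>?H. h x = m" by (elim exE conjE)
  have "h v = \<one>\<^bsub>K\<^esub>" using bspec[OF h(2) H[OF K.one_closed]] v by simp
  with h(1) show ?thesis by (intro exI[of _ h]) simp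
qed

lemma submodule_module:
  assumes "module K M" "submodule H K M"
  shows "module K (M\<lparr>carrier := H\<rparr>)"
  using submodule.submodule_is_module[OF assms(2,1)] .

lemma lin_extend:
  fixes L :: "('k, 'l, 'x) module_scheme" and M :: "('k, 'm, 'y) module_scheme"
  assumes K: "field K" and L: "module K L" and M: "module K M" and J: "submodule J K L"
    and g: "lin K (L\<lparr>carrier := J\<rparr>) M g"
  shows "\<exists>h. lin K L M h \<and> (\<forall>x\<in>J. h x = g x)"
proof -
  interpret L: module K L by fact
  interpret M: module K M by fact
  note J' = submodule_facts[OF L J]
  note JM = submodule_module[OF L J]
  let ?H = "{(x, g x) | x. x \<in> J}"
  have z: "g \<zero>\<^bsub>L\<^esub> = \<zero>\<^bsub>M\<^esub>" using lin_zero[OF JM M g] by simp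
  have a: "g (x \<oplus>\<^bsub>L\<^esub> y) = g x \<oplus>\<^bsub>M\<^esub> g y" if "x \<in> J" "y \<in> J" for x y
    using lin_add[OF g, of x y] that by simp
  have s: "g (c \<odot>\<^bsub>L\<^esub> x) = c \<odot>\<^bsub>M\<^esub> g x" if "c \<in> carrier K" "x \<in> J" for x c
    using lin_smult[OF g that(1), of x] that by simp
  have cl: "g x \<in> carrier M" if "x \<in> J" for x using lin_closed[OF g, of x] that by simp
  have H: "(x, g x) \<in> ?H" if "x \<in> J" for x using that by blast
  have "\<exists>h. lin K L M h \<and> (\<forall>x\<in>carrier L. (x, h x) \<in> carrier L \<times> carrier M) \<and>
      (\<forall>(x, m)\<in>?H. h x = m)"
  proof (rule linear_section[OF K L M])
    show "\<exists>m. (x, m) \<in> carrier L \<times> carrier M" if "x \<in> carrier L" for x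
      using that by auto
    show "?H \<subseteq> carrier L \<times> carrier M" using J'(1) cl by auto
    show "(\<zero>\<^bsub>L\<^esub>, \<zero>\<^bsub>M\<^esub>) \<in> ?H" using H[OF J'(2)] z by simp
    show "(x \<oplus>\<^bsub>L\<^esub> y, m \<oplus>\<^bsub>M\<^esub> n) \<in> ?H" if "(x, m) \<in> ?H" "(y, n) \<in> ?H" for x y m n
      using that H[OF J'(3)[of x y]] by (auto simp: a)
    show "(c \<odot>\<^bsub>L\<^esub> x, c \<odot>\<^bsub>M\<^esub> m) \<in> ?H" if "c \<in> carrier K" "(x, m) \<in> ?H" for c x m
      using that H[OF J'(5)[of c x]] by (auto simp: s)
    show "m = \<zero>\<^bsub>M\<^esub>" if "(\<zero>\<^bsub>L\<^esub>, m) \<in> ?H" for m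
      using that z by auto
  qed auto
  then obtain h where h: "lin K L M h" "\<forall>(x, m)\<in>?H. h x = m" by (elim exE conjE)
  have "h x = g x" if "x \<in> J" for x using bspec[OF h(2) H[OF that]] by simp
  with h(1) show ?thesis by (intro exI[of _ h]) simp
qed

text \<open>
  The target of the lift is confined to a subspace \<open>M'\<close>; with \<open>M'\<close> a homogeneous component this
  serves for graded lifts. The lift is defined on all of \<open>T\<close>, because maps out of \<open>A \<otimes> J \<otimes> A\<close> will be
  obtained by restriction from \<open>A \<otimes> T \<otimes> A\<close>.
\<close>

lemma lin_lift:
  fixes T :: "('k, 't, 'x) module_scheme" and M :: "('k, 'm, 'y) module_scheme"
    and N :: "('k, 'n, 'z) module_scheme"
  assumes K: "field K" and T: "module K T" and M: "module K M" and N: "module K N"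
    and J: "submodule J K T" and M': "submodule M' K M" and e: "lin K M N e"
    and g: "lin K (T\<lparr>carrier := J\<rparr>) N g"
    and sur: "\<And>x. x \<in> J \<Longrightarrow> \<exists>m\<in>M'. e m = g x"
  shows "\<exists>h. lin K T M h \<and> (\<forall>x\<in>J. h x \<in> M' \<and> e (h x) = g x)"
proof -
  interpret T: module K T by fact
  interpret M: module K M by fact
  note M'' = submodule_facts[OF M M']
  note JM = submodule_module[OF T J]
  interpret J: module K "T\<lparr>carrier := J\<rparr>" by (rule JM)
  let ?J = "T\<lparr>carrier := J\<rparr>"
  let ?P = "{(x, m). x \<in> J \<and> m \<in> M' \<and> e m = g x}"
  have a: "e (x \<oplus>\<^bsub>M\<^esub> y) = e x \<oplus>\<^bsub>N\<^esub> e y" if "x \<in> M'" "y \<in> M'" for x y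
    using lin_add[OF e] that M''(1) by blast
  have s: "e (c \<odot>\<^bsub>M\<^esub> x) = c \<odot>\<^bsub>N\<^esub> e x" if "c \<in> carrier K" "x \<in> M'" for x c
    using lin_smult[OF e that(1)] that(2) M''(1) by blast
  have "\<exists>h. lin K ?J M h \<and> (\<forall>x\<in>carrier ?J. (x, h x) \<in> ?P) \<and> (\<forall>(x, m)\<in>{(\<zero>\<^bsub>T\<^esub>, \<zero>\<^bsub>M\<^esub>)}. h x = m)"
  proof (rule linear_section[OF K JM M])
    show "?P \<subseteq> carrier ?J \<times> carrier M" using M''(1) by auto
    show "(x \<oplus>\<^bsub>?J\<^esub> y, m \<oplus>\<^bsub>M\<^esub> n) \<in> ?P" if "(x, m) \<in> ?P" "(y, n) \<in> ?P" for x y m n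
      using that lin_add[OF g, of x y] J.add.m_closed[of x y] M''(3) by (simp add: a)
    show "(c \<odot>\<^bsub>?J\<^esub> x, c \<odot>\<^bsub>M\<^esub> m) \<in> ?P" if "c \<in> carrier K" "(x, m) \<in> ?P" for c x m
      using that lin_smult[OF g that(1), of x] J.smult_closed[of c x] M''(5) by (simp add: s)
    show "\<exists>m. (x, m) \<in> ?P" if "x \<in> carrier ?J" for x
      using that sur[of x] by auto
    show "{(\<zero>\<^bsub>T\<^esub>, \<zero>\<^bsub>M\<^esub>)} \<subseteq> ?P"
      using lin_zero[OF M N e] lin_zero[OF JM N g] submodule_zero[OF T J] M''(2) by simp
  qed auto
  then obtain h0 where h0: "lin K ?J M h0" "\<And>x. x \<in> J \<Longrightarrow> h0 x \<in> M' \<and> e (h0 x) = g x" by auto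
  from lin_extend[OF K T M J h0(1)] show ?thesis using h0(2) by auto
qed


section \<open>Algebras over a field\<close>

lemma module_cong:
  assumes M: "module K M" and eq: "carrier M' = carrier M" "add M' = add M" "zero M' = zero M" "smult M' = smult M"
  shows "module K M'"
proof -
  interpret M: module K M by fact
  have "abelian_group M'"
  proof (rule abelian_groupI)
    show "\<exists>y\<in>carrier M'. y \<oplus>\<^bsub>M'\<^esub> x = \<zero>\<^bsub>M'\<^esub>" if "x \<in> carrier M'" for x
      using that M.l_neg[of x] by (intro bexI[of _ "\<ominus>\<^bsub>M\<^esub> x"]) (simp_all add: eq)
  qed (simp_all add: eq M.a_ac)
  then show ?thesis
    by (intro moduleI M.R.cring_axioms)
       (simp_all add: eq M.smult_l_distr M.smult_r_distr M.smult_assoc1)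
qed

text \<open>
  Associative algebras over a commutative ring; unlike in \<^locale>\<open>algebra\<close>, the multiplication need not
  commute.
\<close>

definition kalg :: "'k ring \<Rightarrow> ('k, 'b) module \<Rightarrow> bool" where
  "kalg K B \<longleftrightarrow> module K B \<and> ring B \<and>
     (\<forall>c\<in>carrier K. \<forall>x\<in>carrier B. \<forall>y\<in>carrier B.
        (c \<odot>\<^bsub>B\<^esub> x) \<otimes>\<^bsub>B\<^esub> y = c \<odot>\<^bsub>B\<^esub> (x \<otimes>\<^bsub>B\<^esub> y) \<and> x \<otimes>\<^bsub>B\<^esub> (c \<odot>\<^bsub>B\<^esub> y) = c \<odot>\<^bsub>B\<^esub> (x \<otimes>\<^bsub>B\<^esub> y))"

lemma kalg_module: "kalg K B \<Longrightarrow> module K B"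
  and kalg_ring: "kalg K B \<Longrightarrow> ring B"
  and kalg_smult: "kalg K B \<Longrightarrow> c \<in> carrier K \<Longrightarrow> x \<in> carrier B \<Longrightarrow> y \<in> carrier B \<Longrightarrow>
        (c \<odot>\<^bsub>B\<^esub> x) \<otimes>\<^bsub>B\<^esub> y = c \<odot>\<^bsub>B\<^esub> (x \<otimes>\<^bsub>B\<^esub> y)"
       "kalg K B \<Longrightarrow> c \<in> carrier K \<Longrightarrow> x \<in> carrier B \<Longrightarrow> y \<in> carrier B \<Longrightarrow>
        x \<otimes>\<^bsub>B\<^esub> (c \<odot>\<^bsub>B\<^esub> y) = c \<odot>\<^bsub>B\<^esub> (x \<otimes>\<^bsub>B\<^esub> y)"
  by (auto simp: kalg_def)

lemma kalg_lin_l: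
  assumes "kalg K B" "y \<in> carrier B"
  shows "lin K B B (\<lambda>x. x \<otimes>\<^bsub>B\<^esub> y)"
proof -
  interpret B: ring B by (rule kalg_ring[OF assms(1)])
  show ?thesis using assms(2) by (intro linI) (auto simp: kalg_smult[OF assms(1)] B.l_distr)
qed

lemma kalg_lin_r:
  assumes "kalg K B" "y \<in> carrier B"
  shows "lin K B B (\<lambda>x. y \<otimes>\<^bsub>B\<^esub> x)"
proof -
  interpret B: ring B by (rule kalg_ring[OF assms(1)])
  show ?thesis using assms(2) by (intro linI) (auto simp: kalg_smult[OF assms(1)] B.r_distr)
qed

lemma kalg_ideal_submodule:
  assumes B: "kalg K B" and I: "ideal I B"
  shows "submodule I K B"
proof -
  interpret B: ring B by (rule kalg_ring[OF B])
  interpret I: ideal I B by (rule I)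
  show ?thesis
  proof (rule submoduleI'[OF kalg_module[OF B]])
    fix c x assume c: "c \<in> carrier K" and x: "x \<in> I"
    have xc: "x \<in> carrier B" using x by simp
    have "c \<odot>\<^bsub>B\<^esub> x = (c \<odot>\<^bsub>B\<^esub> \<one>\<^bsub>B\<^esub>) \<otimes>\<^bsub>B\<^esub> x" using c xc by (simp add: kalg_smult[OF B])
    moreover have "c \<odot>\<^bsub>B\<^esub> \<one>\<^bsub>B\<^esub> \<in> carrier B"
      using module.smult_closed[OF kalg_module[OF B] c] by simp
    ultimately show "c \<odot>\<^bsub>B\<^esub> x \<in> I" using I.I_l_closed[OF x] by simp
  qed (auto intro: I.a_subset)
qed

lemma kalg_quot_mult:
  assumes "ideal I B" "x \<in> carrier B" "y \<in> carrier B"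
  shows "(I +>\<^bsub>B\<^esub> x) \<otimes>\<^bsub>quot B I\<^esub> (I +>\<^bsub>B\<^esub> y) = I +>\<^bsub>B\<^esub> (x \<otimes>\<^bsub>B\<^esub> y)"
  using ideal.rcoset_mult_add[OF assms] by (simp add: quot_simps)

lemma kalg_quot:
  assumes B: "kalg K B" and I: "ideal I B"
  shows "kalg K (quot B I)"
proof -
  interpret B: ring B by (rule kalg_ring[OF B])
  interpret BM: module K B by (rule kalg_module[OF B])
  note S = kalg_ideal_submodule[OF B I]
  note M = quot_module[OF kalg_module[OF B] S]
  note ad = quot_add[OF kalg_module[OF B] S] and sm = quot_smult[OF kalg_module[OF B] S]
    and mu = kalg_quot_mult[OF I]
  have "Group.monoid (quot B I)"
    by (rule monoidI) (auto simp: quot_simps(1) quot_simps(4) mu B.m_assoc)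
  then have "ring (quot B I)"
    using M by (intro ringI) (auto simp: module_def quot_simps(1) ad mu B.l_distr B.r_distr)
  with M show ?thesis
    by (auto simp: kalg_def quot_simps(1) sm mu kalg_smult[OF B])
qed

text \<open>
  The two-sided ideal generated by \<open>X\<close> is spanned by the products \<open>u x v\<close>, and by multilinearity
  it suffices to let \<open>u\<close> and \<open>v\<close> range over a spanning set.
\<close>

lemma lin_genideal_mem:
  assumes B: "kalg K B" and S: "S \<subseteq> carrier B" "lspan K B S = carrier B" and X: "X \<subseteq> carrier B"
    and P: "module K P" and f: "lin K B P f" and H: "submodule H K P"
    and fX: "\<And>u x v. u \<in> S \<Longrightarrow> x \<in> X \<Longrightarrow> v \<in> S \<Longrightarrow> f (u \<otimes>\<^bsub>B\<^esub> x \<otimes>\<^bsub>B\<^esub> v) \<in> H"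
    and y: "y \<in> Idl\<^bsub>B\<^esub> X"
  shows "f y \<in> H"
proof -
  interpret B: ring B by (rule kalg_ring[OF B])
  note BM = kalg_module[OF B]
  let ?G = "{u \<otimes>\<^bsub>B\<^esub> x \<otimes>\<^bsub>B\<^esub> v | u x v. u \<in> carrier B \<and> x \<in> X \<and> v \<in> carrier B}"
  let ?W = "lspan K B ?G"
  have Gc: "?G \<subseteq> carrier B" using X by auto
  note Ws = lspan_submodule[OF BM Gc]
  have l: "a \<otimes>\<^bsub>B\<^esub> w \<in> ?W" if a: "a \<in> carrier B" and w: "w \<in> ?W" for a w
  proof (rule lin_span_mem[OF BM BM kalg_lin_r[OF B a] Gc Ws _ w])
    fix z assume "z \<in> ?G"
    then obtain u x v where z: "z = u \<otimes>\<^bsub>B\<^esub> x \<otimes>\<^bsub>B\<^esub> v" "u \<in> carrier B" "x \<in> X" "v \<in> carrier B" by auto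
    moreover have "x \<in> carrier B" using X z(3) by auto
    ultimately have "a \<otimes>\<^bsub>B\<^esub> z = (a \<otimes>\<^bsub>B\<^esub> u) \<otimes>\<^bsub>B\<^esub> x \<otimes>\<^bsub>B\<^esub> v" using a by (simp add: B.m_assoc)
    moreover have "a \<otimes>\<^bsub>B\<^esub> u \<in> carrier B" using a z by simp
    ultimately have "a \<otimes>\<^bsub>B\<^esub> z \<in> ?G" using z by auto
    then show "a \<otimes>\<^bsub>B\<^esub> z \<in> ?W" by (rule lspan_base)
  qed
  have r: "w \<otimes>\<^bsub>B\<^esub> a \<in> ?W" if a: "a \<in> carrier B" and w: "w \<in> ?W" for a w
  proof (rule lin_span_mem[OF BM BM kalg_lin_l[OF B a] Gc Ws _ w])
    fix z assume "z \<in> ?G"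
    then obtain u x v where z: "z = u \<otimes>\<^bsub>B\<^esub> x \<otimes>\<^bsub>B\<^esub> v" "u \<in> carrier B" "x \<in> X" "v \<in> carrier B" by auto
    moreover have "x \<in> carrier B" using X z(3) by auto
    ultimately have "z \<otimes>\<^bsub>B\<^esub> a = u \<otimes>\<^bsub>B\<^esub> x \<otimes>\<^bsub>B\<^esub> (v \<otimes>\<^bsub>B\<^esub> a)" using a by (simp add: B.m_assoc)
    moreover have "v \<otimes>\<^bsub>B\<^esub> a \<in> carrier B" using a z by simp
    ultimately have "z \<otimes>\<^bsub>B\<^esub> a \<in> ?G" using z by auto
    then show "z \<otimes>\<^bsub>B\<^esub> a \<in> ?W" by (rule lspan_base)
  qed
  have "ideal ?W B"
    by (rule idealI[OF B.ring_axioms submodule.axioms(1)[OF Ws]]) (use l r in auto)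
  moreover have "X \<subseteq> ?W"
  proof
    fix x assume x: "x \<in> X"
    then have "x = \<one>\<^bsub>B\<^esub> \<otimes>\<^bsub>B\<^esub> x \<otimes>\<^bsub>B\<^esub> \<one>\<^bsub>B\<^esub>" using X by auto
    then have "x \<in> ?G" using x by fastforce
    then show "x \<in> ?W" by (rule lspan_base)
  qed
  ultimately have "y \<in> ?W" using B.genideal_minimal y by blast
  then show ?thesis
  proof (rule lin_span_mem[OF BM P f Gc H, rotated])
    fix z assume "z \<in> ?G"
    then obtain u x v where z: "z = u \<otimes>\<^bsub>B\<^esub> x \<otimes>\<^bsub>B\<^esub> v" "u \<in> carrier B" "x \<in> X" "v \<in> carrier B" by auto
    have x: "x \<in> carrier B" using X z(3) by auto
    have "bilin K B B P (\<lambda>u v. f (u \<otimes>\<^bsub>B\<^esub> x \<otimes>\<^bsub>B\<^esub> v))"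
      unfolding bilin_def
    proof (intro conjI ballI)
      show "lin K B P (\<lambda>u. f (u \<otimes>\<^bsub>B\<^esub> x \<otimes>\<^bsub>B\<^esub> v))" if "v \<in> carrier B" for v
        using lin_comp[OF kalg_lin_l[OF B x] lin_comp[OF kalg_lin_l[OF B that] f]] .
      show "lin K B P (\<lambda>v. f (u \<otimes>\<^bsub>B\<^esub> x \<otimes>\<^bsub>B\<^esub> v))" if "u \<in> carrier B" for u
        using lin_comp[OF kalg_lin_r[OF B B.m_closed[OF that x]] f] .
    qed
    from bilin_lspan[OF BM BM P this S(1) S(1) H fX[OF _ z(3)], of u v] show "f z \<in> H"
      using z S(2) by simp
  qed
qed

lemma free_algebra_simps [simp]:
  "carrier (free_algebra K S) = carrier (free_module K (lists S))"
  "zero (free_algebra K S) = (\<lambda>x. \<zero>\<^bsub>K\<^esub>)"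
  "add (free_algebra K S) = (\<lambda>f g x. f x \<oplus>\<^bsub>K\<^esub> g x)"
  "smult (free_algebra K S) = (\<lambda>c f x. c \<otimes>\<^bsub>K\<^esub> f x)"
  "one (free_algebra K S) = basis_vec K []"
  by (simp_all add: free_algebra_def)

lemma free_algebra_mult:
  "f \<otimes>\<^bsub>free_algebra K S\<^esub> g = (\<lambda>w. \<Oplus>\<^bsub>K\<^esub>i\<in>{..length w}. f (take i w) \<otimes>\<^bsub>K\<^esub> g (drop i w))"
  by (simp add: free_algebra_def)

lemma free_algebra_module:
  assumes "cring K"
  shows "module K (free_algebra K S)"
  by (rule module_cong[OF free_module_module[OF assms, of "lists S"]]) simp_all

lemma lspan_cong:
  assumes "carrier M' = carrier M" "add M' = add M" "zero M' = zero M" "smult M' = smult M"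
    and "module K M"
  shows "lspan K M' S = lspan K M S"
proof -
  have M': "module K M'" by (rule module_cong[OF assms(5,1-4)])
  have "submodule H K M' \<longleftrightarrow> submodule H K M" for H
    using submoduleI'[OF assms(5), of H] submoduleI'[OF M', of H]
      submodule_facts[OF assms(5), of H] submodule_facts[OF M', of H] assms(1-4) by metis
  then show ?thesis by (simp add: lspan_def)
qed

lemma free_algebra_span:
  assumes "cring K"
  shows "lspan K (free_algebra K S) (basis_vec K ` lists S) = carrier (free_algebra K S)"
  using lspan_cong[of "free_algebra K S" "free_module K (lists S)" K, OF _ _ _ _ free_module_module[OF assms]]
    free_module_span[OF assms, of "lists S"] by simp

lemma free_algebra_basis_mult:
  assumes "cring K"
  shows "basis_vec K u \<otimes>\<^bsub>free_algebra K S\<^esub> basis_vec K v = basis_vec K (u @ v)"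
proof
  fix w
  interpret K: cring K by fact
  let ?t = "\<lambda>i. basis_vec K u (take i w) \<otimes>\<^bsub>K\<^esub> basis_vec K v (drop i w)"
  show "(basis_vec K u \<otimes>\<^bsub>free_algebra K S\<^esub> basis_vec K v) w = basis_vec K (u @ v) w"
  proof (cases "w = u @ v")
    case True
    have "(\<Oplus>\<^bsub>K\<^esub>i\<in>{..length w}. ?t i) = (\<Oplus>\<^bsub>K\<^esub>i\<in>{..length w}. if length u = i then \<one>\<^bsub>K\<^esub> else \<zero>\<^bsub>K\<^esub>)"
    proof (intro K.finsum_cong')
      fix i assume "i \<in> {..length w}"
      then have "take i w = u \<longleftrightarrow> length u = i" using True by (auto dest: arg_cong[where f=length])
      then show "?t i = (if length u = i then \<one>\<^bsub>K\<^esub> else \<zero>\<^bsub>K\<^esub>)" using True by (auto simp: basis_vec_def)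
    qed auto
    also have "\<dots> = \<one>\<^bsub>K\<^esub>"
      using True by (intro K.finsum_singleton) auto
    finally show ?thesis using True by (simp add: free_algebra_mult basis_vec_def)
  next
    case False
    have "?t i = \<zero>\<^bsub>K\<^esub>" for i
      using False append_take_drop_id[of i w] by (auto simp: basis_vec_def)
    then show ?thesis using False by (simp add: free_algebra_mult) (simp add: basis_vec_def)
  qed
qed

lemma free_algebra_mult_closed:
  assumes "cring K" and f: "f \<in> carrier (free_algebra K S)" and g: "g \<in> carrier (free_algebra K S)"
  shows "f \<otimes>\<^bsub>free_algebra K S\<^esub> g \<in> carrier (free_algebra K S)"
proof -
  interpret K: cring K by fact
  let ?B = "(\<lambda>(u, v). u @ v) ` ({u. f u \<noteq> \<zero>\<^bsub>K\<^esub>} \<times> {v. g v \<noteq> \<zero>\<^bsub>K\<^esub>})"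
  have K: "f w \<in> carrier K" "g w \<in> carrier K" for w using f g by (auto simp: image_subset_iff)
  have "f \<otimes>\<^bsub>free_algebra K S\<^esub> g \<in> carrier (free_module K (lists S))"
  proof (rule free_module_carrierI[where B="?B"])
    show "(f \<otimes>\<^bsub>free_algebra K S\<^esub> g) w \<in> carrier K" for w
      unfolding free_algebra_mult using K by (intro K.finsum_closed) auto
    show "finite ?B" using f g by auto
    have "{u. f u \<noteq> \<zero>\<^bsub>K\<^esub>} \<subseteq> lists S" "{v. g v \<noteq> \<zero>\<^bsub>K\<^esub>} \<subseteq> lists S" using f g by auto
    then show "?B \<subseteq> lists S" by (intro image_subsetI) (simp only: case_prod_beta mem_Times_iff append_in_lists_conv subsetD)
    fix w assume w: "w \<notin> ?B"
    have "f (take i w) \<otimes>\<^bsub>K\<^esub> g (drop i w) = \<zero>\<^bsub>K\<^esub>" for i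
    proof (rule ccontr)
      assume "f (take i w) \<otimes>\<^bsub>K\<^esub> g (drop i w) \<noteq> \<zero>\<^bsub>K\<^esub>"
      then have "f (take i w) \<noteq> \<zero>\<^bsub>K\<^esub>" "g (drop i w) \<noteq> \<zero>\<^bsub>K\<^esub>" using K by auto
      then have "(take i w, drop i w) \<in> {u. f u \<noteq> \<zero>\<^bsub>K\<^esub>} \<times> {v. g v \<noteq> \<zero>\<^bsub>K\<^esub>}" by simp
      then have "w \<in> ?B" by (rule rev_image_eqI) simp
      with w show False ..
    qed
    then show "(f \<otimes>\<^bsub>free_algebra K S\<^esub> g) w = \<zero>\<^bsub>K\<^esub>" by (simp add: free_algebra_mult)
  qed
  then show ?thesis by simp
qed

lemma free_algebra_bilin:
  assumes "cring K"
  shows "bilin K (free_algebra K S) (free_algebra K S) (free_algebra K S) (mult (free_algebra K S))"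
proof -
  interpret K: cring K by fact
  let ?F = "free_algebra K S"
  have c: "f w \<in> carrier K" if "f \<in> carrier ?F" for f w using that by (auto simp: image_subset_iff)
  show ?thesis
    unfolding bilin_def
  proof (intro conjI ballI linI free_algebra_mult_closed[OF assms])
    show "(f \<oplus>\<^bsub>?F\<^esub> g) \<otimes>\<^bsub>?F\<^esub> h = f \<otimes>\<^bsub>?F\<^esub> h \<oplus>\<^bsub>?F\<^esub> g \<otimes>\<^bsub>?F\<^esub> h"
      if "f \<in> carrier ?F" "g \<in> carrier ?F" "h \<in> carrier ?F" for f g h
      unfolding free_algebra_mult using c[OF that(1)] c[OF that(2)] c[OF that(3)]
      by (simp add: K.l_distr Pi_def flip: K.finsum_addf)
    show "h \<otimes>\<^bsub>?F\<^esub> (f \<oplus>\<^bsub>?F\<^esub> g) = h \<otimes>\<^bsub>?F\<^esub> f \<oplus>\<^bsub>?F\<^esub> h \<otimes>\<^bsub>?F\<^esub> g"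
      if "h \<in> carrier ?F" "f \<in> carrier ?F" "g \<in> carrier ?F" for f g h
      unfolding free_algebra_mult using c[OF that(1)] c[OF that(2)] c[OF that(3)]
      by (simp add: K.r_distr Pi_def flip: K.finsum_addf)
    show "(a \<odot>\<^bsub>?F\<^esub> f) \<otimes>\<^bsub>?F\<^esub> h = a \<odot>\<^bsub>?F\<^esub> (f \<otimes>\<^bsub>?F\<^esub> h)"
      if "a \<in> carrier K" "f \<in> carrier ?F" "h \<in> carrier ?F" for a f h
      unfolding free_algebra_mult using c[OF that(2)] c[OF that(3)] that(1)
      by (simp add: K.m_assoc K.finsum_rdistr Pi_def)
    show "h \<otimes>\<^bsub>?F\<^esub> (a \<odot>\<^bsub>?F\<^esub> f) = a \<odot>\<^bsub>?F\<^esub> (h \<otimes>\<^bsub>?F\<^esub> f)"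
      if "h \<in> carrier ?F" "a \<in> carrier K" "f \<in> carrier ?F" for a f h
      unfolding free_algebra_mult using c[OF that(1)] c[OF that(3)] that(2)
      by (simp add: K.m_lcomm K.finsum_rdistr Pi_def)
  qed
qed

text \<open>
  All laws are multilinear, so they need only be checked on words, where the product is
  concatenation; no double sums over factorisations of words occur.
\<close>

lemma free_algebra_kalg:
  assumes K: "cring K"
  shows "kalg K (free_algebra K S)"
proof -
  let ?F = "free_algebra K S" and ?e = "basis_vec K"
  note F = free_algebra_module[OF K, of S]
  note bil = free_algebra_bilin[OF K, of S]
  have l1: "lin K ?F ?F (\<lambda>f. f \<otimes>\<^bsub>?F\<^esub> g)" if "g \<in> carrier ?F" for g
    using bil that unfolding bilin_def by blast
  have l2: "lin K ?F ?F (\<lambda>f. g \<otimes>\<^bsub>?F\<^esub> f)" if "g \<in> carrier ?F" for g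
    using bil that unfolding bilin_def by blast
  have e: "?e w \<in> carrier ?F" if "w \<in> lists S" for w
    using basis_vec_carrier[OF K that] by simp
  have E: "?e ` lists S \<subseteq> carrier ?F" using e by (rule image_subsetI)
  have ext: "f x = g x" if "lin K ?F ?F f" "lin K ?F ?F g" "\<And>w. w \<in> lists S \<Longrightarrow> f (?e w) = g (?e w)"
      "x \<in> carrier ?F" for f g x
    by (rule lin_eq_on_span[OF F F that(1,2) E]) (use that(3,4) in \<open>auto simp only: free_algebra_span[OF K]\<close>)
  note m = free_algebra_mult_closed[OF K, of _ S]
  have a1: "(?e u \<otimes>\<^bsub>?F\<^esub> ?e v) \<otimes>\<^bsub>?F\<^esub> h = ?e u \<otimes>\<^bsub>?F\<^esub> (?e v \<otimes>\<^bsub>?F\<^esub> h)"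
    if "u \<in> lists S" "v \<in> lists S" "h \<in> carrier ?F" for u v h
    by (rule ext[OF l2[OF m[OF e[OF that(1)] e[OF that(2)]]]
          lin_comp[OF l2[OF e[OF that(2)]] l2[OF e[OF that(1)]]] _ that(3)])
       (simp only: free_algebra_basis_mult[OF K] append_assoc)
  have a2: "(?e u \<otimes>\<^bsub>?F\<^esub> g) \<otimes>\<^bsub>?F\<^esub> h = ?e u \<otimes>\<^bsub>?F\<^esub> (g \<otimes>\<^bsub>?F\<^esub> h)"
    if "u \<in> lists S" "g \<in> carrier ?F" "h \<in> carrier ?F" for u g h
    by (rule ext[OF lin_comp[OF l2[OF e[OF that(1)]] l1[OF that(3)]]
          lin_comp[OF l1[OF that(3)] l2[OF e[OF that(1)]]] a1[OF that(1) _ that(3)] that(2)])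
  have assoc: "(f \<otimes>\<^bsub>?F\<^esub> g) \<otimes>\<^bsub>?F\<^esub> h = f \<otimes>\<^bsub>?F\<^esub> (g \<otimes>\<^bsub>?F\<^esub> h)"
    if "f \<in> carrier ?F" "g \<in> carrier ?F" "h \<in> carrier ?F" for f g h
    by (rule ext[OF lin_comp[OF l1[OF that(2)] l1[OF that(3)]] l1[OF m[OF that(2,3)]]
          a2[OF _ that(2,3)] that(1)])
  have nil: "?e [] \<in> carrier ?F" by (rule e) simp
  have one1: "?e [] \<otimes>\<^bsub>?F\<^esub> f = f" if "f \<in> carrier ?F" for f
    by (rule ext[OF l2[OF nil] lin_id _ that]) (simp only: free_algebra_basis_mult[OF K] append_Nil)
  have one2: "f \<otimes>\<^bsub>?F\<^esub> ?e [] = f" if "f \<in> carrier ?F" for f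
    by (rule ext[OF l1[OF nil] lin_id _ that]) (simp only: free_algebra_basis_mult[OF K] append_Nil2)
  have "Group.monoid ?F"
    by (rule monoidI; (simp only: free_algebra_simps(5))?; rule m nil assoc one1 one2)
  then have "ring ?F"
    using F lin_add[OF l1] lin_add[OF l2] by (intro ringI) (simp_all add: module_def del: free_algebra_simps)
  with F show ?thesis
    using lin_smult[OF l1] lin_smult[OF l2] unfolding kalg_def by blast
qed

section \<open>The tensor algebra\<close>

locale tensor_alg =
  fixes K :: "'k ring" and V :: "('k, 'v) module"
  assumes K: "field K" and V: "module K V"
begin

abbreviation "T \<equiv> tensor_algebra K V"
abbreviation "wd \<equiv> word K V"
abbreviation "Lists \<equiv> lists (carrier V)"
abbreviation (input) "FA \<equiv> free_algebra K (carrier V)"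

definition multilin_relators :: "('v list \<Rightarrow> 'k) set" where
  "multilin_relators = (let F = free_algebra K (carrier V); e = basis_vec K in
       {e [u \<oplus>\<^bsub>V\<^esub> v] \<ominus>\<^bsub>F\<^esub> (e [u] \<oplus>\<^bsub>F\<^esub> e [v]) | u v. u \<in> carrier V \<and> v \<in> carrier V} \<union>
       {e [c \<odot>\<^bsub>V\<^esub> v] \<ominus>\<^bsub>F\<^esub> (c \<odot>\<^bsub>F\<^esub> e [v]) | c v. c \<in> carrier K \<and> v \<in> carrier V})"

lemma multilin_ideal_eq: "multilin_ideal K V = Idl\<^bsub>FA\<^esub> multilin_relators"
  by (simp only: multilin_ideal_def multilin_relators_def Let_def)

lemma multilin_relators_mem:
  "u \<in> carrier V \<Longrightarrow> v \<in> carrier V \<Longrightarrow>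
     basis_vec K [u \<oplus>\<^bsub>V\<^esub> v] \<ominus>\<^bsub>FA\<^esub> (basis_vec K [u] \<oplus>\<^bsub>FA\<^esub> basis_vec K [v]) \<in> multilin_relators"
  "c \<in> carrier K \<Longrightarrow> v \<in> carrier V \<Longrightarrow>
     basis_vec K [c \<odot>\<^bsub>V\<^esub> v] \<ominus>\<^bsub>FA\<^esub> (c \<odot>\<^bsub>FA\<^esub> basis_vec K [v]) \<in> multilin_relators"
  unfolding multilin_relators_def Let_def by blast+

lemma multilin_relators_cases:
  assumes "r \<in> multilin_relators"
  obtains (add) u v where "u \<in> carrier V" "v \<in> carrier V"
      "r = basis_vec K [u \<oplus>\<^bsub>V\<^esub> v] \<ominus>\<^bsub>FA\<^esub> (basis_vec K [u] \<oplus>\<^bsub>FA\<^esub> basis_vec K [v])"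
    | (smult) c v where "c \<in> carrier K" "v \<in> carrier V"
      "r = basis_vec K [c \<odot>\<^bsub>V\<^esub> v] \<ominus>\<^bsub>FA\<^esub> (c \<odot>\<^bsub>FA\<^esub> basis_vec K [v])"
  using assms unfolding multilin_relators_def Let_def by blast

lemma K_cring: "cring K"
  using V by (simp add: module_def)

lemma FA: "kalg K FA"
  by (rule free_algebra_kalg[OF K_cring])

lemma basis_FA: "w \<in> Lists \<Longrightarrow> basis_vec K w \<in> carrier FA"
  using basis_vec_carrier[OF K_cring] by (simp only: free_algebra_simps)

lemma V_closed: "u \<in> carrier V \<Longrightarrow> v \<in> carrier V \<Longrightarrow> u \<oplus>\<^bsub>V\<^esub> v \<in> carrier V"
  "c \<in> carrier K \<Longrightarrow> v \<in> carrier V \<Longrightarrow> c \<odot>\<^bsub>V\<^esub> v \<in> carrier V"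
proof -
  interpret V: module K V by (rule V)
  show "u \<in> carrier V \<Longrightarrow> v \<in> carrier V \<Longrightarrow> u \<oplus>\<^bsub>V\<^esub> v \<in> carrier V"
    "c \<in> carrier K \<Longrightarrow> v \<in> carrier V \<Longrightarrow> c \<odot>\<^bsub>V\<^esub> v \<in> carrier V" by simp_all
qed

lemma FA_closed: "x \<in> carrier FA \<Longrightarrow> y \<in> carrier FA \<Longrightarrow> x \<oplus>\<^bsub>FA\<^esub> y \<in> carrier FA"
  "x \<in> carrier FA \<Longrightarrow> y \<in> carrier FA \<Longrightarrow> x \<ominus>\<^bsub>FA\<^esub> y \<in> carrier FA"
  "c \<in> carrier K \<Longrightarrow> x \<in> carrier FA \<Longrightarrow> c \<odot>\<^bsub>FA\<^esub> x \<in> carrier FA"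
proof -
  interpret F: module K FA by (rule kalg_module[OF FA])
  show "x \<in> carrier FA \<Longrightarrow> y \<in> carrier FA \<Longrightarrow> x \<oplus>\<^bsub>FA\<^esub> y \<in> carrier FA"
    "x \<in> carrier FA \<Longrightarrow> y \<in> carrier FA \<Longrightarrow> x \<ominus>\<^bsub>FA\<^esub> y \<in> carrier FA"
    "c \<in> carrier K \<Longrightarrow> x \<in> carrier FA \<Longrightarrow> c \<odot>\<^bsub>FA\<^esub> x \<in> carrier FA"
    by (simp_all del: free_algebra_simps)
qed

lemma multilin_relators_carrier: "multilin_relators \<subseteq> carrier FA"
proof
  fix r assume "r \<in> multilin_relators"
  then show "r \<in> carrier FA"
    by (cases rule: multilin_relators_cases)
       (simp_all only: FA_closed basis_FA V_closed lists.Cons lists.Nil Cons_in_lists_iff simp_thms)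
qed

lemma multilin_ideal_ideal: "ideal (multilin_ideal K V) FA"
  unfolding multilin_ideal_eq by (rule ring.genideal_ideal[OF kalg_ring[OF FA] multilin_relators_carrier])

lemma multilin_ideal_submodule: "submodule (multilin_ideal K V) K FA"
  by (rule kalg_ideal_submodule[OF FA multilin_ideal_ideal])

lemma T_kalg: "kalg K T"
  unfolding tensor_algebra_def by (rule kalg_quot[OF FA multilin_ideal_ideal])

lemmas T_module = kalg_module[OF T_kalg] and T_ring = kalg_ring[OF T_kalg]

lemma word_closed: "w \<in> Lists \<Longrightarrow> wd w \<in> carrier T"
  unfolding word_def tensor_algebra_def quot_simps(1) by (intro imageI basis_FA)

lemma word_mult: "u \<in> Lists \<Longrightarrow> v \<in> Lists \<Longrightarrow> wd u \<otimes>\<^bsub>T\<^esub> wd v = wd (u @ v)"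
  unfolding word_def tensor_algebra_def
  by (simp only: kalg_quot_mult[OF multilin_ideal_ideal basis_FA basis_FA] free_algebra_basis_mult[OF K_cring])

lemma word_Nil: "wd [] = \<one>\<^bsub>T\<^esub>"
  by (simp add: word_def tensor_algebra_def quot_simps)

lemma T_span: "lspan K T (wd ` Lists) = carrier T"
proof
  have c: "wd ` Lists \<subseteq> carrier T" using word_closed by blast
  show "lspan K T (wd ` Lists) \<subseteq> carrier T" by (rule lspan_carrier[OF T_module c])
  note q = quot_proj_lin[OF kalg_module[OF FA] multilin_ideal_submodule, folded tensor_algebra_def]
  show "carrier T \<subseteq> lspan K T (wd ` Lists)"
  proof
    fix X assume "X \<in> carrier T"
    then obtain f where f: "f \<in> carrier FA" "X = multilin_ideal K V +>\<^bsub>FA\<^esub> f"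
      unfolding tensor_algebra_def by (rule quot_carrierE)
    have "multilin_ideal K V +>\<^bsub>FA\<^esub> f \<in> lspan K T (wd ` Lists)"
    proof (rule lin_span_mem[OF kalg_module[OF FA] T_module q])
      show "basis_vec K ` Lists \<subseteq> carrier FA" using basis_FA by (rule image_subsetI)
      show "submodule (lspan K T (wd ` Lists)) K T" by (rule lspan_submodule[OF T_module c])
      show "f \<in> lspan K FA (basis_vec K ` Lists)" using f(1) by (simp only: free_algebra_span[OF K_cring])
      fix b assume "b \<in> basis_vec K ` Lists"
      then show "multilin_ideal K V +>\<^bsub>FA\<^esub> b \<in> lspan K T (wd ` Lists)"
        by (intro lspan_base) (auto simp: word_def)
    qed
    then show "X \<in> lspan K T (wd ` Lists)" by (simp only: f)
  qed
qed

lemma words_closed: "wd ` Lists \<subseteq> carrier T"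
  using word_closed by blast

lemma T_lin_eq:
  assumes "module K P" "lin K T P f" "lin K T P g" "\<And>w. w \<in> Lists \<Longrightarrow> f (wd w) = g (wd w)" "x \<in> carrier T"
  shows "f x = g x"
  by (rule lin_eq_on_span[OF T_module assms(1-3) words_closed]) (use assms(4,5) in \<open>auto simp: T_span\<close>)

text \<open>
  Linear maps out of the tensor algebra are families of multilinear maps: multilinearity says
  exactly that the extension to the free algebra kills \<open>u r v\<close> for words \<open>u\<close>, \<open>v\<close> and relators \<open>r\<close>, and
  these span the ideal.
\<close>

lemma T_lift:
  fixes P :: "('k, 'p, 'z) module_scheme"
  assumes P: "module K P" and cl: "\<And>w. w \<in> Lists \<Longrightarrow> \<phi> w \<in> carrier P"
    and ad: "\<And>u x y v. u \<in> Lists \<Longrightarrow> x \<in> carrier V \<Longrightarrow> y \<in> carrier V \<Longrightarrow> v \<in> Lists \<Longrightarrow>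
       \<phi> (u @ (x \<oplus>\<^bsub>V\<^esub> y) # v) = \<phi> (u @ x # v) \<oplus>\<^bsub>P\<^esub> \<phi> (u @ y # v)"
    and sm: "\<And>u c x v. u \<in> Lists \<Longrightarrow> c \<in> carrier K \<Longrightarrow> x \<in> carrier V \<Longrightarrow> v \<in> Lists \<Longrightarrow>
       \<phi> (u @ (c \<odot>\<^bsub>V\<^esub> x) # v) = c \<odot>\<^bsub>P\<^esub> \<phi> (u @ x # v)"
  shows "\<exists>h. lin K T P h \<and> (\<forall>w\<in>Lists. h (wd w) = \<phi> w)"
proof -
  note FM = kalg_module[OF FA] and FR = kalg_ring[OF FA]
  let ?e = "basis_vec K"
  obtain h where h0: "lin K (free_module K Lists) P h" and hv: "\<And>w. w \<in> Lists \<Longrightarrow> h (?e w) = \<phi> w"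
    using free_module_universal[OF P, of Lists \<phi>] cl by blast
  have h: "lin K FA P h" using h0 by (simp add: lin_def)
  have "h y = \<zero>\<^bsub>P\<^esub>" if "y \<in> multilin_ideal K V" for y
  proof -
    have "h y \<in> {\<zero>\<^bsub>P\<^esub>}"
    proof (rule lin_genideal_mem[OF FA _ free_algebra_span[OF K_cring] multilin_relators_carrier P h
            zero_submodule[OF P] _ that[unfolded multilin_ideal_eq]])
      show "?e ` Lists \<subseteq> carrier FA" using basis_FA by (rule image_subsetI)
      fix u r v assume "u \<in> ?e ` Lists" and r: "r \<in> multilin_relators" and "v \<in> ?e ` Lists"
      then obtain u' v' where u: "u = ?e u'" "u' \<in> Lists" and v: "v = ?e v'" "v' \<in> Lists" by blast
      have l: "lin K FA P (\<lambda>x. h (u \<otimes>\<^bsub>FA\<^esub> x \<otimes>\<^bsub>FA\<^esub> v))"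
        using lin_comp[OF kalg_lin_r[OF FA basis_FA[OF u(2)]] lin_comp[OF kalg_lin_l[OF FA basis_FA[OF v(2)]] h]]
        by (simp only: u(1) v(1))
      have lv: "h (u \<otimes>\<^bsub>FA\<^esub> ?e [x] \<otimes>\<^bsub>FA\<^esub> v) = \<phi> (u' @ x # v')" if "x \<in> carrier V" for x
        unfolding u(1) v(1) free_algebra_basis_mult[OF K_cring] using that u v by (subst hv) auto
      have e1: "?e [x] \<in> carrier FA" if "x \<in> carrier V" for x using that by (intro basis_FA) auto
      from r show "h (u \<otimes>\<^bsub>FA\<^esub> r \<otimes>\<^bsub>FA\<^esub> v) \<in> {\<zero>\<^bsub>P\<^esub>}"
      proof (cases rule: multilin_relators_cases)
        case (add x y)
        have "h (u \<otimes>\<^bsub>FA\<^esub> r \<otimes>\<^bsub>FA\<^esub> v) = \<phi> (u' @ (x \<oplus>\<^bsub>V\<^esub> y) # v') \<ominus>\<^bsub>P\<^esub> (\<phi> (u' @ x # v') \<oplus>\<^bsub>P\<^esub> \<phi> (u' @ y # v'))"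
          unfolding add(3) using add(1,2)
          by (simp only: lin_minus[OF FM P l] lin_add[OF l] FA_closed e1 V_closed lv)
        also have "\<dots> = \<zero>\<^bsub>P\<^esub>" using u v add(1,2) V_closed
          by (subst diff_eq_zero_iff[OF P]) (auto simp: ad[symmetric] intro!: cl)
        finally show ?thesis by simp
      next
        case (smult c x)
        have "h (u \<otimes>\<^bsub>FA\<^esub> r \<otimes>\<^bsub>FA\<^esub> v) = \<phi> (u' @ (c \<odot>\<^bsub>V\<^esub> x) # v') \<ominus>\<^bsub>P\<^esub> (c \<odot>\<^bsub>P\<^esub> \<phi> (u' @ x # v'))"
          unfolding smult(3) using smult(1,2)
          by (simp only: lin_minus[OF FM P l] lin_smult[OF l] FA_closed e1 V_closed lv)
        also have "\<dots> = \<zero>\<^bsub>P\<^esub>" using u v smult(1,2) V_closed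
          by (subst diff_eq_zero_iff[OF P]) (auto simp: sm[symmetric] intro!: cl)
        finally show ?thesis by simp
      qed
    qed
    then show ?thesis by simp
  qed
  from quot_lift[OF FM multilin_ideal_submodule P h this, folded tensor_algebra_def]
  obtain g where g: "lin K T P g" "\<And>x. x \<in> carrier FA \<Longrightarrow> g (multilin_ideal K V +>\<^bsub>FA\<^esub> x) = h x" by blast
  have "g (wd w) = \<phi> w" if "w \<in> Lists" for w
    unfolding word_def g(2)[OF basis_FA[OF that]] by (rule hv[OF that])
  with g(1) show ?thesis by blast
qed

lemma word_add:
  assumes "u \<in> Lists" "x \<in> carrier V" "y \<in> carrier V" "v \<in> Lists"
  shows "wd (u @ (x \<oplus>\<^bsub>V\<^esub> y) # v) = wd (u @ x # v) \<oplus>\<^bsub>T\<^esub> wd (u @ y # v)"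
proof -
  interpret T: ring T by (rule T_ring)
  have x: "[x] \<in> Lists" "[y] \<in> Lists" "[x \<oplus>\<^bsub>V\<^esub> y] \<in> Lists" using assms V_closed by auto
  note FM = kalg_module[OF FA]
  have "wd [x \<oplus>\<^bsub>V\<^esub> y] = wd [x] \<oplus>\<^bsub>T\<^esub> wd [y]"
    unfolding word_def tensor_algebra_def quot_add[OF FM multilin_ideal_submodule basis_FA[OF x(1)] basis_FA[OF x(2)]]
  proof (rule quot_proj_eqI[OF FM multilin_ideal_submodule basis_FA[OF x(3)]])
    show "basis_vec K [x] \<oplus>\<^bsub>FA\<^esub> basis_vec K [y] \<in> carrier FA" by (intro FA_closed basis_FA x)
    show "basis_vec K [x \<oplus>\<^bsub>V\<^esub> y] \<ominus>\<^bsub>FA\<^esub> (basis_vec K [x] \<oplus>\<^bsub>FA\<^esub> basis_vec K [y]) \<in> multilin_ideal K V"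
      using multilin_relators_mem(1)[OF assms(2,3)] ring.genideal_self[OF kalg_ring[OF FA] multilin_relators_carrier]
      unfolding multilin_ideal_eq by blast
  qed
  then have "wd u \<otimes>\<^bsub>T\<^esub> wd [x \<oplus>\<^bsub>V\<^esub> y] \<otimes>\<^bsub>T\<^esub> wd v = wd u \<otimes>\<^bsub>T\<^esub> wd [x] \<otimes>\<^bsub>T\<^esub> wd v \<oplus>\<^bsub>T\<^esub> wd u \<otimes>\<^bsub>T\<^esub> wd [y] \<otimes>\<^bsub>T\<^esub> wd v"
    using word_closed[OF assms(1)] word_closed[OF assms(4)] word_closed[OF x(1)] word_closed[OF x(2)]
    by (simp add: T.l_distr T.r_distr)
  then show ?thesis using assms x by (simp add: word_mult)
qed

lemma word_smult:
  assumes "u \<in> Lists" "c \<in> carrier K" "x \<in> carrier V" "v \<in> Lists"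
  shows "wd (u @ (c \<odot>\<^bsub>V\<^esub> x) # v) = c \<odot>\<^bsub>T\<^esub> wd (u @ x # v)"
proof -
  interpret T: ring T by (rule T_ring)
  have x: "[x] \<in> Lists" "[c \<odot>\<^bsub>V\<^esub> x] \<in> Lists" using assms V_closed by auto
  note FM = kalg_module[OF FA]
  have "wd [c \<odot>\<^bsub>V\<^esub> x] = c \<odot>\<^bsub>T\<^esub> wd [x]"
    unfolding word_def tensor_algebra_def quot_smult[OF FM multilin_ideal_submodule assms(2) basis_FA[OF x(1)]]
  proof (rule quot_proj_eqI[OF FM multilin_ideal_submodule basis_FA[OF x(2)]])
    show "c \<odot>\<^bsub>FA\<^esub> basis_vec K [x] \<in> carrier FA" by (intro FA_closed basis_FA x assms)
    show "basis_vec K [c \<odot>\<^bsub>V\<^esub> x] \<ominus>\<^bsub>FA\<^esub> (c \<odot>\<^bsub>FA\<^esub> basis_vec K [x]) \<in> multilin_ideal K V"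
      using multilin_relators_mem(2)[OF assms(2,3)] ring.genideal_self[OF kalg_ring[OF FA] multilin_relators_carrier]
      unfolding multilin_ideal_eq by blast
  qed
  then have "wd u \<otimes>\<^bsub>T\<^esub> wd [c \<odot>\<^bsub>V\<^esub> x] \<otimes>\<^bsub>T\<^esub> wd v = c \<odot>\<^bsub>T\<^esub> (wd u \<otimes>\<^bsub>T\<^esub> wd [x] \<otimes>\<^bsub>T\<^esub> wd v)"
    using word_closed[OF assms(1)] word_closed[OF assms(4)] word_closed[OF x(1)] assms(2)
    by (simp add: kalg_smult[OF T_kalg])
  then show ?thesis using assms x by (simp add: word_mult)
qed

end


section \<open>Tensor powers and contraction\<close>

text \<open>
  Membership of words in \<^const>\<open>lists\<close> is kept folded; the rules for \<open>Cons\<close> and append suffice.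
\<close>

declare in_lists_conv_set [simp del] in_listsD [rule del] in_listsI [rule del]

context tensor_alg
begin

lemma T_closed:
  "\<one>\<^bsub>T\<^esub> \<in> carrier T" "\<zero>\<^bsub>T\<^esub> \<in> carrier T"
  "x \<in> carrier T \<Longrightarrow> y \<in> carrier T \<Longrightarrow> x \<otimes>\<^bsub>T\<^esub> y \<in> carrier T"
  "x \<in> carrier T \<Longrightarrow> y \<in> carrier T \<Longrightarrow> x \<oplus>\<^bsub>T\<^esub> y \<in> carrier T"
  "c \<in> carrier K \<Longrightarrow> x \<in> carrier T \<Longrightarrow> c \<odot>\<^bsub>T\<^esub> x \<in> carrier T"
proof -
  interpret T: ring T by (rule T_ring)
  show "\<one>\<^bsub>T\<^esub> \<in> carrier T" "\<zero>\<^bsub>T\<^esub> \<in> carrier T"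
    "x \<in> carrier T \<Longrightarrow> y \<in> carrier T \<Longrightarrow> x \<otimes>\<^bsub>T\<^esub> y \<in> carrier T"
    "x \<in> carrier T \<Longrightarrow> y \<in> carrier T \<Longrightarrow> x \<oplus>\<^bsub>T\<^esub> y \<in> carrier T" by simp_all
  show "c \<in> carrier K \<Longrightarrow> x \<in> carrier T \<Longrightarrow> c \<odot>\<^bsub>T\<^esub> x \<in> carrier T"
    using module.smult_closed[OF T_module] .
qed

lemma T_assoc: "x \<in> carrier T \<Longrightarrow> y \<in> carrier T \<Longrightarrow> z \<in> carrier T \<Longrightarrow>
    x \<otimes>\<^bsub>T\<^esub> y \<otimes>\<^bsub>T\<^esub> z = x \<otimes>\<^bsub>T\<^esub> (y \<otimes>\<^bsub>T\<^esub> z)"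
proof -
  interpret T: ring T by (rule T_ring)
  show "x \<in> carrier T \<Longrightarrow> y \<in> carrier T \<Longrightarrow> z \<in> carrier T \<Longrightarrow>
    x \<otimes>\<^bsub>T\<^esub> y \<otimes>\<^bsub>T\<^esub> z = x \<otimes>\<^bsub>T\<^esub> (y \<otimes>\<^bsub>T\<^esub> z)" by (rule T.m_assoc)
qed

lemma vec_closed: "v \<in> carrier V \<Longrightarrow> wd [v] \<in> carrier T"
  by (rule word_closed) simp

lemma word_Cons: "v \<in> carrier V \<Longrightarrow> w \<in> Lists \<Longrightarrow> wd (v # w) = wd [v] \<otimes>\<^bsub>T\<^esub> wd w"
  by (simp add: word_mult)

lemma vec_lin: "lin K V T (\<lambda>v. wd [v])"
  using word_add[of "[]" _ _ "[]"] word_smult[of "[]" _ _ "[]"] vec_closed by (intro linI) simp_all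

abbreviation "wds n \<equiv> {wd w | w. w \<in> Lists \<and> length w = n}"

lemma Lists_Suc_cases:
  assumes "w \<in> Lists" "length w = Suc n"
  obtains v w' where "w = v # w'" "v \<in> carrier V" "w' \<in> Lists" "length w' = n"
  using assms by (cases w) auto

lemma wds_carrier: "wds n \<subseteq> carrier T"
  using word_closed by blast

lemma tpow_submodule: "submodule (tpow K V n) K T"
  unfolding tpow_def by (rule lspan_submodule[OF T_module wds_carrier])

lemma tpow_carrier: "x \<in> tpow K V n \<Longrightarrow> x \<in> carrier T"
  using submodule_subset[OF T_module tpow_submodule] by blast

lemma word_tpow: "w \<in> Lists \<Longrightarrow> length w = n \<Longrightarrow> wd w \<in> tpow K V n"
  unfolding tpow_def by (rule lspan_base) blast

lemma one_tpow: "\<one>\<^bsub>T\<^esub> \<in> tpow K V 0"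
  using word_tpow[of "[]" 0] by (simp add: word_Nil)

lemma T_mult_bilin: "bilin K T T T (mult T)"
  using kalg_lin_l[OF T_kalg] kalg_lin_r[OF T_kalg] by (simp add: bilin_def)

lemma tpow_mult:
  assumes "x \<in> tpow K V m" "y \<in> tpow K V n"
  shows "x \<otimes>\<^bsub>T\<^esub> y \<in> tpow K V (m + n)"
proof (rule bilin_lspan[OF T_module T_module T_module T_mult_bilin wds_carrier wds_carrier tpow_submodule])
  show "x \<in> lspan K T (wds m)" "y \<in> lspan K T (wds n)" using assms by (simp_all add: tpow_def)
  fix x y assume "x \<in> wds m" "y \<in> wds n"
  then show "x \<otimes>\<^bsub>T\<^esub> y \<in> tpow K V (m + n)" by (auto simp: word_mult intro!: word_tpow)
qed

lemma tpow_lin_eq: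
  assumes "module K P" "lin K T P f" "lin K T P g"
    "\<And>w. w \<in> Lists \<Longrightarrow> length w = n \<Longrightarrow> f (wd w) = g (wd w)" "x \<in> tpow K V n"
  shows "f x = g x"
  by (rule lin_eq_on_span[OF T_module assms(1-3) wds_carrier[of n]])
     (use assms(4,5) in \<open>auto simp: tpow_def\<close>)

definition deg_part :: "nat \<Rightarrow> ('k, 'v) talg \<Rightarrow> ('k, 'v) talg" where
  "deg_part p = (SOME h. lin K T T h \<and> (\<forall>w\<in>Lists. h (wd w) = (if length w = p then wd w else \<zero>\<^bsub>T\<^esub>)))"

lemma deg_part_props: "lin K T T (deg_part p) \<and> (\<forall>w\<in>Lists. deg_part p (wd w) = (if length w = p then wd w else \<zero>\<^bsub>T\<^esub>))"
proof -
  interpret TM: module K T by (rule T_module)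
  have "\<exists>h. lin K T T h \<and> (\<forall>w\<in>Lists. h (wd w) = (if length w = p then wd w else \<zero>\<^bsub>T\<^esub>))"
    by (rule T_lift[OF T_module]) (auto simp: word_add word_smult word_closed)
  then show ?thesis unfolding deg_part_def by (rule someI_ex)
qed

lemmas deg_part_lin = deg_part_props[THEN conjunct1]
  and deg_part_word = deg_part_props[THEN conjunct2, rule_format]

lemma deg_part_tpow: "x \<in> tpow K V m \<Longrightarrow> deg_part p x = (if m = p then x else \<zero>\<^bsub>T\<^esub>)"
  using tpow_lin_eq[OF T_module deg_part_lin lin_id, of m p x]
    tpow_lin_eq[OF T_module deg_part_lin lin_const_zero[OF T_module], of m p x]
  by (auto simp: deg_part_word)

text \<open>
  Contraction of the first tensor factor with a functional. These contractions detect
  membership in \<open>V \<otimes> U\<close> and map each intersectand \<open>V\<^bsup>\<otimes>i+1\<^esup> \<otimes> R \<otimes> V\<^bsup>\<otimes>j\<^esup>\<close> of \<open>J\<^sub>n\<^sub>+\<^sub>1\<close> into the intersectand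
  \<open>V\<^bsup>\<otimes>i\<^esup> \<otimes> R \<otimes> V\<^bsup>\<otimes>j\<^esup>\<close> of \<open>J\<^sub>n\<close>.
\<close>

definition contract :: "('v \<Rightarrow> 'k) \<Rightarrow> ('k, 'v) talg \<Rightarrow> ('k, 'v) talg" where
  "contract \<phi> = (SOME h. lin K T T h \<and>
     (\<forall>w\<in>Lists. h (wd w) = (case w of [] \<Rightarrow> \<zero>\<^bsub>T\<^esub> | v # w' \<Rightarrow> \<phi> v \<odot>\<^bsub>T\<^esub> wd w')))"

lemma contract_props:
  assumes \<phi>: "lin K V (scalars K) \<phi>"
  shows "lin K T T (contract \<phi>) \<and>
     (\<forall>w\<in>Lists. contract \<phi> (wd w) = (case w of [] \<Rightarrow> \<zero>\<^bsub>T\<^esub> | v # w' \<Rightarrow> \<phi> v \<odot>\<^bsub>T\<^esub> wd w'))"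
proof -
  interpret TM: module K T by (rule T_module)
  have c: "\<phi> v \<in> carrier K" if "v \<in> carrier V" for v using lin_closed[OF \<phi> that] by simp
  have "\<exists>h. lin K T T h \<and> (\<forall>w\<in>Lists. h (wd w) = (case w of [] \<Rightarrow> \<zero>\<^bsub>T\<^esub> | v # w' \<Rightarrow> \<phi> v \<odot>\<^bsub>T\<^esub> wd w'))"
  proof (rule T_lift[OF T_module])
    show "(case w of [] \<Rightarrow> \<zero>\<^bsub>T\<^esub> | v # w' \<Rightarrow> \<phi> v \<odot>\<^bsub>T\<^esub> wd w') \<in> carrier T" if "w \<in> Lists" for w
      using that c by (cases w) (auto intro: T_closed word_closed)
    fix u v assume u: "u \<in> Lists" and v: "v \<in> Lists"
    show "(case u @ (x \<oplus>\<^bsub>V\<^esub> y) # v of [] \<Rightarrow> \<zero>\<^bsub>T\<^esub> | v # w' \<Rightarrow> \<phi> v \<odot>\<^bsub>T\<^esub> wd w') =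
        (case u @ x # v of [] \<Rightarrow> \<zero>\<^bsub>T\<^esub> | v # w' \<Rightarrow> \<phi> v \<odot>\<^bsub>T\<^esub> wd w') \<oplus>\<^bsub>T\<^esub>
        (case u @ y # v of [] \<Rightarrow> \<zero>\<^bsub>T\<^esub> | v # w' \<Rightarrow> \<phi> v \<odot>\<^bsub>T\<^esub> wd w')"
      if "x \<in> carrier V" "y \<in> carrier V" for x y
      using u v that c lin_add[OF \<phi> that]
      by (cases u) (simp_all add: TM.smult_l_distr TM.smult_r_distr word_add word_closed)
    show "(case u @ (a \<odot>\<^bsub>V\<^esub> x) # v of [] \<Rightarrow> \<zero>\<^bsub>T\<^esub> | v # w' \<Rightarrow> \<phi> v \<odot>\<^bsub>T\<^esub> wd w') =
        a \<odot>\<^bsub>T\<^esub> (case u @ x # v of [] \<Rightarrow> \<zero>\<^bsub>T\<^esub> | v # w' \<Rightarrow> \<phi> v \<odot>\<^bsub>T\<^esub> wd w')"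
      if "a \<in> carrier K" "x \<in> carrier V" for a x
      using u v that c lin_smult[OF \<phi> that]
      by (cases u) (simp_all add: TM.smult_assoc1[symmetric] TM.R.m_comm word_smult word_closed)
  qed
  then show ?thesis unfolding contract_def by (rule someI_ex)
qed

lemma contract_lin: "lin K V (scalars K) \<phi> \<Longrightarrow> lin K T T (contract \<phi>)"
  using contract_props by blast

lemma contract_vec_mult:
  assumes \<phi>: "lin K V (scalars K) \<phi>" and v: "v \<in> carrier V" and t: "t \<in> carrier T"
  shows "contract \<phi> (wd [v] \<otimes>\<^bsub>T\<^esub> t) = \<phi> v \<odot>\<^bsub>T\<^esub> t"
proof (rule T_lin_eq[OF T_module _ _ _ t])
  have c: "\<phi> v \<in> carrier K" using lin_closed[OF \<phi> v] by simp
  show "lin K T T (\<lambda>t. contract \<phi> (wd [v] \<otimes>\<^bsub>T\<^esub> t))"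
    by (rule lin_comp[OF kalg_lin_r[OF T_kalg vec_closed[OF v]] contract_lin[OF \<phi>]])
  show "lin K T T (\<lambda>t. \<phi> v \<odot>\<^bsub>T\<^esub> t)"
    by (rule lin_scale[OF T_module T_module lin_id c])
  show "contract \<phi> (wd [v] \<otimes>\<^bsub>T\<^esub> wd w) = \<phi> v \<odot>\<^bsub>T\<^esub> wd w" if "w \<in> Lists" for w
    using contract_props[OF \<phi>] that v by (simp flip: word_Cons)
qed

lemma contract_tpow:
  assumes \<phi>: "lin K V (scalars K) \<phi>" and x: "x \<in> tpow K V (Suc n)"
  shows "contract \<phi> x \<in> tpow K V n"
proof (rule lin_span_mem[OF T_module T_module contract_lin[OF \<phi>] wds_carrier tpow_submodule])
  show "x \<in> lspan K T (wds (Suc n))" using x by (simp add: tpow_def)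
  fix z assume "z \<in> wds (Suc n)"
  then obtain w0 where w0: "z = wd w0" "w0 \<in> Lists" "length w0 = Suc n" by blast
  from w0(2,3) obtain v w where "w0 = v # w" and z': "v \<in> carrier V" "w \<in> Lists" "length w = n"
    by (rule Lists_Suc_cases)
  with w0(1) have z: "z = wd (v # w)" "v \<in> carrier V" "w \<in> Lists" "length w = n" by simp_all
  have "contract \<phi> z = \<phi> v \<odot>\<^bsub>T\<^esub> wd w"
    unfolding z(1) word_Cons[OF z(2,3)] by (rule contract_vec_mult[OF \<phi> z(2) word_closed[OF z(3)]])
  then show "contract \<phi> z \<in> tpow K V n"
    using submodule_smult[OF T_module tpow_submodule _ word_tpow[OF z(3,4)]] lin_closed[OF \<phi> z(2)] by simp
qed

lemma contract_mult:
  assumes \<phi>: "lin K V (scalars K) \<phi>" and x: "x \<in> tpow K V (Suc n)" and t: "t \<in> carrier T"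
  shows "contract \<phi> (x \<otimes>\<^bsub>T\<^esub> t) = contract \<phi> x \<otimes>\<^bsub>T\<^esub> t"
proof (rule tpow_lin_eq[OF T_module _ _ _ x])
  show "lin K T T (\<lambda>x. contract \<phi> (x \<otimes>\<^bsub>T\<^esub> t))"
    by (rule lin_comp[OF kalg_lin_l[OF T_kalg t] contract_lin[OF \<phi>]])
  show "lin K T T (\<lambda>x. contract \<phi> x \<otimes>\<^bsub>T\<^esub> t)"
    by (rule lin_comp[OF contract_lin[OF \<phi>] kalg_lin_l[OF T_kalg t]])
  fix w assume "w \<in> Lists" "length w = Suc n"
  then obtain v w' where w: "w = v # w'" "v \<in> carrier V" "w' \<in> Lists" by (rule Lists_Suc_cases)
  have c: "\<phi> v \<in> carrier K" using lin_closed[OF \<phi> w(2)] by simp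
  have "contract \<phi> (wd w \<otimes>\<^bsub>T\<^esub> t) = contract \<phi> (wd [v] \<otimes>\<^bsub>T\<^esub> (wd w' \<otimes>\<^bsub>T\<^esub> t))"
    unfolding w(1) word_Cons[OF w(2,3)] using T_assoc[OF vec_closed[OF w(2)] word_closed[OF w(3)] t] by simp
  also have "\<dots> = (\<phi> v \<odot>\<^bsub>T\<^esub> wd w') \<otimes>\<^bsub>T\<^esub> t"
    using w t c by (simp add: contract_vec_mult[OF \<phi>] T_closed word_closed kalg_smult[OF T_kalg])
  also have "\<dots> = contract \<phi> (wd w) \<otimes>\<^bsub>T\<^esub> t"
    unfolding w(1) word_Cons[OF w(2,3)] contract_vec_mult[OF \<phi> w(2) word_closed[OF w(3)]] ..
  finally show "contract \<phi> (wd w \<otimes>\<^bsub>T\<^esub> t) = contract \<phi> (wd w) \<otimes>\<^bsub>T\<^esub> t" .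
qed

text \<open>
  A finite list of pairs \<open>(v, \<phi>)\<close> stands for the operator \<open>\<Sum> v \<otimes> \<phi>\<close> of finite rank on \<open>V\<close>; on the tensor
  algebra it acts on the first factor. Operators of this kind that fix a given finite set of vectors
  play the role of a basis of \<open>V\<close> with its dual coordinates.
\<close>

fun rank_op :: "('v \<times> ('v \<Rightarrow> 'k)) list \<Rightarrow> 'v \<Rightarrow> 'v" where
  "rank_op [] x = \<zero>\<^bsub>V\<^esub>"
| "rank_op ((v, \<phi>) # ps) x = \<phi> x \<odot>\<^bsub>V\<^esub> v \<oplus>\<^bsub>V\<^esub> rank_op ps x"

fun rank_op_T :: "('v \<times> ('v \<Rightarrow> 'k)) list \<Rightarrow> ('k, 'v) talg \<Rightarrow> ('k, 'v) talg" where
  "rank_op_T [] x = \<zero>\<^bsub>T\<^esub>"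
| "rank_op_T ((v, \<phi>) # ps) x = wd [v] \<otimes>\<^bsub>T\<^esub> contract \<phi> x \<oplus>\<^bsub>T\<^esub> rank_op_T ps x"

definition rank_data :: "('v \<times> ('v \<Rightarrow> 'k)) list \<Rightarrow> bool" where
  "rank_data ps \<longleftrightarrow> (\<forall>(v, \<phi>)\<in>set ps. v \<in> carrier V \<and> lin K V (scalars K) \<phi>)"

lemma rank_op_lin: "rank_data ps \<Longrightarrow> lin K V V (rank_op ps)"
proof (induction ps)
  case Nil
  have "lin K V V (\<lambda>x. \<zero>\<^bsub>V\<^esub>)" by (rule lin_const_zero[OF V])
  then show ?case by (simp add: lin_def)
next
  case (Cons p ps)
  interpret V: module K V by (rule V)
  obtain v \<phi> where p: "p = (v, \<phi>)" by (cases p)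
  have v: "v \<in> carrier V" and \<phi>: "lin K V (scalars K) \<phi>" and ps: "rank_data ps"
    using Cons.prems by (auto simp: p rank_data_def)
  have "lin K V V (\<lambda>x. \<phi> x \<odot>\<^bsub>V\<^esub> v)"
    using lin_closed[OF \<phi>] lin_add[OF \<phi>] lin_smult[OF \<phi>] v
    by (intro linI) (auto simp: V.smult_l_distr V.smult_assoc1)
  from lin_plus[OF V V this Cons.IH[OF ps]] show ?case by (simp add: p lin_def)
qed

lemma rank_op_T_lin: "rank_data ps \<Longrightarrow> lin K T T (rank_op_T ps)"
proof (induction ps)
  case Nil
  have "lin K T T (\<lambda>x. \<zero>\<^bsub>T\<^esub>)" by (rule lin_const_zero[OF T_module])
  then show ?case by (simp add: lin_def)
next
  case (Cons p ps)
  obtain v \<phi> where p: "p = (v, \<phi>)" by (cases p)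
  have v: "v \<in> carrier V" and \<phi>: "lin K V (scalars K) \<phi>" and ps: "rank_data ps"
    using Cons.prems by (auto simp: p rank_data_def)
  from lin_plus[OF T_module T_module
      lin_comp[OF contract_lin[OF \<phi>] kalg_lin_r[OF T_kalg vec_closed[OF v]]] Cons.IH[OF ps]]
  show ?case by (simp add: p lin_def)
qed

lemma rank_op_T_vec_mult:
  assumes "rank_data ps" "u \<in> carrier V" "t \<in> carrier T"
  shows "rank_op_T ps (wd [u] \<otimes>\<^bsub>T\<^esub> t) = wd [rank_op ps u] \<otimes>\<^bsub>T\<^esub> t"
  using assms(1)
proof (induction ps)
  case Nil
  interpret T: ring T by (rule T_ring)
  show ?case using lin_zero[OF V T_module vec_lin] assms(3) by simp
next
  case (Cons p ps)
  interpret T: ring T by (rule T_ring)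
  interpret V: module K V by (rule V)
  obtain v \<phi> where p: "p = (v, \<phi>)" by (cases p)
  have v: "v \<in> carrier V" and \<phi>: "lin K V (scalars K) \<phi>" and ps: "rank_data ps"
    using Cons.prems by (auto simp: p rank_data_def)
  have c: "\<phi> u \<in> carrier K" using lin_closed[OF \<phi> assms(2)] by simp
  have r: "rank_op ps u \<in> carrier V" using lin_closed[OF rank_op_lin[OF ps] assms(2)] .
  have "wd [\<phi> u \<odot>\<^bsub>V\<^esub> v \<oplus>\<^bsub>V\<^esub> rank_op ps u] = \<phi> u \<odot>\<^bsub>T\<^esub> wd [v] \<oplus>\<^bsub>T\<^esub> wd [rank_op ps u]"
    using lin_add[OF vec_lin _ r] lin_smult[OF vec_lin c v] c v by simp
  then show ?case
    using Cons.IH[OF ps] v c r assms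
    by (simp add: p contract_vec_mult[OF \<phi>] T.l_distr kalg_smult[OF T_kalg] vec_closed T_closed)
qed

text \<open>
  Induction on the vectors: if \<open>P\<close> fixes the previous ones and \<open>u' = u - P u\<close> is nonzero, a functional \<open>\<phi>\<close> with
  \<open>\<phi> u' = 1\<close> gives the corrected operator \<open>P + u' \<otimes> \<phi>(1 - P)\<close>, whose new term vanishes on everything that
  \<open>P\<close> fixes.
\<close>

lemma rank_op_fixes:
  assumes "set us \<subseteq> carrier V"
  shows "\<exists>ps. rank_data ps \<and> (\<forall>u\<in>set us. rank_op ps u = u)"
  using assms
proof (induction us)
  case Nil
  then show ?case by (intro exI[of _ "[]"]) (simp add: rank_data_def)
next
  case (Cons u us)
  interpret V: module K V by (rule V)
  from Cons obtain ps where ps: "rank_data ps" "\<And>x. x \<in> set us \<Longrightarrow> rank_op ps x = x" by auto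
  have u: "u \<in> carrier V" and us: "set us \<subseteq> carrier V" using Cons.prems by auto
  have rc: "rank_op ps x \<in> carrier V" if "x \<in> carrier V" for x using lin_closed[OF rank_op_lin[OF ps(1)] that] .
  define u' where "u' = u \<ominus>\<^bsub>V\<^esub> rank_op ps u"
  have u': "u' \<in> carrier V" using u rc by (simp add: u'_def)
  show ?case
  proof (cases "u' = \<zero>\<^bsub>V\<^esub>")
    case True
    then have "rank_op ps u = u" using diff_eq_zero_iff[OF V u rc[OF u]] by (simp add: u'_def)
    with ps show ?thesis by auto
  next
    case False
    then obtain \<phi> where \<phi>: "lin K V (scalars K) \<phi>" "\<phi> u' = \<one>\<^bsub>K\<^esub>" using exists_functional[OF K V u'] by blast
    define \<psi> where "\<psi> x = \<phi> (x \<ominus>\<^bsub>V\<^esub> rank_op ps x)" for x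
    have "lin K V (scalars K) \<psi>"
      unfolding \<psi>_def by (rule lin_comp[OF lin_diff[OF V V lin_id rank_op_lin[OF ps(1)]] \<phi>(1)])
    then have "rank_data ((u', \<psi>) # ps)" using ps(1) u' by (simp add: rank_data_def)
    moreover have "rank_op ((u', \<psi>) # ps) u = u"
    proof -
      have "rank_op ((u', \<psi>) # ps) u = u' \<oplus>\<^bsub>V\<^esub> rank_op ps u"
        using \<phi>(2) u' by (simp add: \<psi>_def flip: u'_def)
      also have "\<dots> = u" using u rc[OF u] by (simp add: u'_def V.minus_eq V.a_assoc V.l_neg)
      finally show ?thesis .
    qed
    moreover have "rank_op ((u', \<psi>) # ps) x = x" if x: "x \<in> set us" for x
    proof -
      have xc: "x \<in> carrier V" using us x by blast
      have "\<psi> x = \<zero>\<^bsub>K\<^esub>"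
        using ps(2)[OF x] diff_eq_zero_iff[OF V xc xc] lin_zero[OF V scalars_module[OF K_cring] \<phi>(1)]
        by (simp add: \<psi>_def)
      then show ?thesis using ps(2)[OF x] xc u' by simp
    qed
    ultimately show ?thesis by (intro exI[of _ "(u', \<psi>) # ps"]) simp
  qed
qed

lemma rank_op_T_fixes:
  assumes "x \<in> tpow K V (Suc n)"
  shows "\<exists>ps. rank_data ps \<and> rank_op_T ps x = x"
proof -
  have "\<exists>us. set us \<subseteq> carrier V \<and>
     (\<forall>ps. rank_data ps \<longrightarrow> (\<forall>u\<in>set us. rank_op ps u = u) \<longrightarrow> rank_op_T ps x = x)"
    using T_module wds_carrier assms[unfolded tpow_def]
  proof (induction rule: lspan_induct)
    case (base x)
    then obtain w0 where w0: "x = wd w0" "w0 \<in> Lists" "length w0 = Suc n" by blast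
    from w0(2,3) obtain v w where "w0 = v # w" and x': "v \<in> carrier V" "w \<in> Lists"
      by (rule Lists_Suc_cases)
    with w0(1) have x: "x = wd (v # w)" "v \<in> carrier V" "w \<in> Lists" by simp_all
    then show ?case
      unfolding x(1) word_Cons[OF x(2,3)]
      by (intro exI[of _ "[v]"]) (auto simp: rank_op_T_vec_mult word_closed)
  next
    case zero
    show ?case using lin_zero[OF T_module T_module rank_op_T_lin] by (intro exI[of _ "[]"]) simp
  next
    case (add x y)
    then obtain us us' where "set us \<subseteq> carrier V" "set us' \<subseteq> carrier V"
      "\<And>ps. rank_data ps \<Longrightarrow> (\<forall>u\<in>set us. rank_op ps u = u) \<Longrightarrow> rank_op_T ps x = x"
      "\<And>ps. rank_data ps \<Longrightarrow> (\<forall>u\<in>set us'. rank_op ps u = u) \<Longrightarrow> rank_op_T ps y = y" by blast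
    then show ?case using add(1,2)
      by (intro exI[of _ "us @ us'"]) (simp add: lin_add[OF rank_op_T_lin])
  next
    case (smult c x)
    then show ?case by (auto simp: lin_smult[OF rank_op_T_lin])
  qed
  then show ?thesis using rank_op_fixes by blast
qed

text \<open>
  A finite rank operator that fixes the first letters occurring in \<open>x\<close> fixes \<open>x\<close> and writes it as
  \<open>\<Sum> v \<otimes> \<phi>(x)\<close>, a sum over contractions of \<open>x\<close>.
\<close>

lemma left_factor:
  assumes x: "x \<in> tpow K V (Suc n)" and U: "submodule U K T"
    and c: "\<And>\<phi>. lin K V (scalars K) \<phi> \<Longrightarrow> contract \<phi> x \<in> U"
  shows "x \<in> lspan K T {wd [v] \<otimes>\<^bsub>T\<^esub> y | v y. v \<in> carrier V \<and> y \<in> U}"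
proof -
  let ?G = "{wd [v] \<otimes>\<^bsub>T\<^esub> y | v y. v \<in> carrier V \<and> y \<in> U}"
  have G: "?G \<subseteq> carrier T" using vec_closed submodule_subset[OF T_module U] T_closed(3) by blast
  note S = submodule_facts[OF T_module lspan_submodule[OF T_module G]]
  have r: "rank_op_T ps x \<in> lspan K T ?G" if "rank_data ps" for ps
    using that
  proof (induction ps)
    case Nil
    show ?case using S(2) by simp
  next
    case (Cons p ps)
    obtain v \<phi> where p: "p = (v, \<phi>)" by (cases p)
    have v: "v \<in> carrier V" and \<phi>: "lin K V (scalars K) \<phi>" and ps: "rank_data ps"
      using Cons.prems by (auto simp: p rank_data_def)
    have "wd [v] \<otimes>\<^bsub>T\<^esub> contract \<phi> x \<in> ?G" using v c[OF \<phi>] by blast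
    from S(3)[OF lspan_base[OF this] Cons.IH[OF ps]] show ?case by (simp add: p)
  qed
  from rank_op_T_fixes[OF x] obtain ps where ps: "rank_data ps" "rank_op_T ps x = x" by (elim exE conjE)
  show ?thesis using r[OF ps(1)] by (simp only: ps(2))
qed

section \<open>The spaces \<open>J\<^sub>n\<close>\<close>

abbreviation "shifted_gens R i j \<equiv>
  {u \<otimes>\<^bsub>T\<^esub> r \<otimes>\<^bsub>T\<^esub> v | u r v. u \<in> tpow K V i \<and> r \<in> R \<and> v \<in> tpow K V j}"

lemma shifted_eq: "shifted K V R i j = lspan K T (shifted_gens R i j)"
  by (simp only: shifted_def Let_def)

lemma shifted_gens_carrier: "R \<subseteq> carrier T \<Longrightarrow> shifted_gens R i j \<subseteq> carrier T"
  using tpow_carrier T_closed(3) by blast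

lemma shifted_submodule: "R \<subseteq> carrier T \<Longrightarrow> submodule (shifted K V R i j) K T"
  unfolding shifted_eq by (rule lspan_submodule[OF T_module shifted_gens_carrier])

lemma J_space_iff:
  assumes "s \<le> n"
  shows "x \<in> J_space K V s R n \<longleftrightarrow> (\<forall>i j. i + s + j = n \<longrightarrow> x \<in> shifted K V R i j)"
  using assms by (auto simp: J_space_def)

lemma J_submodule:
  assumes R: "R \<subseteq> carrier T"
  shows "submodule (J_space K V s R n) K T"
proof (cases "n < s")
  case True
  then show ?thesis by (simp add: J_space_def tpow_submodule)
next
  case False
  then have J: "x \<in> J_space K V s R n \<longleftrightarrow> (\<forall>i j. i + s + j = n \<longrightarrow> x \<in> shifted K V R i j)" for x
    by (simp add: J_space_iff)
  note S = submodule_facts[OF T_module shifted_submodule[OF R]]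
  show ?thesis
  proof (rule submoduleI'[OF T_module])
    have "0 + s + (n - s) = n" using False by simp
    then show "J_space K V s R n \<subseteq> carrier T" using S(1) J by blast
  qed (simp_all add: J S(2,3,5))
qed

lemma J_tpow:
  assumes R: "R \<subseteq> tpow K V s"
  shows "J_space K V s R n \<subseteq> tpow K V n"
proof (cases "n < s")
  case True
  then show ?thesis by (simp add: J_space_def)
next
  case False
  have "shifted K V R 0 (n - s) \<subseteq> tpow K V n"
    unfolding shifted_eq
  proof (rule lspan_least[OF tpow_submodule], rule subsetI)
    fix z assume "z \<in> shifted_gens R 0 (n - s)"
    then obtain u r v where "z = u \<otimes>\<^bsub>T\<^esub> r \<otimes>\<^bsub>T\<^esub> v" "u \<in> tpow K V 0" "r \<in> tpow K V s" "v \<in> tpow K V (n - s)"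
      using R by blast
    then have "z \<in> tpow K V (0 + s + (n - s))" using tpow_mult by blast
    then show "z \<in> tpow K V n" using False by simp
  qed
  moreover have "J_space K V s R n \<subseteq> shifted K V R 0 (n - s)"
    using False by (auto simp: J_space_iff)
  ultimately show ?thesis by blast
qed

lemma contract_shifted:
  assumes \<phi>: "lin K V (scalars K) \<phi>" and R: "R \<subseteq> carrier T" and x: "x \<in> shifted K V R (Suc i) j"
  shows "contract \<phi> x \<in> shifted K V R i j"
proof (rule lin_span_mem[OF T_module T_module contract_lin[OF \<phi>] shifted_gens_carrier[OF R]
      shifted_submodule[OF R] _ x[unfolded shifted_eq]])
  fix z assume "z \<in> shifted_gens R (Suc i) j"
  then obtain u r v where z: "z = u \<otimes>\<^bsub>T\<^esub> r \<otimes>\<^bsub>T\<^esub> v" "u \<in> tpow K V (Suc i)" "r \<in> R" "v \<in> tpow K V j" by blast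
  have c: "r \<in> carrier T" "v \<in> carrier T" "u \<in> carrier T" "contract \<phi> u \<in> carrier T"
    using z R tpow_carrier contract_tpow[OF \<phi> z(2)] by blast+
  have "contract \<phi> z = contract \<phi> u \<otimes>\<^bsub>T\<^esub> r \<otimes>\<^bsub>T\<^esub> v"
    using c contract_mult[OF \<phi> z(2), of "r \<otimes>\<^bsub>T\<^esub> v"] by (simp add: z(1) T_assoc T_closed)
  then have "contract \<phi> z \<in> shifted_gens R i j" using z contract_tpow[OF \<phi> z(2)] by blast
  then show "contract \<phi> z \<in> shifted K V R i j" unfolding shifted_eq by (rule lspan_base)
qed

text \<open>
  Contraction sends the intersectand of \<open>J\<^sub>n\<^sub>+\<^sub>1\<close> with \<open>i + 1\<close> letters left of \<open>R\<close> to the one of \<open>J\<^sub>n\<close> with \<open>i\<close>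
  letters left of \<open>R\<close>, and every intersectand of \<open>J\<^sub>n\<close> is reached in this way. For \<open>n < s\<close> the space \<open>J\<^sub>n\<close> is the
  whole tensor power.
\<close>

lemma J_left:
  assumes R: "R \<subseteq> tpow K V s" and x: "x \<in> J_space K V s R (Suc n)"
  shows "x \<in> lspan K T {wd [v] \<otimes>\<^bsub>T\<^esub> y | v y. v \<in> carrier V \<and> y \<in> J_space K V s R n}"
proof (rule left_factor)
  have RT: "R \<subseteq> carrier T" using R tpow_carrier by blast
  show xt: "x \<in> tpow K V (Suc n)" using J_tpow[OF R] x by blast
  show "submodule (J_space K V s R n) K T" by (rule J_submodule[OF RT])
  fix \<phi> assume \<phi>: "lin K V (scalars K) \<phi>"
  show "contract \<phi> x \<in> J_space K V s R n"
  proof (cases "n < s")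
    case True
    then show ?thesis using contract_tpow[OF \<phi> xt] by (simp add: J_space_def)
  next
    case False
    have "contract \<phi> x \<in> shifted K V R i j" if ij: "i + s + j = n" for i j
    proof (rule contract_shifted[OF \<phi> RT])
      have "Suc i + s + j = Suc n" using ij by simp
      then show "x \<in> shifted K V R (Suc i) j"
        using x False J_space_iff[of s "Suc n" x R] by simp
    qed
    then show ?thesis using False by (simp add: J_space_iff)
  qed
qed

text \<open>
  Reversal of words is an anti-automorphism of \<open>T(V)\<close> that maps the spaces \<open>J\<^sub>n\<close> of \<open>R\<close> to those of the
  reversed relations. It reduces the inclusion on the right to the one on the left.
\<close>

definition reversal :: "('k, 'v) talg \<Rightarrow> ('k, 'v) talg" where
  "reversal = (SOME h. lin K T T h \<and> (\<forall>w\<in>Lists. h (wd w) = wd (rev w)))"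

lemma reversal_props: "lin K T T reversal \<and> (\<forall>w\<in>Lists. reversal (wd w) = wd (rev w))"
proof -
  have "\<exists>h. lin K T T h \<and> (\<forall>w\<in>Lists. h (wd w) = wd (rev w))"
  proof (rule T_lift[OF T_module])
    show "wd (rev w) \<in> carrier T" if "w \<in> Lists" for w using that by (intro word_closed) (simp add: in_lists_conv_set)
    fix u v assume uv: "u \<in> Lists" "v \<in> Lists"
    then have r: "rev v \<in> Lists" "rev u \<in> Lists" by (simp_all add: in_lists_conv_set)
    show "wd (rev (u @ (x \<oplus>\<^bsub>V\<^esub> y) # v)) = wd (rev (u @ x # v)) \<oplus>\<^bsub>T\<^esub> wd (rev (u @ y # v))"
      if "x \<in> carrier V" "y \<in> carrier V" for x y
      using word_add[OF r(1) that r(2)] by simp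
    show "wd (rev (u @ (c \<odot>\<^bsub>V\<^esub> x) # v)) = c \<odot>\<^bsub>T\<^esub> wd (rev (u @ x # v))"
      if "c \<in> carrier K" "x \<in> carrier V" for c x
      using word_smult[OF r(1) that r(2)] by simp
  qed
  then show ?thesis unfolding reversal_def by (rule someI_ex)
qed

lemmas reversal_lin = reversal_props[THEN conjunct1]
  and reversal_word = reversal_props[THEN conjunct2, rule_format]

lemma rev_Lists: "w \<in> Lists \<Longrightarrow> rev w \<in> Lists"
  by (simp add: in_lists_conv_set)

lemma reversal_reversal:
  assumes "x \<in> carrier T"
  shows "reversal (reversal x) = x"
  by (rule T_lin_eq[OF T_module lin_comp[OF reversal_lin reversal_lin] lin_id _ assms])
     (simp add: reversal_word rev_Lists)

lemma reversal_mult: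
  assumes x: "x \<in> carrier T" and y: "y \<in> carrier T"
  shows "reversal (x \<otimes>\<^bsub>T\<^esub> y) = reversal y \<otimes>\<^bsub>T\<^esub> reversal x"
proof (rule T_lin_eq[OF T_module lin_comp[OF kalg_lin_l[OF T_kalg y] reversal_lin]
      lin_comp[OF reversal_lin kalg_lin_r[OF T_kalg lin_closed[OF reversal_lin y]]] _ x])
  fix w assume w: "w \<in> Lists"
  show "reversal (wd w \<otimes>\<^bsub>T\<^esub> y) = reversal y \<otimes>\<^bsub>T\<^esub> reversal (wd w)"
  proof (rule T_lin_eq[OF T_module lin_comp[OF kalg_lin_r[OF T_kalg word_closed[OF w]] reversal_lin]
        lin_comp[OF reversal_lin kalg_lin_l[OF T_kalg lin_closed[OF reversal_lin word_closed[OF w]]]] _ y])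
    show "reversal (wd w \<otimes>\<^bsub>T\<^esub> wd w') = reversal (wd w') \<otimes>\<^bsub>T\<^esub> reversal (wd w)" if "w' \<in> Lists" for w'
      using w that by (simp add: word_mult reversal_word rev_Lists)
  qed
qed

lemma reversal_tpow:
  assumes "x \<in> tpow K V n"
  shows "reversal x \<in> tpow K V n"
proof (rule lin_span_mem[OF T_module T_module reversal_lin wds_carrier tpow_submodule])
  show "x \<in> lspan K T (wds n)" using assms by (simp add: tpow_def)
  show "reversal z \<in> tpow K V n" if "z \<in> wds n" for z
    using that by (auto simp: reversal_word intro!: word_tpow rev_Lists)
qed

lemma reversal_shifted:
  assumes R: "R \<subseteq> carrier T" and x: "x \<in> shifted K V R i j"
  shows "reversal x \<in> shifted K V (reversal ` R) j i"
proof (rule lin_span_mem[OF T_module T_module reversal_lin shifted_gens_carrier[OF R] _ _ x[unfolded shifted_eq]])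
  have R': "reversal ` R \<subseteq> carrier T" using R lin_closed[OF reversal_lin] by blast
  show "submodule (shifted K V (reversal ` R) j i) K T" by (rule shifted_submodule[OF R'])
  fix z assume "z \<in> shifted_gens R i j"
  then obtain u r v where z: "z = u \<otimes>\<^bsub>T\<^esub> r \<otimes>\<^bsub>T\<^esub> v" "u \<in> tpow K V i" "r \<in> R" "v \<in> tpow K V j" by blast
  have c: "r \<in> carrier T" "v \<in> carrier T" "u \<in> carrier T" using z R tpow_carrier by blast+
  have "reversal z = reversal v \<otimes>\<^bsub>T\<^esub> reversal r \<otimes>\<^bsub>T\<^esub> reversal u"
    using c by (simp add: z(1) reversal_mult T_closed T_assoc lin_closed[OF reversal_lin])
  then have "reversal z \<in> shifted_gens (reversal ` R) j i" using z reversal_tpow by blast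
  then show "reversal z \<in> shifted K V (reversal ` R) j i" unfolding shifted_eq by (rule lspan_base)
qed

lemma reversal_J:
  assumes R: "R \<subseteq> carrier T" and x: "x \<in> J_space K V s R n"
  shows "reversal x \<in> J_space K V s (reversal ` R) n"
proof (cases "n < s")
  case True
  then show ?thesis using x by (simp add: J_space_def reversal_tpow)
next
  case False
  have "reversal x \<in> shifted K V (reversal ` R) i j" if ij: "i + s + j = n" for i j
  proof (rule reversal_shifted[OF R])
    have "j + s + i = n" using ij by simp
    then show "x \<in> shifted K V R j i" using x False J_space_iff[of s n x R] by simp
  qed
  then show ?thesis using False by (simp add: J_space_iff)
qed

lemma J_right:
  assumes R: "R \<subseteq> tpow K V s" and x: "x \<in> J_space K V s R (Suc n)"
  shows "x \<in> lspan K T {y \<otimes>\<^bsub>T\<^esub> wd [v] | v y. v \<in> carrier V \<and> y \<in> J_space K V s R n}"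
proof -
  let ?R = "reversal ` R"
  let ?G = "{wd [v] \<otimes>\<^bsub>T\<^esub> y | v y. v \<in> carrier V \<and> y \<in> J_space K V s ?R n}"
  let ?G' = "{y \<otimes>\<^bsub>T\<^esub> wd [v] | v y. v \<in> carrier V \<and> y \<in> J_space K V s R n}"
  have RT: "R \<subseteq> carrier T" using R tpow_carrier by blast
  have R't: "?R \<subseteq> tpow K V s" using R reversal_tpow by blast
  then have R'T: "?R \<subseteq> carrier T" using tpow_carrier by blast
  have RR: "reversal ` ?R = R" using RT reversal_reversal by (force simp: image_image)
  note Jc = submodule_subset[OF T_module J_submodule]
  have G: "?G \<subseteq> carrier T" and G': "?G' \<subseteq> carrier T"
    using Jc[OF R'T] Jc[OF RT] vec_closed T_closed(3) by blast+
  have "reversal (reversal x) \<in> lspan K T ?G'"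
  proof (rule lin_span_mem[OF T_module T_module reversal_lin G lspan_submodule[OF T_module G']])
    show "reversal x \<in> lspan K T ?G" by (rule J_left[OF R't reversal_J[OF RT x]])
    fix z assume "z \<in> ?G"
    then obtain v y where z: "z = wd [v] \<otimes>\<^bsub>T\<^esub> y" "v \<in> carrier V" "y \<in> J_space K V s ?R n" by blast
    have y: "y \<in> carrier T" using z(3) Jc[OF R'T] by blast
    have "reversal z = reversal y \<otimes>\<^bsub>T\<^esub> wd [v]"
      using z y by (simp add: reversal_mult vec_closed reversal_word)
    moreover have "reversal y \<in> J_space K V s R n" using reversal_J[OF R'T z(3)] by (simp only: RR)
    ultimately have "reversal z \<in> ?G'" using z(2) by blast
    then show "reversal z \<in> lspan K T ?G'" by (rule lspan_base)
  qed
  moreover have "x \<in> carrier T" using Jc[OF RT] x by blast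
  ultimately show ?thesis by (simp add: reversal_reversal)
qed

end


section \<open>The algebra \<open>A\<close> and the ambient bimodule \<open>A \<otimes> T(V) \<otimes> A\<close>\<close>

locale koszul = tensor_alg K V for K :: "'k ring" and V :: "('k, 'v) module" +
  fixes s :: nat and R :: "('k, 'v) talg set"
  assumes s2: "s \<ge> 2" and R_tpow: "R \<subseteq> tpow K V s"
begin

abbreviation "A \<equiv> hom_algebra K V R"
abbreviation "pj \<equiv> proj K V R"
abbreviation "Ad \<equiv> hom_algebra_deg K V R"
abbreviation "AAT \<equiv> AT K V R"
abbreviation "TTA \<equiv> TA K V R"
abbreviation "AA \<equiv> ATA K V R"
abbreviation "p3 \<equiv> pure3 K V R"
abbreviation "J \<equiv> J_space K V s R"

lemma R_carrier: "R \<subseteq> carrier T"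
  using R_tpow tpow_carrier by blast

lemma IR: "ideal (Idl\<^bsub>T\<^esub> R) T"
  by (rule ring.genideal_ideal[OF T_ring R_carrier])

lemma A_kalg: "kalg K A"
  unfolding hom_algebra_def Let_def by (rule kalg_quot[OF T_kalg IR])

lemmas A_module = kalg_module[OF A_kalg] and A_ring = kalg_ring[OF A_kalg]

lemma A_closed:
  "\<one>\<^bsub>A\<^esub> \<in> carrier A" "\<zero>\<^bsub>A\<^esub> \<in> carrier A"
  "x \<in> carrier A \<Longrightarrow> y \<in> carrier A \<Longrightarrow> x \<otimes>\<^bsub>A\<^esub> y \<in> carrier A"
  "x \<in> carrier A \<Longrightarrow> y \<in> carrier A \<Longrightarrow> x \<oplus>\<^bsub>A\<^esub> y \<in> carrier A"
  "c \<in> carrier K \<Longrightarrow> x \<in> carrier A \<Longrightarrow> c \<odot>\<^bsub>A\<^esub> x \<in> carrier A"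
proof -
  interpret A: ring A by (rule A_ring)
  show "\<one>\<^bsub>A\<^esub> \<in> carrier A" "\<zero>\<^bsub>A\<^esub> \<in> carrier A"
    "x \<in> carrier A \<Longrightarrow> y \<in> carrier A \<Longrightarrow> x \<otimes>\<^bsub>A\<^esub> y \<in> carrier A"
    "x \<in> carrier A \<Longrightarrow> y \<in> carrier A \<Longrightarrow> x \<oplus>\<^bsub>A\<^esub> y \<in> carrier A" by simp_all
  show "c \<in> carrier K \<Longrightarrow> x \<in> carrier A \<Longrightarrow> c \<odot>\<^bsub>A\<^esub> x \<in> carrier A"
    using module.smult_closed[OF A_module] .
qed

lemma A_laws:
  "x \<in> carrier A \<Longrightarrow> \<one>\<^bsub>A\<^esub> \<otimes>\<^bsub>A\<^esub> x = x" "x \<in> carrier A \<Longrightarrow> x \<otimes>\<^bsub>A\<^esub> \<one>\<^bsub>A\<^esub> = x"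
  "x \<in> carrier A \<Longrightarrow> y \<in> carrier A \<Longrightarrow> z \<in> carrier A \<Longrightarrow> x \<otimes>\<^bsub>A\<^esub> y \<otimes>\<^bsub>A\<^esub> z = x \<otimes>\<^bsub>A\<^esub> (y \<otimes>\<^bsub>A\<^esub> z)"
  "x \<in> carrier A \<Longrightarrow> \<zero>\<^bsub>A\<^esub> \<otimes>\<^bsub>A\<^esub> x = \<zero>\<^bsub>A\<^esub>" "x \<in> carrier A \<Longrightarrow> x \<otimes>\<^bsub>A\<^esub> \<zero>\<^bsub>A\<^esub> = \<zero>\<^bsub>A\<^esub>"
proof -
  interpret A: ring A by (rule A_ring)
  show "x \<in> carrier A \<Longrightarrow> \<one>\<^bsub>A\<^esub> \<otimes>\<^bsub>A\<^esub> x = x" "x \<in> carrier A \<Longrightarrow> x \<otimes>\<^bsub>A\<^esub> \<one>\<^bsub>A\<^esub> = x"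
    "x \<in> carrier A \<Longrightarrow> y \<in> carrier A \<Longrightarrow> z \<in> carrier A \<Longrightarrow> x \<otimes>\<^bsub>A\<^esub> y \<otimes>\<^bsub>A\<^esub> z = x \<otimes>\<^bsub>A\<^esub> (y \<otimes>\<^bsub>A\<^esub> z)"
    "x \<in> carrier A \<Longrightarrow> \<zero>\<^bsub>A\<^esub> \<otimes>\<^bsub>A\<^esub> x = \<zero>\<^bsub>A\<^esub>" "x \<in> carrier A \<Longrightarrow> x \<otimes>\<^bsub>A\<^esub> \<zero>\<^bsub>A\<^esub> = \<zero>\<^bsub>A\<^esub>"
    by (simp_all add: A.m_assoc)
qed

lemma proj_eq: "pj t = Idl\<^bsub>T\<^esub> R +>\<^bsub>T\<^esub> t"
  by (simp add: proj_def Let_def)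

lemma proj_lin: "lin K T A pj"
  unfolding proj_eq hom_algebra_def Let_def
  by (rule quot_proj_lin[OF T_module kalg_ideal_submodule[OF T_kalg IR]])

lemma proj_closed: "t \<in> carrier T \<Longrightarrow> pj t \<in> carrier A"
  by (rule lin_closed[OF proj_lin])

lemma proj_mult: "x \<in> carrier T \<Longrightarrow> y \<in> carrier T \<Longrightarrow> pj x \<otimes>\<^bsub>A\<^esub> pj y = pj (x \<otimes>\<^bsub>T\<^esub> y)"
  unfolding proj_eq hom_algebra_def Let_def by (rule kalg_quot_mult[OF IR])

lemma proj_one: "pj \<one>\<^bsub>T\<^esub> = \<one>\<^bsub>A\<^esub>"
  by (simp add: proj_eq hom_algebra_def Let_def quot_simps)

lemma proj_surj:
  assumes "a \<in> carrier A"
  obtains t where "t \<in> carrier T" "a = pj t"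
  using assms unfolding hom_algebra_def Let_def proj_eq by (rule quot_carrierE)

lemma proj_ideal: "t \<in> Idl\<^bsub>T\<^esub> R \<Longrightarrow> pj t = \<zero>\<^bsub>A\<^esub>"
  using quot_eq_zero_iff[OF T_module kalg_ideal_submodule[OF T_kalg IR], of t] ideal.Icarr[OF IR, of t]
  by (simp add: proj_eq hom_algebra_def Let_def quot_simps)

lemma proj_R:
  assumes "r \<in> R" "x \<in> carrier T" "y \<in> carrier T"
  shows "pj (x \<otimes>\<^bsub>T\<^esub> r \<otimes>\<^bsub>T\<^esub> y) = \<zero>\<^bsub>A\<^esub>"
proof (rule proj_ideal)
  have "r \<in> Idl\<^bsub>T\<^esub> R" using ring.genideal_self[OF T_ring R_carrier] assms(1) by blast
  then show "x \<otimes>\<^bsub>T\<^esub> r \<otimes>\<^bsub>T\<^esub> y \<in> Idl\<^bsub>T\<^esub> R"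
    using assms(2,3) ideal.I_l_closed[OF IR] ideal.I_r_closed[OF IR] by blast
qed

lemma A_lift:
  fixes P :: "('k, 'p, 'z) module_scheme"
  assumes P: "module K P" and f: "lin K T P f"
    and R: "\<And>u r v. u \<in> Lists \<Longrightarrow> r \<in> R \<Longrightarrow> v \<in> Lists \<Longrightarrow> f (wd u \<otimes>\<^bsub>T\<^esub> r \<otimes>\<^bsub>T\<^esub> wd v) = \<zero>\<^bsub>P\<^esub>"
  shows "\<exists>h. lin K A P h \<and> (\<forall>t\<in>carrier T. h (pj t) = f t)"
  unfolding proj_eq hom_algebra_def Let_def
proof (rule quot_lift[OF T_module kalg_ideal_submodule[OF T_kalg IR] P f])
  fix y assume "y \<in> Idl\<^bsub>T\<^esub> R"
  have "f y \<in> {\<zero>\<^bsub>P\<^esub>}"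
    by (rule lin_genideal_mem[OF T_kalg words_closed T_span R_carrier P f zero_submodule[OF P] _ \<open>y \<in> _\<close>])
       (use R in auto)
  then show "f y = \<zero>\<^bsub>P\<^esub>" by simp
qed

lemma Ad_eq: "Ad p = pj ` tpow K V p"
  by (simp add: hom_algebra_deg_def)

lemma Ad_carrier: "a \<in> Ad p \<Longrightarrow> a \<in> carrier A"
  using proj_closed tpow_carrier by (auto simp: Ad_eq)

lemma Ad_mult: "a \<in> Ad p \<Longrightarrow> b \<in> Ad q \<Longrightarrow> a \<otimes>\<^bsub>A\<^esub> b \<in> Ad (p + q)"
  unfolding Ad_eq by (auto simp: proj_mult tpow_carrier tpow_mult)

lemma Ad_one: "\<one>\<^bsub>A\<^esub> \<in> Ad 0"
  unfolding Ad_eq proj_one[symmetric] by (rule imageI[OF one_tpow])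

lemma Ad_vec: "v \<in> carrier V \<Longrightarrow> pj (wd [v]) \<in> Ad 1"
  unfolding Ad_eq by (intro imageI word_tpow) auto

text \<open>
  Since \<open>R\<close> is homogeneous, \<open>u r v\<close> lies in a single degree for words \<open>u\<close> and \<open>v\<close>, so the projections of
  \<open>T(V)\<close> onto its homogeneous parts preserve the ideal and descend to \<open>A\<close>.
\<close>

lemma deg_part_A_ex:
  "\<exists>h. lin K A A h \<and> (\<forall>m. \<forall>a\<in>Ad m. h a = (if m = p then a else \<zero>\<^bsub>A\<^esub>))"
proof -
  have "\<exists>h. lin K A A h \<and> (\<forall>t\<in>carrier T. h (pj t) = pj (deg_part p t))"
  proof (rule A_lift[OF A_module lin_comp[OF deg_part_lin proj_lin]])
    fix u r v assume urv: "u \<in> Lists" "r \<in> R" "v \<in> Lists"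
    have "wd u \<otimes>\<^bsub>T\<^esub> r \<otimes>\<^bsub>T\<^esub> wd v \<in> tpow K V (length u + s + length v)"
      using urv R_tpow by (intro tpow_mult word_tpow) auto
    from deg_part_tpow[OF this, of p] show "pj (deg_part p (wd u \<otimes>\<^bsub>T\<^esub> r \<otimes>\<^bsub>T\<^esub> wd v)) = \<zero>\<^bsub>A\<^esub>"
      using proj_R[OF urv(2) word_closed[OF urv(1)] word_closed[OF urv(3)]]
        lin_zero[OF T_module A_module proj_lin] by simp
  qed
  then obtain h where h: "lin K A A h" "\<And>t. t \<in> carrier T \<Longrightarrow> h (pj t) = pj (deg_part p t)" by blast
  have "h a = (if m = p then a else \<zero>\<^bsub>A\<^esub>)" if a: "a \<in> Ad m" for a m
  proof -
    obtain t where t: "t \<in> tpow K V m" "a = pj t" using a unfolding Ad_eq by (rule imageE)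
    show ?thesis unfolding t(2)
      using h(2)[OF tpow_carrier[OF t(1)]] deg_part_tpow[OF t(1), of p] lin_zero[OF T_module A_module proj_lin] by simp
  qed
  with h(1) show ?thesis by blast
qed

definition deg_part_A :: "nat \<Rightarrow> ('k, 'v) halg \<Rightarrow> ('k, 'v) halg" where
  "deg_part_A p = (SOME h. lin K A A h \<and> (\<forall>m. \<forall>a\<in>Ad m. h a = (if m = p then a else \<zero>\<^bsub>A\<^esub>)))"

lemma deg_part_A_lin: "lin K A A (deg_part_A p)"
  and deg_part_A_Ad: "a \<in> Ad m \<Longrightarrow> deg_part_A p a = (if m = p then a else \<zero>\<^bsub>A\<^esub>)"
  using someI_ex[OF deg_part_A_ex[of p]] unfolding deg_part_A_def by blast+

lemma AAT_module: "module K AAT"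
  unfolding AT_def by (rule tensor_module[OF A_module T_module])

lemma TTA_module: "module K TTA"
  unfolding TA_def by (rule tensor_module[OF T_module A_module])

lemma AA_module: "module K AA"
  unfolding ATA_def by (rule tensor_module[OF AAT_module A_module])

lemma p3_lin:
  "x \<in> carrier T \<Longrightarrow> b \<in> carrier A \<Longrightarrow> lin K A AA (\<lambda>a. p3 a x b)"
  "a \<in> carrier A \<Longrightarrow> b \<in> carrier A \<Longrightarrow> lin K T AA (\<lambda>x. p3 a x b)"
  "a \<in> carrier A \<Longrightarrow> x \<in> carrier T \<Longrightarrow> lin K A AA (\<lambda>b. p3 a x b)"
proof -
  note l = tens_lin1[OF AAT_module A_module, folded ATA_def]
  show "lin K A AA (\<lambda>a. p3 a x b)" if "x \<in> carrier T" "b \<in> carrier A"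
    unfolding pure3_def
    by (rule lin_comp[OF tens_lin1[OF A_module T_module that(1), folded AT_def] l[OF that(2)]])
  show "lin K T AA (\<lambda>x. p3 a x b)" if "a \<in> carrier A" "b \<in> carrier A"
    unfolding pure3_def
    by (rule lin_comp[OF tens_lin2[OF A_module T_module that(1), folded AT_def] l[OF that(2)]])
  show "lin K A AA (\<lambda>b. p3 a x b)" if "a \<in> carrier A" "x \<in> carrier T"
    unfolding pure3_def
    using tens_lin2[OF AAT_module A_module, folded ATA_def] tens_closed[OF A_module T_module that, folded AT_def]
    by blast
qed

lemma p3_closed: "a \<in> carrier A \<Longrightarrow> x \<in> carrier T \<Longrightarrow> b \<in> carrier A \<Longrightarrow> p3 a x b \<in> carrier AA"
  using lin_closed[OF p3_lin(1)] .

lemma p3_zero: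
  "x \<in> carrier T \<Longrightarrow> b \<in> carrier A \<Longrightarrow> p3 \<zero>\<^bsub>A\<^esub> x b = \<zero>\<^bsub>AA\<^esub>"
  "a \<in> carrier A \<Longrightarrow> x \<in> carrier T \<Longrightarrow> p3 a x \<zero>\<^bsub>A\<^esub> = \<zero>\<^bsub>AA\<^esub>"
  using lin_zero[OF A_module AA_module p3_lin(1)] lin_zero[OF A_module AA_module p3_lin(3)] by blast+

lemma AA_lift:
  fixes Q :: "('k, 'q, 'z) module_scheme"
  assumes "module K Q"
    and "\<And>y z. y \<in> carrier T \<Longrightarrow> z \<in> carrier A \<Longrightarrow> lin K A Q (\<lambda>x. \<tau> x y z)"
    and "\<And>x z. x \<in> carrier A \<Longrightarrow> z \<in> carrier A \<Longrightarrow> lin K T Q (\<lambda>y. \<tau> x y z)"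
    and "\<And>x y. x \<in> carrier A \<Longrightarrow> y \<in> carrier T \<Longrightarrow> lin K A Q (\<lambda>z. \<tau> x y z)"
  shows "\<exists>h. lin K AA Q h \<and> (\<forall>x\<in>carrier A. \<forall>y\<in>carrier T. \<forall>z\<in>carrier A. h (p3 x y z) = \<tau> x y z)"
  unfolding ATA_def AT_def pure3_def
  by (rule tensor3_lift[OF A_module T_module A_module assms])

lemma AA_lin_eq:
  assumes Q: "module K Q" and f: "lin K AA Q f" and g: "lin K AA Q g"
    and eq: "\<And>a w b. a \<in> carrier A \<Longrightarrow> w \<in> Lists \<Longrightarrow> b \<in> carrier A \<Longrightarrow> f (p3 a (wd w) b) = g (p3 a (wd w) b)"
    and z: "z \<in> carrier AA"
  shows "f z = g z"
proof (rule tensor3_lin_eq[OF A_module T_module A_module Q])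
  show "lin K (tensor K (tensor K A T) A) Q f" "lin K (tensor K (tensor K A T) A) Q g"
    "z \<in> carrier (tensor K (tensor K A T) A)"
    using f g z by (simp_all only: ATA_def AT_def)
  fix a x b assume a: "a \<in> carrier A" and x: "x \<in> carrier T" and b: "b \<in> carrier A"
  have "f (p3 a x b) = g (p3 a x b)"
    by (rule T_lin_eq[OF Q lin_comp[OF p3_lin(2)[OF a b] f] lin_comp[OF p3_lin(2)[OF a b] g] eq[OF a _ b] x])
  then show "f (tens K (tensor K A T) A (tens K A T a x) b) = g (tens K (tensor K A T) A (tens K A T a x) b)"
    by (simp only: pure3_def AT_def)
qed

section \<open>The differentials\<close>

text \<open>
  Existence: for fixed \<open>a\<close> the prescribed values are multilinear in the word, hence define a linear
  map on \<open>T(V)\<close>, which depends linearly on \<open>a\<close>. Uniqueness: the elements \<open>a \<otimes> w\<close> with \<open>w\<close> a word span.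
\<close>

lemma delta_L_props:
  shows delta_L_lin: "lin K AAT AAT (\<delta>_L K V R)"
    and delta_L_Nil: "a \<in> carrier A \<Longrightarrow> \<delta>_L K V R (tens K A T a (wd [])) = \<zero>\<^bsub>AAT\<^esub>"
    and delta_L_Cons: "a \<in> carrier A \<Longrightarrow> v \<in> carrier V \<Longrightarrow> w \<in> Lists \<Longrightarrow>
      \<delta>_L K V R (tens K A T a (wd (v # w))) = tens K A T (a \<otimes>\<^bsub>A\<^esub> pj (wd [v])) (wd w)"
proof -
  let ?\<phi> = "\<lambda>a w. case w of [] \<Rightarrow> \<zero>\<^bsub>AAT\<^esub> | v # w' \<Rightarrow> tens K A T (a \<otimes>\<^bsub>A\<^esub> pj (wd [v])) (wd w')"
  interpret Q: module K AAT by (rule AAT_module)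
  note tl = tens_lin1[OF A_module T_module, folded AT_def] tens_lin2[OF A_module T_module, folded AT_def]
  note tc = tens_closed[OF A_module T_module, folded AT_def]
  have vc: "a \<otimes>\<^bsub>A\<^esub> pj (wd [v]) \<in> carrier A" if "a \<in> carrier A" "v \<in> carrier V" for a v
    using that by (intro A_closed proj_closed vec_closed)
  have \<phi>c: "?\<phi> a w \<in> carrier AAT" if "a \<in> carrier A" "w \<in> Lists" for a w
    using that by (cases w) (auto intro!: tc vc word_closed)
  have vl: "lin K V AAT (\<lambda>v. tens K A T (a \<otimes>\<^bsub>A\<^esub> pj (wd [v])) t)" if "a \<in> carrier A" "t \<in> carrier T" for a t
    by (rule lin_comp[OF lin_comp[OF vec_lin lin_comp[OF proj_lin kalg_lin_r[OF A_kalg that(1)]]] tl(1)[OF that(2)]])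
  have al: "lin K A AAT (\<lambda>a. ?\<phi> a w)" if "w \<in> Lists" for w
  proof (cases w)
    case Nil
    then show ?thesis using lin_const_zero[OF AAT_module] by simp
  next
    case (Cons v w')
    have "v \<in> carrier V" "w' \<in> Lists" using that Cons by auto
    then show ?thesis
      using lin_comp[OF kalg_lin_l[OF A_kalg proj_closed[OF vec_closed]] tl(1)[OF word_closed], of v w']
      by (simp add: Cons)
  qed
  have "\<exists>h. lin K T AAT h \<and> (\<forall>w\<in>Lists. h (wd w) = ?\<phi> a w)" if a: "a \<in> carrier A" for a
  proof (rule T_lift[OF AAT_module \<phi>c[OF a]])
    fix u v assume u: "u \<in> Lists" and v: "v \<in> Lists"
    show "?\<phi> a (u @ (x \<oplus>\<^bsub>V\<^esub> y) # v) = ?\<phi> a (u @ x # v) \<oplus>\<^bsub>AAT\<^esub> ?\<phi> a (u @ y # v)"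
      if xy: "x \<in> carrier V" "y \<in> carrier V" for x y
    proof (cases u)
      case Nil
      then show ?thesis using lin_add[OF vl[OF a word_closed[OF v]] xy] by simp
    next
      case (Cons z u')
      then have z: "z \<in> carrier V" "u' \<in> Lists" using u by auto
      have "u' @ x # v \<in> Lists" "u' @ y # v \<in> Lists" using z v xy by auto
      then show ?thesis
        using lin_add[OF tl(2)[OF vc[OF a z(1)]] word_closed word_closed, of "u' @ x # v" "u' @ y # v"]
        by (simp add: Cons word_add[OF z(2) xy v])
    qed
    show "?\<phi> a (u @ (c \<odot>\<^bsub>V\<^esub> x) # v) = c \<odot>\<^bsub>AAT\<^esub> ?\<phi> a (u @ x # v)"
      if cx: "c \<in> carrier K" "x \<in> carrier V" for c x
    proof (cases u)
      case Nil
      then show ?thesis using lin_smult[OF vl[OF a word_closed[OF v]] cx] by simp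
    next
      case (Cons z u')
      then have z: "z \<in> carrier V" "u' \<in> Lists" using u by auto
      have "u' @ x # v \<in> Lists" using z v cx by auto
      then show ?thesis
        using lin_smult[OF tl(2)[OF vc[OF a z(1)]] cx(1) word_closed, of "u' @ x # v"]
        by (simp add: Cons word_smult[OF z(2) cx v])
    qed
  qed
  then obtain h where h: "\<And>a. a \<in> carrier A \<Longrightarrow> lin K T AAT (h a)"
    and hv: "\<And>a w. a \<in> carrier A \<Longrightarrow> w \<in> Lists \<Longrightarrow> h a (wd w) = ?\<phi> a w" by metis
  have "bilin K A T AAT h"
    unfolding bilin_def
  proof (intro conjI ballI linI)
    show "h a t \<in> carrier AAT" "h a t \<in> carrier AAT" if "a \<in> carrier A" "t \<in> carrier T" for a t
      using lin_closed[OF h[OF that(1)] that(2)] by auto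
    show "h a (t \<oplus>\<^bsub>T\<^esub> t') = h a t \<oplus>\<^bsub>AAT\<^esub> h a t'" if "a \<in> carrier A" "t \<in> carrier T" "t' \<in> carrier T" for a t t'
      using lin_add[OF h[OF that(1)] that(2,3)] .
    show "h a (c \<odot>\<^bsub>T\<^esub> t) = c \<odot>\<^bsub>AAT\<^esub> h a t" if "a \<in> carrier A" "c \<in> carrier K" "t \<in> carrier T" for a t c
      using lin_smult[OF h[OF that(1)] that(2,3)] .
    show "h (a \<oplus>\<^bsub>A\<^esub> a') t = h a t \<oplus>\<^bsub>AAT\<^esub> h a' t" if "t \<in> carrier T" and a: "a \<in> carrier A" "a' \<in> carrier A" for a a' t
      by (rule T_lin_eq[OF AAT_module h[OF A_closed(4)[OF a]] lin_plus[OF T_module AAT_module h[OF a(1)] h[OF a(2)]] _ that(1)])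
         (use lin_add[OF al a] in \<open>simp add: hv a A_closed\<close>)
    show "h (c \<odot>\<^bsub>A\<^esub> a) t = c \<odot>\<^bsub>AAT\<^esub> h a t" if "t \<in> carrier T" and a: "c \<in> carrier K" "a \<in> carrier A" for c a t
      by (rule T_lin_eq[OF AAT_module h[OF A_closed(5)[OF a]] lin_scale[OF T_module AAT_module h[OF a(2)] a(1)] _ that(1)])
         (use lin_smult[OF al a] in \<open>simp add: hv a A_closed\<close>)
  qed
  from tensor_lift[OF A_module T_module AAT_module this, folded AT_def]
  obtain g where g: "lin K AAT AAT g" and gv: "\<And>a t. a \<in> carrier A \<Longrightarrow> t \<in> carrier T \<Longrightarrow> g (tens K A T a t) = h a t"
    by blast
  let ?P = "\<lambda>h. h \<in> linear_maps K AAT AAT \<and>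
       (\<forall>a\<in>carrier A. h (tens K A T a (wd [])) = \<zero>\<^bsub>AAT\<^esub>) \<and>
       (\<forall>a\<in>carrier A. \<forall>v\<in>carrier V. \<forall>w\<in>Lists.
          h (tens K A T a (wd (v # w))) = tens K A T (a \<otimes>\<^bsub>A\<^esub> pj (wd [v])) (wd w))"
  have ex: "?P (restrict g (carrier AAT))"
  proof (intro conjI ballI)
    show "restrict g (carrier AAT) \<in> linear_maps K AAT AAT" by (rule lin_restrict[OF AAT_module g])
    show "restrict g (carrier AAT) (tens K A T a (wd [])) = \<zero>\<^bsub>AAT\<^esub>" if "a \<in> carrier A" for a
      using that tc[OF that word_closed, of "[]"] by (simp add: gv word_closed hv)
    show "restrict g (carrier AAT) (tens K A T a (wd (v # w))) = tens K A T (a \<otimes>\<^bsub>A\<^esub> pj (wd [v])) (wd w)"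
      if "a \<in> carrier A" "v \<in> carrier V" "w \<in> Lists" for a v w
      using that tc[OF that(1) word_closed, of "v # w"] by (simp add: gv word_closed hv)
  qed
  have un: "f = f'" if f: "?P f" and f': "?P f'" for f f'
  proof (rule extensionalityI)
    show "f \<in> extensional (carrier AAT)" "f' \<in> extensional (carrier AAT)"
      using f f' by (simp_all add: linear_maps_iff)
    have l: "lin K AAT AAT f" "lin K AAT AAT f'" using f f' by (simp_all add: linear_maps_iff)
    fix z assume z: "z \<in> carrier AAT"
    show "f z = f' z"
    proof (rule tensor_lin_eq[OF A_module T_module AAT_module, where f=f and g=f' and z=z])
      show "lin K (tensor K A T) AAT f" "lin K (tensor K A T) AAT f'" "z \<in> carrier (tensor K A T)"
        using l z by (simp_all only: AT_def)
      fix a t assume a: "a \<in> carrier A" and t: "t \<in> carrier T"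
      show "f (tens K A T a t) = f' (tens K A T a t)"
      proof (rule T_lin_eq[OF AAT_module lin_comp[OF tl(2)[OF a] l(1)] lin_comp[OF tl(2)[OF a] l(2)] _ t])
        show "f (tens K A T a (wd w)) = f' (tens K A T a (wd w))" if "w \<in> Lists" for w
          using that f f' a by (cases w) simp_all
      qed
    qed
  qed
  have "?P (\<delta>_L K V R)"
    unfolding \<delta>_L_def Let_def by (rule theI[where P="?P", OF ex un[OF _ ex]])
  then show "lin K AAT AAT (\<delta>_L K V R)"
    "a \<in> carrier A \<Longrightarrow> \<delta>_L K V R (tens K A T a (wd [])) = \<zero>\<^bsub>AAT\<^esub>"
    "a \<in> carrier A \<Longrightarrow> v \<in> carrier V \<Longrightarrow> w \<in> Lists \<Longrightarrow>
      \<delta>_L K V R (tens K A T a (wd (v # w))) = tens K A T (a \<otimes>\<^bsub>A\<^esub> pj (wd [v])) (wd w)"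
    by (simp_all add: linear_maps_iff)
qed

lemma delta_R_props:
  shows delta_R_lin: "lin K TTA TTA (\<delta>_R K V R)"
    and delta_R_Nil: "a \<in> carrier A \<Longrightarrow> \<delta>_R K V R (tens K T A (wd []) a) = \<zero>\<^bsub>TTA\<^esub>"
    and delta_R_snoc: "a \<in> carrier A \<Longrightarrow> v \<in> carrier V \<Longrightarrow> w \<in> Lists \<Longrightarrow>
      \<delta>_R K V R (tens K T A (wd (w @ [v])) a) = tens K T A (wd w) (pj (wd [v]) \<otimes>\<^bsub>A\<^esub> a)"
proof -
  let ?\<phi> = "\<lambda>a w. if w = [] then \<zero>\<^bsub>TTA\<^esub> else tens K T A (wd (butlast w)) (pj (wd [last w]) \<otimes>\<^bsub>A\<^esub> a)"
  interpret Q: module K TTA by (rule TTA_module)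
  note tl = tens_lin1[OF T_module A_module, folded TA_def] tens_lin2[OF T_module A_module, folded TA_def]
  note tc = tens_closed[OF T_module A_module, folded TA_def]
  have vc: "pj (wd [v]) \<otimes>\<^bsub>A\<^esub> a \<in> carrier A" if "a \<in> carrier A" "v \<in> carrier V" for a v
    using that by (intro A_closed proj_closed vec_closed)
  have lst: "butlast w \<in> Lists \<and> last w \<in> carrier V" if "w \<in> Lists" "w \<noteq> []" for w
    using that by (cases w rule: rev_cases) auto
  have \<phi>c: "?\<phi> a w \<in> carrier TTA" if "a \<in> carrier A" "w \<in> Lists" for a w
    using that lst by (auto intro!: tc vc word_closed)
  have vl: "lin K V TTA (\<lambda>v. tens K T A t (pj (wd [v]) \<otimes>\<^bsub>A\<^esub> a))" if "a \<in> carrier A" "t \<in> carrier T" for a t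
    by (rule lin_comp[OF lin_comp[OF vec_lin lin_comp[OF proj_lin kalg_lin_l[OF A_kalg that(1)]]] tl(2)[OF that(2)]])
  have al: "lin K A TTA (\<lambda>a. ?\<phi> a w)" if "w \<in> Lists" for w
  proof (cases "w = []")
    case True
    then show ?thesis using lin_const_zero[OF TTA_module] by simp
  next
    case False
    then show ?thesis
      using lst[OF that] lin_comp[OF kalg_lin_r[OF A_kalg proj_closed[OF vec_closed]] tl(2)[OF word_closed], of "last w" "butlast w"]
      by simp
  qed
  have "\<exists>h. lin K T TTA h \<and> (\<forall>w\<in>Lists. h (wd w) = ?\<phi> a w)" if a: "a \<in> carrier A" for a
  proof (rule T_lift[OF TTA_module \<phi>c[OF a]])
    fix u v assume u: "u \<in> Lists" and v: "v \<in> Lists"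
    show "?\<phi> a (u @ (x \<oplus>\<^bsub>V\<^esub> y) # v) = ?\<phi> a (u @ x # v) \<oplus>\<^bsub>TTA\<^esub> ?\<phi> a (u @ y # v)"
      if xy: "x \<in> carrier V" "y \<in> carrier V" for x y
    proof (cases v rule: rev_cases)
      case Nil
      then show ?thesis using lin_add[OF vl[OF a word_closed[OF u]] xy] by simp
    next
      case (snoc v' z)
      then have z: "z \<in> carrier V" "v' \<in> Lists" using v by auto
      have "u @ x # v' \<in> Lists" "u @ y # v' \<in> Lists" using z u xy by auto
      then show ?thesis
        using lin_add[OF tl(1)[OF vc[OF a z(1)]] word_closed word_closed, of "u @ x # v'" "u @ y # v'"]
        by (simp add: snoc butlast_append word_add[OF u xy z(2)])
    qed
    show "?\<phi> a (u @ (c \<odot>\<^bsub>V\<^esub> x) # v) = c \<odot>\<^bsub>TTA\<^esub> ?\<phi> a (u @ x # v)"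
      if cx: "c \<in> carrier K" "x \<in> carrier V" for c x
    proof (cases v rule: rev_cases)
      case Nil
      then show ?thesis using lin_smult[OF vl[OF a word_closed[OF u]] cx] by simp
    next
      case (snoc v' z)
      then have z: "z \<in> carrier V" "v' \<in> Lists" using v by auto
      have "u @ x # v' \<in> Lists" using z u cx by auto
      then show ?thesis
        using lin_smult[OF tl(1)[OF vc[OF a z(1)]] cx(1) word_closed, of "u @ x # v'"]
        by (simp add: snoc butlast_append word_smult[OF u cx z(2)])
    qed
  qed
  then obtain h where h: "\<And>a. a \<in> carrier A \<Longrightarrow> lin K T TTA (h a)"
    and hv: "\<And>a w. a \<in> carrier A \<Longrightarrow> w \<in> Lists \<Longrightarrow> h a (wd w) = ?\<phi> a w" by metis
  have "bilin K T A TTA (\<lambda>t a. h a t)"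
    unfolding bilin_def
  proof (intro conjI ballI linI)
    show "h a t \<in> carrier TTA" "h a t \<in> carrier TTA" if "t \<in> carrier T" "a \<in> carrier A" for a t
      using lin_closed[OF h[OF that(2)] that(1)] by auto
    show "h a (t \<oplus>\<^bsub>T\<^esub> t') = h a t \<oplus>\<^bsub>TTA\<^esub> h a t'" if "a \<in> carrier A" "t \<in> carrier T" "t' \<in> carrier T" for a t t'
      using lin_add[OF h[OF that(1)] that(2,3)] .
    show "h a (c \<odot>\<^bsub>T\<^esub> t) = c \<odot>\<^bsub>TTA\<^esub> h a t" if "a \<in> carrier A" "c \<in> carrier K" "t \<in> carrier T" for a t c
      using lin_smult[OF h[OF that(1)] that(2,3)] .
    show "h (a \<oplus>\<^bsub>A\<^esub> a') t = h a t \<oplus>\<^bsub>TTA\<^esub> h a' t" if "t \<in> carrier T" and a: "a \<in> carrier A" "a' \<in> carrier A" for a a' t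
      by (rule T_lin_eq[OF TTA_module h[OF A_closed(4)[OF a]] lin_plus[OF T_module TTA_module h[OF a(1)] h[OF a(2)]] _ that(1)])
         (use lin_add[OF al a] in \<open>simp add: hv a A_closed\<close>)
    show "h (c \<odot>\<^bsub>A\<^esub> a) t = c \<odot>\<^bsub>TTA\<^esub> h a t" if "t \<in> carrier T" and a: "c \<in> carrier K" "a \<in> carrier A" for c a t
      by (rule T_lin_eq[OF TTA_module h[OF A_closed(5)[OF a]] lin_scale[OF T_module TTA_module h[OF a(2)] a(1)] _ that(1)])
         (use lin_smult[OF al a] in \<open>simp add: hv a A_closed\<close>)
  qed
  from tensor_lift[OF T_module A_module TTA_module this, folded TA_def]
  obtain g where g: "lin K TTA TTA g" and gv: "\<And>a t. a \<in> carrier A \<Longrightarrow> t \<in> carrier T \<Longrightarrow> g (tens K T A t a) = h a t"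
    by blast
  let ?P = "\<lambda>h. h \<in> linear_maps K TTA TTA \<and>
       (\<forall>a\<in>carrier A. h (tens K T A (wd []) a) = \<zero>\<^bsub>TTA\<^esub>) \<and>
       (\<forall>a\<in>carrier A. \<forall>v\<in>carrier V. \<forall>w\<in>Lists.
          h (tens K T A (wd (w @ [v])) a) = tens K T A (wd w) (pj (wd [v]) \<otimes>\<^bsub>A\<^esub> a))"
  have ex: "?P (restrict g (carrier TTA))"
  proof (intro conjI ballI)
    show "restrict g (carrier TTA) \<in> linear_maps K TTA TTA" by (rule lin_restrict[OF TTA_module g])
    show "restrict g (carrier TTA) (tens K T A (wd []) a) = \<zero>\<^bsub>TTA\<^esub>" if "a \<in> carrier A" for a
      using that tc[OF word_closed that, of "[]"] by (simp add: gv word_closed hv)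
    show "restrict g (carrier TTA) (tens K T A (wd (w @ [v])) a) = tens K T A (wd w) (pj (wd [v]) \<otimes>\<^bsub>A\<^esub> a)"
      if "a \<in> carrier A" "v \<in> carrier V" "w \<in> Lists" for a v w
      using that tc[OF word_closed that(1), of "w @ [v]"] by (simp add: gv word_closed hv)
  qed
  have un: "f = f'" if f: "?P f" and f': "?P f'" for f f'
  proof (rule extensionalityI)
    show "f \<in> extensional (carrier TTA)" "f' \<in> extensional (carrier TTA)"
      using f f' by (simp_all add: linear_maps_iff)
    have l: "lin K TTA TTA f" "lin K TTA TTA f'" using f f' by (simp_all add: linear_maps_iff)
    fix z assume z: "z \<in> carrier TTA"
    show "f z = f' z"
    proof (rule tensor_lin_eq[OF T_module A_module TTA_module, where f=f and g=f' and z=z])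
      show "lin K (tensor K T A) TTA f" "lin K (tensor K T A) TTA f'" "z \<in> carrier (tensor K T A)"
        using l z by (simp_all only: TA_def)
      fix t a assume t: "t \<in> carrier T" and a: "a \<in> carrier A"
      show "f (tens K T A t a) = f' (tens K T A t a)"
      proof (rule T_lin_eq[OF TTA_module lin_comp[OF tl(1)[OF a] l(1)] lin_comp[OF tl(1)[OF a] l(2)] _ t])
        show "f (tens K T A (wd w) a) = f' (tens K T A (wd w) a)" if "w \<in> Lists" for w
          using that f f' a by (cases w rule: rev_cases) simp_all
      qed
    qed
  qed
  have "?P (\<delta>_R K V R)"
    unfolding \<delta>_R_def Let_def by (rule theI[where P="?P", OF ex un[OF _ ex]])
  then show "lin K TTA TTA (\<delta>_R K V R)"
    "a \<in> carrier A \<Longrightarrow> \<delta>_R K V R (tens K T A (wd []) a) = \<zero>\<^bsub>TTA\<^esub>"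
    "a \<in> carrier A \<Longrightarrow> v \<in> carrier V \<Longrightarrow> w \<in> Lists \<Longrightarrow>
      \<delta>_R K V R (tens K T A (wd (w @ [v])) a) = tens K T A (wd w) (pj (wd [v]) \<otimes>\<^bsub>A\<^esub> a)"
    by (simp_all add: linear_maps_iff)
qed

abbreviation "dL \<equiv> \<delta>'_L K V R"
abbreviation "dR \<equiv> \<delta>'_R K V R"

lemma dL_lin: "lin K AA AA dL"
  unfolding \<delta>'_L_def Let_def ATA_def
  by (rule tensor_map_lin[OF AAT_module A_module AAT_module A_module delta_L_lin lin_id])

lemma dL_p3:
  assumes "a \<in> carrier A" "t \<in> carrier T" "b \<in> carrier A"
  shows "dL (p3 a t b) = tens K AAT A (\<delta>_L K V R (tens K A T a t)) b"
  unfolding \<delta>'_L_def Let_def pure3_def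
  using tensor_map_tens[OF AAT_module A_module AAT_module A_module delta_L_lin lin_id]
    tens_closed[OF A_module T_module assms(1,2), folded AT_def] assms(3) by simp

lemma dL_Nil:
  assumes "a \<in> carrier A" "b \<in> carrier A"
  shows "dL (p3 a (wd []) b) = \<zero>\<^bsub>AA\<^esub>"
  using dL_p3[OF assms(1) word_closed assms(2), of "[]"] delta_L_Nil[OF assms(1)]
    lin_zero[OF AAT_module AA_module tens_lin1[OF AAT_module A_module assms(2), folded ATA_def]] by simp

lemma dL_Cons:
  assumes "a \<in> carrier A" "v \<in> carrier V" "w \<in> Lists" "b \<in> carrier A"
  shows "dL (p3 a (wd (v # w)) b) = p3 (a \<otimes>\<^bsub>A\<^esub> pj (wd [v])) (wd w) b"
  using dL_p3[OF assms(1) word_closed assms(4), of "v # w"] delta_L_Cons[OF assms(1-3)] assms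
  by (simp add: pure3_def)

lemma dR_lin: "lin K AA AA dR"
proof -
  note a = tensor_assoc_lin[OF A_module T_module A_module, folded AT_def TA_def, folded ATA_def]
  note i = tensor_assoc_inv_lin[OF A_module T_module A_module, folded AT_def TA_def, folded ATA_def]
  note m = tensor_map_lin[OF A_module TTA_module A_module TTA_module lin_id delta_R_lin]
  show ?thesis
    unfolding \<delta>'_R_def Let_def o_def by (rule lin_comp[OF lin_comp[OF a m] i])
qed

lemma dR_p3:
  assumes "a \<in> carrier A" "t \<in> carrier T" "b \<in> carrier A"
  shows "dR (p3 a t b) = inv_into (carrier AA) (tensor_assoc K A T A)
    (tens K A TTA a (\<delta>_R K V R (tens K T A t b)))"
  using tensor_assoc_tens[OF A_module T_module A_module assms, folded AT_def TA_def]
    tensor_map_tens[OF A_module TTA_module A_module TTA_module lin_id delta_R_lin assms(1)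
      tens_closed[OF T_module A_module assms(2,3), folded TA_def]]
  unfolding \<delta>'_R_def Let_def o_def pure3_def by simp

lemma dR_Nil:
  assumes "a \<in> carrier A" "b \<in> carrier A"
  shows "dR (p3 a (wd []) b) = \<zero>\<^bsub>AA\<^esub>"
proof -
  note i = tensor_assoc_inv_lin[OF A_module T_module A_module, folded AT_def TA_def, folded ATA_def]
  note T2 = tensor_module[OF A_module TTA_module]
  show ?thesis
    using dR_p3[OF assms(1) word_closed assms(2), of "[]"] delta_R_Nil[OF assms(2)]
      lin_zero[OF TTA_module T2 tens_lin2[OF A_module TTA_module assms(1)]] lin_zero[OF T2 AA_module i] by simp
qed

lemma dR_snoc:
  assumes "a \<in> carrier A" "v \<in> carrier V" "w \<in> Lists" "b \<in> carrier A"
  shows "dR (p3 a (wd (w @ [v])) b) = p3 a (wd w) (pj (wd [v]) \<otimes>\<^bsub>A\<^esub> b)"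
proof -
  have "pj (wd [v]) \<otimes>\<^bsub>A\<^esub> b \<in> carrier A" using assms by (intro A_closed proj_closed vec_closed)
  from tensor_assoc_inv_tens[OF A_module T_module A_module assms(1) word_closed[OF assms(3)] this,
      folded AT_def TA_def, folded ATA_def]
  show ?thesis
    using dR_p3[OF assms(1) word_closed assms(4), of "w @ [v]"] delta_R_snoc[OF assms(4,2,3)] assms
    by (simp add: pure3_def)
qed

text \<open>
  The tail of the word may be replaced by any tensor, which is the form suited to \<open>V \<otimes> J\<^sub>n\<close>.
\<close>

lemma dL_vec_mult:
  assumes a: "a \<in> carrier A" and v: "v \<in> carrier V" and t: "t \<in> carrier T" and b: "b \<in> carrier A"
  shows "dL (p3 a (wd [v] \<otimes>\<^bsub>T\<^esub> t) b) = p3 (a \<otimes>\<^bsub>A\<^esub> pj (wd [v])) t b"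
proof (rule T_lin_eq[OF AA_module _ _ _ t])
  show "lin K T AA (\<lambda>t. dL (p3 a (wd [v] \<otimes>\<^bsub>T\<^esub> t) b))"
    by (rule lin_comp[OF lin_comp[OF kalg_lin_r[OF T_kalg vec_closed[OF v]] p3_lin(2)[OF a b]] dL_lin])
  show "lin K T AA (\<lambda>t. p3 (a \<otimes>\<^bsub>A\<^esub> pj (wd [v])) t b)"
    using a b v by (intro p3_lin A_closed proj_closed vec_closed)
  show "dL (p3 a (wd [v] \<otimes>\<^bsub>T\<^esub> wd w) b) = p3 (a \<otimes>\<^bsub>A\<^esub> pj (wd [v])) (wd w) b" if "w \<in> Lists" for w
    using dL_Cons[OF a v that b] v that by (simp add: word_mult)
qed

lemma dR_vec_mult:
  assumes a: "a \<in> carrier A" and v: "v \<in> carrier V" and t: "t \<in> carrier T" and b: "b \<in> carrier A"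
  shows "dR (p3 a (t \<otimes>\<^bsub>T\<^esub> wd [v]) b) = p3 a t (pj (wd [v]) \<otimes>\<^bsub>A\<^esub> b)"
proof (rule T_lin_eq[OF AA_module _ _ _ t])
  show "lin K T AA (\<lambda>t. dR (p3 a (t \<otimes>\<^bsub>T\<^esub> wd [v]) b))"
    by (rule lin_comp[OF lin_comp[OF kalg_lin_l[OF T_kalg vec_closed[OF v]] p3_lin(2)[OF a b]] dR_lin])
  show "lin K T AA (\<lambda>t. p3 a t (pj (wd [v]) \<otimes>\<^bsub>A\<^esub> b))"
    using a b v by (intro p3_lin A_closed proj_closed vec_closed)
  show "dR (p3 a (wd w \<otimes>\<^bsub>T\<^esub> wd [v]) b) = p3 a (wd w) (pj (wd [v]) \<otimes>\<^bsub>A\<^esub> b)" if "w \<in> Lists" for w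
    using dR_snoc[OF a v that b] v that by (simp add: word_mult)
qed

lemma dL_one: "a \<in> carrier A \<Longrightarrow> b \<in> carrier A \<Longrightarrow> dL (p3 a \<one>\<^bsub>T\<^esub> b) = \<zero>\<^bsub>AA\<^esub>"
  using dL_Nil by (simp add: word_Nil)

lemma dR_one: "a \<in> carrier A \<Longrightarrow> b \<in> carrier A \<Longrightarrow> dR (p3 a \<one>\<^bsub>T\<^esub> b) = \<zero>\<^bsub>AA\<^esub>"
  using dR_Nil by (simp add: word_Nil)

text \<open>
  On words of length at least two the maps act on different letters; on shorter words both
  composites vanish, because one of the maps meets the empty word.
\<close>

lemma dL_dR_commute:
  assumes "z \<in> carrier AA"
  shows "dL (dR z) = dR (dL z)"
proof (rule AA_lin_eq[OF AA_module lin_comp[OF dR_lin dL_lin] lin_comp[OF dL_lin dR_lin] _ assms])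
  fix a w b assume a: "a \<in> carrier A" and w: "w \<in> Lists" and b: "b \<in> carrier A"
  have z: "dL \<zero>\<^bsub>AA\<^esub> = \<zero>\<^bsub>AA\<^esub>" "dR \<zero>\<^bsub>AA\<^esub> = \<zero>\<^bsub>AA\<^esub>"
    using lin_zero[OF AA_module AA_module] dL_lin dR_lin by blast+
  have l: "a \<otimes>\<^bsub>A\<^esub> pj (wd [v]) \<in> carrier A" "pj (wd [v]) \<otimes>\<^bsub>A\<^esub> b \<in> carrier A" if "v \<in> carrier V" for v
    using A_closed(3)[OF a proj_closed[OF vec_closed[OF that]]] A_closed(3)[OF proj_closed[OF vec_closed[OF that]] b] by auto
  consider "w = []" | v where "w = [v]" | v w' v' where "w = v # w' @ [v']"
    by (metis list.exhaust rev_exhaust)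
  then show "dL (dR (p3 a (wd w) b)) = dR (dL (p3 a (wd w) b))"
  proof cases
    case 1
    then show ?thesis using a b by (simp add: dL_Nil dR_Nil z)
  next
    case (2 v)
    then have v: "v \<in> carrier V" using w by simp
    show ?thesis
      using dL_Cons[OF a v _ b, of "[]"] dR_snoc[OF a v _ b, of "[]"] dL_Nil[OF a l(2)[OF v]] dR_Nil[OF l(1)[OF v] b]
      by (simp add: 2)
  next
    case (3 v w' v')
    then have v: "v \<in> carrier V" "w' \<in> Lists" "v' \<in> carrier V" using w by auto
    have "dR (p3 a (wd (v # w' @ [v'])) b) = p3 a (wd (v # w')) (pj (wd [v']) \<otimes>\<^bsub>A\<^esub> b)"
      using dR_snoc[OF a v(3) _ b, of "v # w'"] v by simp
    moreover have "dL (p3 a (wd (v # w' @ [v'])) b) = p3 (a \<otimes>\<^bsub>A\<^esub> pj (wd [v])) (wd (w' @ [v'])) b"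
      using v by (intro dL_Cons a b) auto
    ultimately show ?thesis
      using dL_Cons[OF a v(1,2) l(2)[OF v(3)]] dR_snoc[OF l(1)[OF v(1)] v(3,2) b] by (simp add: 3)
  qed
qed

lemma lin_funpow: "lin K M M f \<Longrightarrow> lin K M M (f ^^ n)"
  by (induction n) (auto simp: lin_def Pi_def)

text \<open>
  Applying \<open>\<delta>'\<^sub>L\<close> as often as \<open>y\<close> has letters moves all of \<open>y\<close> into the left factor.
\<close>

lemma dL_power:
  assumes y: "y \<in> tpow K V m" and t: "t \<in> carrier T" and a: "a \<in> carrier A" and b: "b \<in> carrier A"
  shows "(dL ^^ m) (p3 a (y \<otimes>\<^bsub>T\<^esub> t) b) = p3 (a \<otimes>\<^bsub>A\<^esub> pj y) t b"
proof (rule tpow_lin_eq[OF AA_module _ _ _ y])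
  show "lin K T AA (\<lambda>y. (dL ^^ m) (p3 a (y \<otimes>\<^bsub>T\<^esub> t) b))"
    by (rule lin_comp[OF lin_comp[OF kalg_lin_l[OF T_kalg t] p3_lin(2)[OF a b]] lin_funpow[OF dL_lin]])
  show "lin K T AA (\<lambda>y. p3 (a \<otimes>\<^bsub>A\<^esub> pj y) t b)"
    by (rule lin_comp[OF lin_comp[OF proj_lin kalg_lin_r[OF A_kalg a]] p3_lin(1)[OF t b]])
  fix w assume "w \<in> Lists" "length w = m"
  then show "(dL ^^ m) (p3 a (wd w \<otimes>\<^bsub>T\<^esub> t) b) = p3 (a \<otimes>\<^bsub>A\<^esub> pj (wd w)) t b"
    using a
  proof (induction w arbitrary: a m)
    case Nil
    interpret T: ring T by (rule T_ring)
    show ?case using Nil t by (simp add: word_Nil proj_one A_laws)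
  next
    case (Cons v w)
    then have v: "v \<in> carrier V" "w \<in> Lists" and m: "m = Suc (length w)" and a: "a \<in> carrier A" by auto
    have av: "a \<otimes>\<^bsub>A\<^esub> pj (wd [v]) \<in> carrier A" using a v by (intro A_closed proj_closed vec_closed)
    have "wd (v # w) \<otimes>\<^bsub>T\<^esub> t = wd [v] \<otimes>\<^bsub>T\<^esub> (wd w \<otimes>\<^bsub>T\<^esub> t)"
      unfolding word_Cons[OF v] by (rule T_assoc[OF vec_closed[OF v(1)] word_closed[OF v(2)] t])
    then have "(dL ^^ m) (p3 a (wd (v # w) \<otimes>\<^bsub>T\<^esub> t) b) = (dL ^^ length w) (p3 (a \<otimes>\<^bsub>A\<^esub> pj (wd [v])) (wd w \<otimes>\<^bsub>T\<^esub> t) b)"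
      using dL_vec_mult[OF a v(1) T_closed(3)[OF word_closed[OF v(2)] t] b]
      by (simp add: m funpow_swap1)
    also have "\<dots> = p3 (a \<otimes>\<^bsub>A\<^esub> pj (wd [v]) \<otimes>\<^bsub>A\<^esub> pj (wd w)) t b"
      using Cons.IH[OF refl av] .
    also have "a \<otimes>\<^bsub>A\<^esub> pj (wd [v]) \<otimes>\<^bsub>A\<^esub> pj (wd w) = a \<otimes>\<^bsub>A\<^esub> pj (wd (v # w))"
      using v a unfolding word_Cons[OF v]
      by (simp add: A_laws proj_closed vec_closed word_closed proj_mult)
    finally show ?case .
  qed
qed

lemma dR_power:
  assumes y: "y \<in> tpow K V m" and t: "t \<in> carrier T" and a: "a \<in> carrier A" and b: "b \<in> carrier A"
  shows "(dR ^^ m) (p3 a (t \<otimes>\<^bsub>T\<^esub> y) b) = p3 a t (pj y \<otimes>\<^bsub>A\<^esub> b)"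
proof (rule tpow_lin_eq[OF AA_module _ _ _ y])
  show "lin K T AA (\<lambda>y. (dR ^^ m) (p3 a (t \<otimes>\<^bsub>T\<^esub> y) b))"
    by (rule lin_comp[OF lin_comp[OF kalg_lin_r[OF T_kalg t] p3_lin(2)[OF a b]] lin_funpow[OF dR_lin]])
  show "lin K T AA (\<lambda>y. p3 a t (pj y \<otimes>\<^bsub>A\<^esub> b))"
    by (rule lin_comp[OF lin_comp[OF proj_lin kalg_lin_l[OF A_kalg b]] p3_lin(3)[OF a t]])
  fix w assume "w \<in> Lists" "length w = m"
  then show "(dR ^^ m) (p3 a (t \<otimes>\<^bsub>T\<^esub> wd w) b) = p3 a t (pj (wd w) \<otimes>\<^bsub>A\<^esub> b)"
    using b
  proof (induction w arbitrary: b m rule: rev_induct)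
    case Nil
    interpret T: ring T by (rule T_ring)
    show ?case using Nil t by (simp add: word_Nil proj_one A_laws)
  next
    case (snoc v w)
    then have v: "v \<in> carrier V" "w \<in> Lists" and m: "m = Suc (length w)" and b: "b \<in> carrier A" by auto
    have vb: "pj (wd [v]) \<otimes>\<^bsub>A\<^esub> b \<in> carrier A" using b v by (intro A_closed proj_closed vec_closed)
    have wv: "wd (w @ [v]) = wd w \<otimes>\<^bsub>T\<^esub> wd [v]" using v by (simp add: word_mult)
    have "t \<otimes>\<^bsub>T\<^esub> wd (w @ [v]) = (t \<otimes>\<^bsub>T\<^esub> wd w) \<otimes>\<^bsub>T\<^esub> wd [v]"
      unfolding wv by (rule T_assoc[OF t word_closed[OF v(2)] vec_closed[OF v(1)], symmetric])
    then have "(dR ^^ m) (p3 a (t \<otimes>\<^bsub>T\<^esub> wd (w @ [v])) b) = (dR ^^ length w) (p3 a (t \<otimes>\<^bsub>T\<^esub> wd w) (pj (wd [v]) \<otimes>\<^bsub>A\<^esub> b))"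
      using dR_vec_mult[OF a v(1) T_closed(3)[OF t word_closed[OF v(2)]] b]
      by (simp add: m funpow_swap1)
    also have "\<dots> = p3 a t (pj (wd w) \<otimes>\<^bsub>A\<^esub> (pj (wd [v]) \<otimes>\<^bsub>A\<^esub> b))"
      using snoc.IH[OF v(2) refl vb] .
    also have "pj (wd w) \<otimes>\<^bsub>A\<^esub> (pj (wd [v]) \<otimes>\<^bsub>A\<^esub> b) = pj (wd (w @ [v])) \<otimes>\<^bsub>A\<^esub> b"
      using v b unfolding wv
      by (simp add: A_laws(3)[symmetric] proj_closed vec_closed word_closed proj_mult)
    finally show ?case .
  qed
qed

lemma funpow_zero:
  assumes "lin K AA AA f"
  shows "(f ^^ n) \<zero>\<^bsub>AA\<^esub> = \<zero>\<^bsub>AA\<^esub>"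
  using lin_zero[OF AA_module AA_module lin_funpow[OF assms]] .

lemma J_carrier: "x \<in> J n \<Longrightarrow> x \<in> carrier T"
  using submodule_subset[OF T_module J_submodule[OF R_carrier]] by blast

text \<open>
  If \<open>n < s\<close>, already \<open>n + 1\<close> steps exhaust the middle word. Otherwise \<open>x\<close> is a combination of tensors
  \<open>r v\<close> with \<open>r \<in> R\<close> (up to a scalar \<open>u\<close> of degree \<open>0\<close>), and \<open>s\<close> steps multiply \<open>a\<close> by the class of \<open>r\<close>.
\<close>

lemma dL_nilpotent:
  assumes x: "x \<in> J n" and a: "a \<in> carrier A" and b: "b \<in> carrier A"
  shows "(dL ^^ s) (p3 a x b) = \<zero>\<^bsub>AA\<^esub>"
proof (cases "n < s")
  case True
  interpret T: ring T by (rule T_ring)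
  have xt: "x \<in> tpow K V n" using x True by (simp add: J_space_def)
  have "(dL ^^ s) (p3 a x b) = (dL ^^ (s - Suc n)) ((dL ^^ Suc n) (p3 a x b))"
    using True funpow_add[of "s - Suc n" "Suc n" dL] by simp
  also have "(dL ^^ Suc n) (p3 a x b) = dL ((dL ^^ n) (p3 a (x \<otimes>\<^bsub>T\<^esub> \<one>\<^bsub>T\<^esub>) b))"
    using tpow_carrier[OF xt] by simp
  also have "\<dots> = \<zero>\<^bsub>AA\<^esub>"
    unfolding dL_power[OF xt T_closed(1) a b] using a b tpow_carrier[OF xt] by (intro dL_one A_closed proj_closed)
  finally show ?thesis using funpow_zero[OF dL_lin] by simp
next
  case False
  have "0 + s + (n - s) = n" using False by simp
  then have xs: "x \<in> shifted K V R 0 (n - s)" using J_space_iff[of s n x R] x False by auto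
  have "(dL ^^ s) (p3 a x b) \<in> {\<zero>\<^bsub>AA\<^esub>}"
  proof (rule lin_span_mem[OF T_module AA_module lin_comp[OF p3_lin(2)[OF a b] lin_funpow[OF dL_lin]]
        shifted_gens_carrier[OF R_carrier] zero_submodule[OF AA_module] _ xs[unfolded shifted_eq]])
    fix z assume "z \<in> shifted_gens R 0 (n - s)"
    then obtain u r v where z: "z = u \<otimes>\<^bsub>T\<^esub> r \<otimes>\<^bsub>T\<^esub> v" "u \<in> tpow K V 0" "r \<in> R" "v \<in> tpow K V (n - s)" by blast
    have u: "u \<otimes>\<^bsub>T\<^esub> r \<in> tpow K V s" using tpow_mult[OF z(2), of r s] z(3) R_tpow by auto
    have "u \<otimes>\<^bsub>T\<^esub> r \<otimes>\<^bsub>T\<^esub> \<one>\<^bsub>T\<^esub> = u \<otimes>\<^bsub>T\<^esub> r"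
      using tpow_carrier[OF u] ring.is_monoid[OF T_ring] by (simp add: monoid.r_one)
    then have "pj (u \<otimes>\<^bsub>T\<^esub> r) = \<zero>\<^bsub>A\<^esub>"
      using proj_R[OF z(3) tpow_carrier[OF z(2)] T_closed(1)] by simp
    then show "(dL ^^ s) (p3 a z b) \<in> {\<zero>\<^bsub>AA\<^esub>}"
      using dL_power[OF u tpow_carrier[OF z(4)] a b] tpow_carrier[OF z(4)] a b
      by (simp add: z(1) A_laws p3_zero)
  qed
  then show ?thesis by simp
qed

lemma dR_nilpotent:
  assumes x: "x \<in> J n" and a: "a \<in> carrier A" and b: "b \<in> carrier A"
  shows "(dR ^^ s) (p3 a x b) = \<zero>\<^bsub>AA\<^esub>"
proof (cases "n < s")
  case True
  interpret T: ring T by (rule T_ring)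
  have xt: "x \<in> tpow K V n" using x True by (simp add: J_space_def)
  have "(dR ^^ s) (p3 a x b) = (dR ^^ (s - Suc n)) ((dR ^^ Suc n) (p3 a x b))"
    using True funpow_add[of "s - Suc n" "Suc n" dR] by simp
  also have "(dR ^^ Suc n) (p3 a x b) = dR ((dR ^^ n) (p3 a (\<one>\<^bsub>T\<^esub> \<otimes>\<^bsub>T\<^esub> x) b))"
    using tpow_carrier[OF xt] by simp
  also have "\<dots> = \<zero>\<^bsub>AA\<^esub>"
    unfolding dR_power[OF xt T_closed(1) a b] using a b tpow_carrier[OF xt] by (intro dR_one A_closed proj_closed)
  finally show ?thesis using funpow_zero[OF dR_lin] by simp
next
  case False
  have "(n - s) + s + 0 = n" using False by simp
  then have xs: "x \<in> shifted K V R (n - s) 0" using J_space_iff[of s n x R] x False by auto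
  have "(dR ^^ s) (p3 a x b) \<in> {\<zero>\<^bsub>AA\<^esub>}"
  proof (rule lin_span_mem[OF T_module AA_module lin_comp[OF p3_lin(2)[OF a b] lin_funpow[OF dR_lin]]
        shifted_gens_carrier[OF R_carrier] zero_submodule[OF AA_module] _ xs[unfolded shifted_eq]])
    fix z assume "z \<in> shifted_gens R (n - s) 0"
    then obtain u r v where z: "z = u \<otimes>\<^bsub>T\<^esub> r \<otimes>\<^bsub>T\<^esub> v" "u \<in> tpow K V (n - s)" "r \<in> R" "v \<in> tpow K V 0" by blast
    have r: "r \<in> carrier T" "r \<in> tpow K V s" using z(3) R_carrier R_tpow by auto
    have v: "r \<otimes>\<^bsub>T\<^esub> v \<in> tpow K V s" using tpow_mult[OF r(2) z(4)] by simp
    have z': "z = u \<otimes>\<^bsub>T\<^esub> (r \<otimes>\<^bsub>T\<^esub> v)"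
      using T_assoc[OF tpow_carrier[OF z(2)] r(1) tpow_carrier[OF z(4)]] z(1) by simp
    have "\<one>\<^bsub>T\<^esub> \<otimes>\<^bsub>T\<^esub> r \<otimes>\<^bsub>T\<^esub> v = r \<otimes>\<^bsub>T\<^esub> v"
      using r(1) ring.is_monoid[OF T_ring] by (simp add: monoid.l_one)
    then have "pj (r \<otimes>\<^bsub>T\<^esub> v) = \<zero>\<^bsub>A\<^esub>"
      using proj_R[OF z(3) T_closed(1) tpow_carrier[OF z(4)]] by simp
    then show "(dR ^^ s) (p3 a z b) \<in> {\<zero>\<^bsub>AA\<^esub>}"
      using dR_power[OF v tpow_carrier[OF z(2)] a b] tpow_carrier[OF z(2)] a b
      by (simp add: z' A_laws p3_zero)
  qed
  then show ?thesis by simp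
qed

lemma dL_J_mem:
  assumes x: "x \<in> J (Suc n)" and a: "a \<in> carrier A" and b: "b \<in> carrier A" and H: "submodule H K AA"
    and vy: "\<And>v y. v \<in> carrier V \<Longrightarrow> y \<in> J n \<Longrightarrow> p3 (a \<otimes>\<^bsub>A\<^esub> pj (wd [v])) y b \<in> H"
  shows "dL (p3 a x b) \<in> H"
proof (rule lin_span_mem[OF T_module AA_module lin_comp[OF p3_lin(2)[OF a b] dL_lin] _ H _ J_left[OF R_tpow x]])
  show "{wd [v] \<otimes>\<^bsub>T\<^esub> y | v y. v \<in> carrier V \<and> y \<in> J n} \<subseteq> carrier T"
    using vec_closed J_carrier T_closed(3) by blast
  show "dL (p3 a z b) \<in> H" if "z \<in> {wd [v] \<otimes>\<^bsub>T\<^esub> y | v y. v \<in> carrier V \<and> y \<in> J n}" for z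
    using that dL_vec_mult[OF a _ J_carrier b] vy by auto
qed

lemma dR_J_mem:
  assumes x: "x \<in> J (Suc n)" and a: "a \<in> carrier A" and b: "b \<in> carrier A" and H: "submodule H K AA"
    and vy: "\<And>v y. v \<in> carrier V \<Longrightarrow> y \<in> J n \<Longrightarrow> p3 a y (pj (wd [v]) \<otimes>\<^bsub>A\<^esub> b) \<in> H"
  shows "dR (p3 a x b) \<in> H"
proof (rule lin_span_mem[OF T_module AA_module lin_comp[OF p3_lin(2)[OF a b] dR_lin] _ H _ J_right[OF R_tpow x]])
  show "{y \<otimes>\<^bsub>T\<^esub> wd [v] | v y. v \<in> carrier V \<and> y \<in> J n} \<subseteq> carrier T"
    using vec_closed J_carrier T_closed(3) by blast
  show "dR (p3 a z b) \<in> H" if "z \<in> {y \<otimes>\<^bsub>T\<^esub> wd [v] | v y. v \<in> carrier V \<and> y \<in> J n}" for z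
    using that dR_vec_mult[OF a _ J_carrier b] vy by auto
qed

end


lemma bimod_hom_lin: "f \<in> bimod_hom K A M N \<Longrightarrow> lin K M N f"
  by (auto simp: bimod_hom_def lin_def)

lemma (in bimodule) lact_lin: "a \<in> carrier A \<Longrightarrow> lin K M M (lact M a)"
  by (rule linI) (auto simp: lact_closed lact_add_r lact_scalar)

lemma (in bimodule) ract_lin: "a \<in> carrier A \<Longrightarrow> lin K M M (\<lambda>x. ract M x a)"
  by (rule linI) (auto simp: ract_closed ract_add_l ract_scalar)

lemma (in bimodule) lact_lin': "kalg K A \<Longrightarrow> x \<in> carrier M \<Longrightarrow> lin K A M (\<lambda>a. lact M a x)"
  by (rule linI) (auto simp: lact_closed lact_add_l lact_scalar)

lemma (in bimodule) ract_lin': "kalg K A \<Longrightarrow> x \<in> carrier M \<Longrightarrow> lin K A M (\<lambda>a. ract M x a)"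
  by (rule linI) (auto simp: ract_closed ract_add_r ract_scalar)

text \<open>
  Applying \<open>\<pi> d\<close> to a decomposition returns its summand of degree \<open>d\<close>, hence uniqueness; existence holds on
  the pieces and is stable under sums and multiples.
\<close>

lemma direct_sum_decompI:
  assumes M: "module K M" and G: "\<And>d. submodule (G d) K M" and \<pi>: "\<And>d. lin K M M (\<pi> d)"
    and same: "\<And>d x. x \<in> G d \<Longrightarrow> \<pi> d x = x"
    and other: "\<And>d d' x. x \<in> G d \<Longrightarrow> d \<noteq> d' \<Longrightarrow> \<pi> d' x = \<zero>\<^bsub>M\<^esub>"
    and span: "lspan K M (\<Union>d. G d) = carrier M"
  shows "direct_sum_decomp K M G"
proof -
  interpret M: module K M by (rule M)
  note G' = submodule_facts[OF M G]
  have Gc: "(\<Union>d. G d) \<subseteq> carrier M" using G'(1) by blast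
  have grow: "(\<Oplus>\<^bsub>M\<^esub>d\<in>D. f d) = (\<Oplus>\<^bsub>M\<^esub>d\<in>D'. f d)"
    if "finite D'" "D \<subseteq> D'" "\<And>d. d \<in> D' - D \<Longrightarrow> f d = \<zero>\<^bsub>M\<^esub>" "\<And>d. f d \<in> carrier M" for D D' f
    using that by (intro M.add.finprod_mono_neutral_cong_left) auto
  let ?Q = "\<lambda>x D. finite D \<and> (\<forall>d. \<pi> d x \<in> G d) \<and> (\<forall>d. d \<notin> D \<longrightarrow> \<pi> d x = \<zero>\<^bsub>M\<^esub>) \<and> x = (\<Oplus>\<^bsub>M\<^esub>d\<in>D. \<pi> d x)"
  have Q: "\<exists>D. ?Q x D" if "x \<in> carrier M" for x
    using M Gc that[folded span]
  proof (induction rule: lspan_induct)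
    case (base x)
    then obtain d where d: "x \<in> G d" by blast
    have "\<pi> d' x \<in> G d'" for d' using same[OF d] other[OF d, of d'] d G'(2) by (cases "d = d'") auto
    moreover have "x = (\<Oplus>\<^bsub>M\<^esub>d'\<in>{d}. \<pi> d' x)"
    proof -
      have "x \<in> carrier M" by (rule subsetD[OF G'(1) d])
      from lin_closed[OF \<pi> this] have "(\<Oplus>\<^bsub>M\<^esub>d'\<in>{d}. \<pi> d' x) = \<pi> d x" by (simp add: Pi_def)
      then show ?thesis by (simp only: same[OF d])
    qed
    ultimately show ?case using other[OF d] by (intro exI[of _ "{d}"]) auto
  next
    case zero
    have "\<pi> d \<zero>\<^bsub>M\<^esub> = \<zero>\<^bsub>M\<^esub>" for d by (rule lin_zero[OF M M \<pi>])
    then show ?case using G'(2) by (intro exI[of _ "{}"]) auto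
  next
    case (add x y)
    obtain D D' where D: "?Q x D" "?Q y D'" using add(3,4) by (elim exE)
    note c = lin_closed[OF \<pi> add(1)] lin_closed[OF \<pi> add(2)]
    have p: "\<pi> d (x \<oplus>\<^bsub>M\<^esub> y) = \<pi> d x \<oplus>\<^bsub>M\<^esub> \<pi> d y" for d by (rule lin_add[OF \<pi> add(1,2)])
    have "x = (\<Oplus>\<^bsub>M\<^esub>d\<in>D \<union> D'. \<pi> d x)" using D c grow[of "D \<union> D'" D "\<lambda>d. \<pi> d x"] by simp
    moreover have "y = (\<Oplus>\<^bsub>M\<^esub>d\<in>D \<union> D'. \<pi> d y)" using D c grow[of "D \<union> D'" D' "\<lambda>d. \<pi> d y"] by simp
    moreover have "(\<Oplus>\<^bsub>M\<^esub>d\<in>D \<union> D'. \<pi> d x \<oplus>\<^bsub>M\<^esub> \<pi> d y) = (\<Oplus>\<^bsub>M\<^esub>d\<in>D \<union> D'. \<pi> d x) \<oplus>\<^bsub>M\<^esub> (\<Oplus>\<^bsub>M\<^esub>d\<in>D \<union> D'. \<pi> d y)"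
      using c by (intro M.finsum_addf) auto
    ultimately have "x \<oplus>\<^bsub>M\<^esub> y = (\<Oplus>\<^bsub>M\<^esub>d\<in>D \<union> D'. \<pi> d (x \<oplus>\<^bsub>M\<^esub> y))" by (simp only: p)
    moreover have "\<pi> d (x \<oplus>\<^bsub>M\<^esub> y) \<in> G d" for d unfolding p using D G'(3) by simp
    moreover have "\<pi> d (x \<oplus>\<^bsub>M\<^esub> y) = \<zero>\<^bsub>M\<^esub>" if "d \<notin> D \<union> D'" for d unfolding p using that D by simp
    ultimately show ?case using D by (intro exI[of _ "D \<union> D'"]) simp
  next
    case (smult c x)
    obtain D where D: "?Q x D" using smult(3) by (elim exE)
    have p: "\<pi> d (c \<odot>\<^bsub>M\<^esub> x) = c \<odot>\<^bsub>M\<^esub> \<pi> d x" for d by (rule lin_smult[OF \<pi> smult(1,2)])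
    have e: "c \<odot>\<^bsub>M\<^esub> (\<Oplus>\<^bsub>M\<^esub>d\<in>D. \<pi> d x) = (\<Oplus>\<^bsub>M\<^esub>d\<in>D. c \<odot>\<^bsub>M\<^esub> \<pi> d x)"
      using D smult(1) lin_closed[OF \<pi> smult(2)] by (intro M.finsum_smult_ldistr) auto
    have "x = (\<Oplus>\<^bsub>M\<^esub>d\<in>D. \<pi> d x)" using D by simp
    then have "c \<odot>\<^bsub>M\<^esub> x = (\<Oplus>\<^bsub>M\<^esub>d\<in>D. \<pi> d (c \<odot>\<^bsub>M\<^esub> x))"
      unfolding p by (rule trans[OF arg_cong[where f="smult M c"] e])
    moreover have "\<pi> d (c \<odot>\<^bsub>M\<^esub> x) \<in> G d" for d unfolding p using D G'(5)[OF smult(1)] by simp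
    moreover have "\<pi> d (c \<odot>\<^bsub>M\<^esub> x) = \<zero>\<^bsub>M\<^esub>" if "d \<notin> D" for d unfolding p using that D smult(1) by simp
    moreover have "finite D" using D by simp
    ultimately show ?case by (intro exI[of _ D] conjI allI impI)
  qed
  have "\<exists>!f. (\<forall>d. f d \<in> G d) \<and> finite {d. f d \<noteq> \<zero>\<^bsub>M\<^esub>} \<and> x = (\<Oplus>\<^bsub>M\<^esub>d\<in>{d. f d \<noteq> \<zero>\<^bsub>M\<^esub>}. f d)"
    if x: "x \<in> carrier M" for x
  proof (rule ex1I[of _ "\<lambda>d. \<pi> d x"])
    obtain D where D: "?Q x D" using Q[OF x] by (elim exE)
    have sub: "{d. \<pi> d x \<noteq> \<zero>\<^bsub>M\<^esub>} \<subseteq> D" using D by blast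
    then have "finite {d. \<pi> d x \<noteq> \<zero>\<^bsub>M\<^esub>}" using D finite_subset by blast
    moreover have "(\<Oplus>\<^bsub>M\<^esub>d\<in>{d. \<pi> d x \<noteq> \<zero>\<^bsub>M\<^esub>}. \<pi> d x) = (\<Oplus>\<^bsub>M\<^esub>d\<in>D. \<pi> d x)"
      using D sub lin_closed[OF \<pi> x] by (intro grow) auto
    ultimately show "(\<forall>d. \<pi> d x \<in> G d) \<and> finite {d. \<pi> d x \<noteq> \<zero>\<^bsub>M\<^esub>} \<and>
        x = (\<Oplus>\<^bsub>M\<^esub>d\<in>{d. \<pi> d x \<noteq> \<zero>\<^bsub>M\<^esub>}. \<pi> d x)" using D by simp
    fix f assume f: "(\<forall>d. f d \<in> G d) \<and> finite {d. f d \<noteq> \<zero>\<^bsub>M\<^esub>} \<and> x = (\<Oplus>\<^bsub>M\<^esub>d\<in>{d. f d \<noteq> \<zero>\<^bsub>M\<^esub>}. f d)"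
    then have fG: "f d \<in> G d" and ff: "finite {d. f d \<noteq> \<zero>\<^bsub>M\<^esub>}"
      and fx: "x = (\<Oplus>\<^bsub>M\<^esub>d\<in>{d. f d \<noteq> \<zero>\<^bsub>M\<^esub>}. f d)" for d by simp_all
    have fc: "f d \<in> carrier M" for d by (rule subsetD[OF G'(1) fG])
    show "f = (\<lambda>d. \<pi> d x)"
    proof
      fix d
      let ?D = "insert d {d. f d \<noteq> \<zero>\<^bsub>M\<^esub>}"
      have D: "finite ?D" using ff by simp
      have v: "\<pi> d (f d') = (if d = d' then f d' else \<zero>\<^bsub>M\<^esub>)" for d'
        using same[OF fG] other[OF fG, of d' d] by simp
      have "(\<Oplus>\<^bsub>M\<^esub>d\<in>{d. f d \<noteq> \<zero>\<^bsub>M\<^esub>}. f d) = (\<Oplus>\<^bsub>M\<^esub>d\<in>?D. f d)"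
        by (rule grow[OF D]) (use fc in auto)
      then have "\<pi> d x = \<pi> d (\<Oplus>\<^bsub>M\<^esub>d\<in>?D. f d)" using fx by simp
      also have "\<dots> = (\<Oplus>\<^bsub>M\<^esub>d'\<in>?D. \<pi> d (f d'))"
        by (rule lin_of_finsum[OF M M \<pi> D fc])
      also have "\<dots> = (\<Oplus>\<^bsub>M\<^esub>d'\<in>?D. if d = d' then f d' else \<zero>\<^bsub>M\<^esub>)" by (simp only: v)
      also have "\<dots> = f d"
        by (rule M.finsum_singleton[OF insertI1 D]) (simp add: fc)
      finally show "f d = \<pi> d x" by (rule sym)
    qed
  qed
  then show ?thesis using G by (simp add: direct_sum_decomp_def)
qed

context koszul
begin

abbreviation "lA a' \<equiv> tensor_map K AAT A AAT A (tensor_map K A T A T (\<lambda>a. a' \<otimes>\<^bsub>A\<^esub> a) (\<lambda>t. t)) (\<lambda>b. b)"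
abbreviation "rA b' \<equiv> tensor_map K AAT A AAT A (\<lambda>y. y) (\<lambda>b. b \<otimes>\<^bsub>A\<^esub> b')"

lemma lA_lin: "a' \<in> carrier A \<Longrightarrow> lin K AA AA (lA a')"
  unfolding ATA_def
  by (rule tensor_map_lin[OF AAT_module A_module AAT_module A_module
        tensor_map_lin[OF A_module T_module A_module T_module kalg_lin_r[OF A_kalg] lin_id, folded AT_def] lin_id])

lemma rA_lin: "b' \<in> carrier A \<Longrightarrow> lin K AA AA (rA b')"
  unfolding ATA_def
  by (rule tensor_map_lin[OF AAT_module A_module AAT_module A_module lin_id kalg_lin_l[OF A_kalg]])

lemma lA_p3:
  assumes "a' \<in> carrier A" "a \<in> carrier A" "x \<in> carrier T" "b \<in> carrier A"
  shows "lA a' (p3 a x b) = p3 (a' \<otimes>\<^bsub>A\<^esub> a) x b"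
  using tensor_map_tens[OF AAT_module A_module AAT_module A_module
        tensor_map_lin[OF A_module T_module A_module T_module kalg_lin_r[OF A_kalg assms(1)] lin_id, folded AT_def] lin_id
        tens_closed[OF A_module T_module assms(2,3), folded AT_def] assms(4)]
    tensor_map_tens[OF A_module T_module A_module T_module kalg_lin_r[OF A_kalg assms(1)] lin_id assms(2,3)]
  by (simp add: pure3_def)

lemma rA_p3:
  assumes "b' \<in> carrier A" "a \<in> carrier A" "x \<in> carrier T" "b \<in> carrier A"
  shows "rA b' (p3 a x b) = p3 a x (b \<otimes>\<^bsub>A\<^esub> b')"
  using tensor_map_tens[OF AAT_module A_module AAT_module A_module lin_id kalg_lin_l[OF A_kalg assms(1)]
        tens_closed[OF A_module T_module assms(2,3), folded AT_def] assms(4)]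
  by (simp add: pure3_def)

abbreviation "C \<equiv> K_LR K V s R"
abbreviation "G \<equiv> K_LR_deg K V s R"
abbreviation "gens3 n \<equiv> {p3 a x b | a x b. a \<in> carrier A \<and> x \<in> J n \<and> b \<in> carrier A}"
abbreviation "W n \<equiv> lspan K AA (gens3 n)"
abbreviation "degs n d \<equiv> {p3 a x b | a x b p q. a \<in> Ad p \<and> x \<in> J n \<and> b \<in> Ad q \<and> int (p + n + q) = d}"

lemma C_simps:
  "carrier (C n) = W n" "add (C n) = add AA" "zero (C n) = zero AA" "smult (C n) = smult AA"
  "lact (C n) a z = lA a z" "ract (C n) z b = rA b z"
  by (simp_all add: K_LR_def Let_def module.defs bimod.defs)

lemma gens3_carrier: "gens3 n \<subseteq> carrier AA"
  using p3_closed J_carrier by blast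

lemma degs_gens3: "degs n d \<subseteq> gens3 n"
  using Ad_carrier by blast

lemma degs_carrier: "degs n d \<subseteq> carrier AA"
  using degs_gens3 gens3_carrier by (rule order_trans)

lemma W_submodule: "submodule (W n) K AA"
  by (rule lspan_submodule[OF AA_module gens3_carrier])

lemma W_carrier: "z \<in> W n \<Longrightarrow> z \<in> carrier AA"
  using lspan_carrier[OF AA_module gens3_carrier] by blast

lemma G_eq: "G n d = lspan K AA (degs n d)"
  by (simp only: K_LR_deg_def)

lemma G_submodule: "submodule (G n d) K AA"
  unfolding G_eq by (rule lspan_submodule[OF AA_module degs_carrier])

lemma G_W: "G n d \<subseteq> W n"
  unfolding G_eq by (rule lspan_mono[OF degs_gens3])

lemma C_module: "module K (C n)"
  by (rule module_cong[OF submodule_module[OF AA_module W_submodule, of n]]) (simp_all add: C_simps)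

text \<open>
  The bimodules \<open>A \<otimes> J\<^sub>n \<otimes> A\<close> share the operations of the ambient space, so subspaces and spans may be
  computed there.
\<close>

lemma C_submodule_iff:
  assumes "H \<subseteq> W n"
  shows "submodule H K (C n) \<longleftrightarrow> submodule H K AA"
proof
  assume "submodule H K (C n)"
  note S = submodule_facts[OF C_module this, unfolded C_simps]
  show "submodule H K AA"
    by (rule submoduleI'[OF AA_module]) (use S assms W_carrier in auto)
next
  assume "submodule H K AA"
  note S = submodule_facts[OF AA_module this]
  show "submodule H K (C n)"
    by (rule submoduleI'[OF C_module]) (use S assms in \<open>auto simp: C_simps\<close>)
qed

lemma C_lspan:
  assumes "S \<subseteq> W n"
  shows "lspan K (C n) S = lspan K AA S"
proof
  have Sc: "S \<subseteq> carrier (C n)" "S \<subseteq> carrier AA" using assms W_carrier by (auto simp: C_simps)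
  have w: "lspan K (C n) S \<subseteq> W n" using lspan_carrier[OF C_module Sc(1)] by (simp only: C_simps)
  have w': "lspan K AA S \<subseteq> W n" using lspan_least[OF W_submodule assms] .
  show "lspan K (C n) S \<subseteq> lspan K AA S"
    using lspan_submodule[OF AA_module Sc(2)] C_submodule_iff[OF w'] by (intro lspan_least lspan_superset) simp
  show "lspan K AA S \<subseteq> lspan K (C n) S"
    using lspan_submodule[OF C_module Sc(1)] C_submodule_iff[OF w] by (intro lspan_least lspan_superset) simp
qed

lemma lA_W: "a \<in> carrier A \<Longrightarrow> z \<in> W n \<Longrightarrow> lA a z \<in> W n"
proof (rule lin_span_mem[OF AA_module AA_module lA_lin gens3_carrier W_submodule])
  fix z assume a: "a \<in> carrier A" and "z \<in> gens3 n"
  then obtain a' x b where z: "z = p3 a' x b" "a' \<in> carrier A" "x \<in> J n" "b \<in> carrier A" by blast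
  have "lA a z = p3 (a \<otimes>\<^bsub>A\<^esub> a') x b" unfolding z(1) by (rule lA_p3[OF a z(2) J_carrier[OF z(3)] z(4)])
  then have "lA a z \<in> gens3 n" using z A_closed(3)[OF a z(2)] by blast
  then show "lA a z \<in> W n" by (rule lspan_base)
qed

lemma rA_W: "a \<in> carrier A \<Longrightarrow> z \<in> W n \<Longrightarrow> rA a z \<in> W n"
proof (rule lin_span_mem[OF AA_module AA_module rA_lin gens3_carrier W_submodule])
  fix z assume a: "a \<in> carrier A" and "z \<in> gens3 n"
  then obtain a' x b where z: "z = p3 a' x b" "a' \<in> carrier A" "x \<in> J n" "b \<in> carrier A" by blast
  have "rA a z = p3 a' x (b \<otimes>\<^bsub>A\<^esub> a)" unfolding z(1) by (rule rA_p3[OF a z(2) J_carrier[OF z(3)] z(4)])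
  then have "rA a z \<in> gens3 n" using z A_closed(3)[OF z(4) a] by blast
  then show "rA a z \<in> W n" by (rule lspan_base)
qed

lemma action_laws:
  assumes a: "a \<in> carrier A" and b: "b \<in> carrier A" and c: "c \<in> carrier K" and z: "z \<in> carrier AA"
  shows "lA (a \<oplus>\<^bsub>A\<^esub> b) z = lA a z \<oplus>\<^bsub>AA\<^esub> lA b z"
    and "rA (a \<oplus>\<^bsub>A\<^esub> b) z = rA a z \<oplus>\<^bsub>AA\<^esub> rA b z"
    and "lA (a \<otimes>\<^bsub>A\<^esub> b) z = lA a (lA b z)"
    and "rA (a \<otimes>\<^bsub>A\<^esub> b) z = rA b (rA a z)"
    and "lA \<one>\<^bsub>A\<^esub> z = z"
    and "rA \<one>\<^bsub>A\<^esub> z = z"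
    and "rA b (lA a z) = lA a (rA b z)"
    and "lA (c \<odot>\<^bsub>A\<^esub> a) z = c \<odot>\<^bsub>AA\<^esub> lA a z"
    and "rA (c \<odot>\<^bsub>A\<^esub> a) z = c \<odot>\<^bsub>AA\<^esub> rA a z"
proof -
  note cl = word_closed A_closed
  note ext = AA_lin_eq[OF AA_module _ _ _ z]
  note ad = lin_add[OF p3_lin(1)] lin_add[OF p3_lin(3)] lin_smult[OF p3_lin(1)] lin_smult[OF p3_lin(3)]
  interpret A: ring A by (rule A_ring)
  show "lA (a \<oplus>\<^bsub>A\<^esub> b) z = lA a z \<oplus>\<^bsub>AA\<^esub> lA b z"
    by (rule ext[OF lA_lin lin_plus[OF AA_module AA_module lA_lin lA_lin]])
       (simp_all add: a b c lA_p3 cl ad A.l_distr)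
  show "rA (a \<oplus>\<^bsub>A\<^esub> b) z = rA a z \<oplus>\<^bsub>AA\<^esub> rA b z"
    by (rule ext[OF rA_lin lin_plus[OF AA_module AA_module rA_lin rA_lin]])
       (simp_all add: a b c rA_p3 cl ad A.r_distr)
  show "lA (a \<otimes>\<^bsub>A\<^esub> b) z = lA a (lA b z)"
    by (rule ext[OF lA_lin lin_comp[OF lA_lin lA_lin]]) (simp_all add: a b c lA_p3 cl A_laws)
  show "rA (a \<otimes>\<^bsub>A\<^esub> b) z = rA b (rA a z)"
    by (rule ext[OF rA_lin lin_comp[OF rA_lin rA_lin]]) (simp_all add: a b c rA_p3 cl A_laws)
  show "lA \<one>\<^bsub>A\<^esub> z = z"
    by (rule ext[OF lA_lin lin_id]) (simp_all add: a b c lA_p3 cl A_laws)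
  show "rA \<one>\<^bsub>A\<^esub> z = z"
    by (rule ext[OF rA_lin lin_id]) (simp_all add: a b c rA_p3 cl A_laws)
  show "rA b (lA a z) = lA a (rA b z)"
    by (rule ext[OF lin_comp[OF lA_lin rA_lin] lin_comp[OF rA_lin lA_lin]]) (simp_all add: a b c lA_p3 rA_p3 cl)
  show "lA (c \<odot>\<^bsub>A\<^esub> a) z = c \<odot>\<^bsub>AA\<^esub> lA a z"
    by (rule ext[OF lA_lin lin_scale[OF AA_module AA_module lA_lin]])
       (simp_all add: a b c lA_p3 cl ad kalg_smult[OF A_kalg])
  show "rA (c \<odot>\<^bsub>A\<^esub> a) z = c \<odot>\<^bsub>AA\<^esub> rA a z"
    by (rule ext[OF rA_lin lin_scale[OF AA_module AA_module rA_lin]])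
       (simp_all add: a b c rA_p3 cl ad kalg_smult[OF A_kalg])
qed

lemma C_bimodule: "bimodule K A (C n)"
proof (rule bimodule.intro[OF A_ring C_module], unfold_locales)
  have one: "\<one>\<^bsub>A\<^esub> \<in> carrier A" "\<one>\<^bsub>K\<^esub> \<in> carrier K"
    using A_closed(1) K_cring by (auto simp: cring_def ring_def monoid.one_closed)
  fix a x assume a: "a \<in> carrier A" and x: "x \<in> carrier (C n)"
  then have xW: "x \<in> W n" and xc: "x \<in> carrier AA" using W_carrier by (auto simp: C_simps)
  show "lact (C n) a x \<in> carrier (C n)" "ract (C n) x a \<in> carrier (C n)"
    using lA_W[OF a xW] rA_W[OF a xW] by (simp_all add: C_simps)
  show "lact (C n) a (x \<oplus>\<^bsub>C n\<^esub> y) = lact (C n) a x \<oplus>\<^bsub>C n\<^esub> lact (C n) a y"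
    "ract (C n) (x \<oplus>\<^bsub>C n\<^esub> y) a = ract (C n) x a \<oplus>\<^bsub>C n\<^esub> ract (C n) y a"
    if "y \<in> carrier (C n)" for y
    using lin_add[OF lA_lin[OF a] xc] lin_add[OF rA_lin[OF a] xc] that W_carrier by (simp_all add: C_simps)
  show "lact (C n) (a \<oplus>\<^bsub>A\<^esub> b) x = lact (C n) a x \<oplus>\<^bsub>C n\<^esub> lact (C n) b x"
    "ract (C n) x (a \<oplus>\<^bsub>A\<^esub> b) = ract (C n) x a \<oplus>\<^bsub>C n\<^esub> ract (C n) x b"
    "lact (C n) (a \<otimes>\<^bsub>A\<^esub> b) x = lact (C n) a (lact (C n) b x)"
    "ract (C n) x (a \<otimes>\<^bsub>A\<^esub> b) = ract (C n) (ract (C n) x a) b"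
    "ract (C n) (lact (C n) a x) b = lact (C n) a (ract (C n) x b)"
    if b: "b \<in> carrier A" for b
    using action_laws[OF a b one(2) xc] by (simp_all add: C_simps)
next
  have one: "\<one>\<^bsub>A\<^esub> \<in> carrier A" "\<one>\<^bsub>K\<^esub> \<in> carrier K"
    using A_closed(1) K_cring by (auto simp: cring_def ring_def monoid.one_closed)
  fix x assume x: "x \<in> carrier (C n)"
  then have xc: "x \<in> carrier AA" using W_carrier by (auto simp: C_simps)
  show "lact (C n) \<one>\<^bsub>A\<^esub> x = x" "ract (C n) x \<one>\<^bsub>A\<^esub> = x"
    using action_laws[OF one(1,1) one(2) xc] by (simp_all add: C_simps)
  fix c a assume c: "c \<in> carrier K" and a: "a \<in> carrier A"
  show "lact (C n) (c \<odot>\<^bsub>A\<^esub> a) x = c \<odot>\<^bsub>C n\<^esub> lact (C n) a x \<and>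
      lact (C n) a (c \<odot>\<^bsub>C n\<^esub> x) = c \<odot>\<^bsub>C n\<^esub> lact (C n) a x"
    using action_laws[OF a a c xc] lin_smult[OF lA_lin[OF a] c xc] by (simp add: C_simps)
  show "ract (C n) x (c \<odot>\<^bsub>A\<^esub> a) = c \<odot>\<^bsub>C n\<^esub> ract (C n) x a \<and>
      ract (C n) (c \<odot>\<^bsub>C n\<^esub> x) a = c \<odot>\<^bsub>C n\<^esub> ract (C n) x a"
    using action_laws[OF a a c xc] lin_smult[OF rA_lin[OF a] c xc] by (simp add: C_simps)
qed

section \<open>The grading\<close>

lemma A_span: "lspan K A (\<Union>p. Ad p) = carrier A"
proof
  have c: "(\<Union>p. Ad p) \<subseteq> carrier A" using Ad_carrier by blast
  show "lspan K A (\<Union>p. Ad p) \<subseteq> carrier A" by (rule lspan_carrier[OF A_module c])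
  show "carrier A \<subseteq> lspan K A (\<Union>p. Ad p)"
  proof
    fix a assume "a \<in> carrier A"
    then obtain t where t: "t \<in> carrier T" "a = pj t" by (rule proj_surj)
    show "a \<in> lspan K A (\<Union>p. Ad p)" unfolding t(2)
    proof (rule lin_span_mem[OF T_module A_module proj_lin words_closed lspan_submodule[OF A_module c]])
      show "t \<in> lspan K T (wd ` Lists)" using t(1) by (simp only: T_span)
      fix x assume "x \<in> wd ` Lists"
      then obtain w where "x = wd w" "w \<in> Lists" by blast
      then have "pj x \<in> Ad (length w)" unfolding Ad_eq using word_tpow[OF _ refl] by blast
      then show "pj x \<in> lspan K A (\<Union>p. Ad p)" by (intro lspan_base) blast
    qed
  qed
qed

lemma W_span: "W n = lspan K AA (\<Union>d. degs n d)"
proof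
  let ?D = "\<Union>d. degs n d"
  have Dc: "?D \<subseteq> carrier AA" by (rule UN_least) (rule degs_carrier)
  have Ac: "(\<Union>p. Ad p) \<subseteq> carrier A" using Ad_carrier by blast
  show "lspan K AA ?D \<subseteq> W n" by (intro lspan_mono UN_least degs_gens3)
  show "W n \<subseteq> lspan K AA ?D"
  proof (rule lspan_least[OF lspan_submodule[OF AA_module Dc]], rule subsetI)
    fix z assume "z \<in> gens3 n"
    then obtain a x b where z: "z = p3 a x b" "a \<in> carrier A" "x \<in> J n" "b \<in> carrier A" by blast
    note xc = J_carrier[OF z(3)]
    have "bilin K A A AA (\<lambda>a b. p3 a x b)"
      using p3_lin(1)[OF xc] p3_lin(3)[OF _ xc] by (simp add: bilin_def)
    then show "z \<in> lspan K AA ?D" unfolding z(1)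
    proof (rule bilin_lspan[OF A_module A_module AA_module _ Ac Ac lspan_submodule[OF AA_module Dc]])
      show "a \<in> lspan K A (\<Union>p. Ad p)" "b \<in> lspan K A (\<Union>p. Ad p)" using z by (simp_all only: A_span)
      fix a b assume "a \<in> (\<Union>p. Ad p)" "b \<in> (\<Union>p. Ad p)"
      then obtain p q where "a \<in> Ad p" "b \<in> Ad q" by blast
      then have "p3 a x b \<in> degs n (int (p + n + q))" using z(3) by blast
      then show "p3 a x b \<in> lspan K AA ?D" by (intro lspan_base) blast
    qed
  qed
qed

text \<open>
  The projection onto total degree \<open>d\<close> is \<open>\<Sum> \<pi>\<^sub>p \<otimes> 1 \<otimes> \<pi>\<^sub>q\<close> over \<open>p + n + q = d\<close>, where the middle factor counts as having
  degree \<open>n\<close>; it does the right thing on \<open>A \<otimes> V\<^bsup>\<otimes>n\<^esup> \<otimes> A\<close>.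
\<close>

lemma AA_degree_projection:
  "\<exists>h. lin K AA AA h \<and> (\<forall>p q a x b. a \<in> Ad p \<longrightarrow> x \<in> carrier T \<longrightarrow> b \<in> Ad q \<longrightarrow>
         h (p3 a x b) = (if int (p + n + q) = d then p3 a x b else \<zero>\<^bsub>AA\<^esub>))"
proof -
  interpret M: module K AA by (rule AA_module)
  let ?I = "{(p, q). int (p + n + q) = d}"
  have "?I \<subseteq> {..nat d} \<times> {..nat d}" by auto
  then have I: "finite ?I" by (rule finite_subset) simp
  let ?t = "\<lambda>a x b. \<Oplus>\<^bsub>AA\<^esub>i\<in>?I. p3 (deg_part_A (fst i) a) x (deg_part_A (snd i) b)"
  note cc = lin_closed[OF deg_part_A_lin]
  have "\<exists>h. lin K AA AA h \<and> (\<forall>a\<in>carrier A. \<forall>x\<in>carrier T. \<forall>b\<in>carrier A. h (p3 a x b) = ?t a x b)"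
  proof (rule AA_lift[OF AA_module])
    show "lin K A AA (\<lambda>a. ?t a x b)" if "x \<in> carrier T" "b \<in> carrier A" for x b
      using that cc by (intro lin_finsum[OF A_module AA_module I] lin_comp[OF deg_part_A_lin p3_lin(1)])
    show "lin K T AA (\<lambda>x. ?t a x b)" if "a \<in> carrier A" "b \<in> carrier A" for a b
      using that cc by (intro lin_finsum[OF T_module AA_module I] p3_lin(2))
    show "lin K A AA (\<lambda>b. ?t a x b)" if "a \<in> carrier A" "x \<in> carrier T" for a x
      using that cc by (intro lin_finsum[OF A_module AA_module I] lin_comp[OF deg_part_A_lin p3_lin(3)])
  qed
  then obtain h where h: "lin K AA AA h"
    "\<And>a x b. a \<in> carrier A \<Longrightarrow> x \<in> carrier T \<Longrightarrow> b \<in> carrier A \<Longrightarrow> h (p3 a x b) = ?t a x b" by blast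
  have "h (p3 a x b) = (if int (p + n + q) = d then p3 a x b else \<zero>\<^bsub>AA\<^esub>)"
    if a: "a \<in> Ad p" and x: "x \<in> carrier T" and b: "b \<in> Ad q" for p q a x b
  proof -
    note ac = Ad_carrier[OF a] and bc = Ad_carrier[OF b]
    have pc: "p3 a x b \<in> carrier AA" by (rule p3_closed[OF ac x bc])
    have t: "p3 (deg_part_A (fst i) a) x (deg_part_A (snd i) b) = (if (p, q) = i then p3 a x b else \<zero>\<^bsub>AA\<^esub>)" for i
      using deg_part_A_Ad[OF a, of "fst i"] deg_part_A_Ad[OF b, of "snd i"] p3_zero ac bc x A_closed(2)
      by (cases i) auto
    have "?t a x b = (\<Oplus>\<^bsub>AA\<^esub>i\<in>?I. if (p, q) = i then p3 a x b else \<zero>\<^bsub>AA\<^esub>)" by (simp only: t)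
    also have "\<dots> = (if int (p + n + q) = d then p3 a x b else \<zero>\<^bsub>AA\<^esub>)"
    proof (cases "(p, q) \<in> ?I")
      case True
      have "(\<Oplus>\<^bsub>AA\<^esub>i\<in>?I. if (p, q) = i then p3 a x b else \<zero>\<^bsub>AA\<^esub>) = p3 a x b"
        using pc by (intro M.finsum_singleton[OF True I]) auto
      then show ?thesis using True by simp
    next
      case False
      have "(\<Oplus>\<^bsub>AA\<^esub>i\<in>?I. if (p, q) = i then p3 a x b else \<zero>\<^bsub>AA\<^esub>) = \<zero>\<^bsub>AA\<^esub>"
        using False by (intro M.add.finprod_one_eqI) auto
      then show ?thesis using False by simp
    qed
    finally show ?thesis using h(2)[OF ac x bc] by simp
  qed
  with h(1) show ?thesis by blast
qed

lemma C_direct_sum: "direct_sum_decomp K (C n) (G n)"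
proof -
  obtain \<pi> where \<pi>: "\<And>d. lin K AA AA (\<pi> d)"
    and \<pi>v: "\<And>d p q a x b. a \<in> Ad p \<Longrightarrow> x \<in> carrier T \<Longrightarrow> b \<in> Ad q \<Longrightarrow>
         \<pi> d (p3 a x b) = (if int (p + n + q) = d then p3 a x b else \<zero>\<^bsub>AA\<^esub>)"
    using AA_degree_projection[of n] by metis
  have \<pi>d: "\<pi> d' z = (if d = d' then z else \<zero>\<^bsub>AA\<^esub>)" if "z \<in> degs n d" for z d d'
    using that \<pi>v J_carrier by auto
  show ?thesis
  proof (rule direct_sum_decompI[OF C_module, where \<pi>=\<pi>])
    show "submodule (G n d) K (C n)" for d using C_submodule_iff[OF G_W] G_submodule by simp
    show "\<pi> d x = x" if "x \<in> G n d" for d x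
      by (rule lin_eq_on_span[OF AA_module AA_module \<pi> lin_id degs_carrier _ that[unfolded G_eq]])
         (drule \<pi>d[of _ d d], simp only: simp_thms if_True)
    show "\<pi> d' x = \<zero>\<^bsub>C n\<^esub>" if "x \<in> G n d" "d \<noteq> d'" for d d' x
      unfolding C_simps
      by (rule lin_eq_on_span[OF AA_module AA_module \<pi> lin_const_zero[OF AA_module] degs_carrier _ that(1)[unfolded G_eq]])
         (drule \<pi>d[of _ d d'], simp only: that(2) if_False)
    show "lspan K (C n) (\<Union>d. G n d) = carrier (C n)"
    proof -
      have GW: "(\<Union>d. G n d) \<subseteq> W n" by (rule UN_least) (rule G_W)
      have "(\<Union>d. degs n d) \<subseteq> (\<Union>d. G n d)" unfolding G_eq by (rule UN_mono[OF subset_refl lspan_superset])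
      then have "W n \<subseteq> lspan K AA (\<Union>d. G n d)" by (subst W_span) (rule lspan_mono)
      then show ?thesis
        unfolding C_lspan[OF GW] C_simps(1) using lspan_least[OF W_submodule GW] by (rule equalityI[rotated])
    qed
    fix d
    have "\<pi> d z \<in> W n" if z: "z \<in> W n" for z
    proof (rule lin_span_mem[OF AA_module AA_module \<pi> _ W_submodule _ z[unfolded W_span]])
      show "(\<Union>d. degs n d) \<subseteq> carrier AA" by (rule UN_least) (rule degs_carrier)
      fix y assume "y \<in> (\<Union>d. degs n d)"
      then obtain d' where y: "y \<in> degs n d'" by (rule UN_E)
      have "y \<in> W n" by (rule lspan_base[OF subsetD[OF degs_gens3 y]])
      then show "\<pi> d y \<in> W n" using \<pi>d[OF y, of d] submodule_zero[OF AA_module W_submodule] by simp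
    qed
    then show "lin K (C n) (C n) (\<pi> d)"
      using \<pi>[of d] W_carrier by (simp add: lin_def C_simps Pi_def)
  qed
qed

lemma G_action:
  assumes a: "a \<in> Ad p" and z: "z \<in> G n d"
  shows "lA a z \<in> G n (int p + d)" and "rA a z \<in> G n (d + int p)"
proof -
  note ac = Ad_carrier[OF a]
  show "lA a z \<in> G n (int p + d)"
  proof (rule lin_span_mem[OF AA_module AA_module lA_lin[OF ac] degs_carrier G_submodule _ z[unfolded G_eq]])
    fix y assume "y \<in> degs n d"
    then obtain a' x b p' q where y: "y = p3 a' x b" "a' \<in> Ad p'" "x \<in> J n" "b \<in> Ad q" "int (p' + n + q) = d" by blast
    have "lA a y = p3 (a \<otimes>\<^bsub>A\<^esub> a') x b" unfolding y(1) by (rule lA_p3[OF ac Ad_carrier[OF y(2)] J_carrier[OF y(3)] Ad_carrier[OF y(4)]])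
    moreover have "int ((p + p') + n + q) = int p + d" using y(5) by simp
    ultimately have "lA a y \<in> degs n (int p + d)" using Ad_mult[OF a y(2)] y(3,4) by blast
    then show "lA a y \<in> G n (int p + d)" unfolding G_eq by (rule lspan_base)
  qed
  show "rA a z \<in> G n (d + int p)"
  proof (rule lin_span_mem[OF AA_module AA_module rA_lin[OF ac] degs_carrier G_submodule _ z[unfolded G_eq]])
    fix y assume "y \<in> degs n d"
    then obtain a' x b p' q where y: "y = p3 a' x b" "a' \<in> Ad p'" "x \<in> J n" "b \<in> Ad q" "int (p' + n + q) = d" by blast
    have "rA a y = p3 a' x (b \<otimes>\<^bsub>A\<^esub> a)" unfolding y(1) by (rule rA_p3[OF ac Ad_carrier[OF y(2)] J_carrier[OF y(3)] Ad_carrier[OF y(4)]])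
    moreover have "int (p' + n + (q + p)) = d + int p" using y(5) by simp
    ultimately have "rA a y \<in> degs n (d + int p)" using Ad_mult[OF y(4) a] y(2,3) by blast
    then show "rA a y \<in> G n (d + int p)" unfolding G_eq by (rule lspan_base)
  qed
qed

lemma C_graded: "graded_bimodule K A Ad (C n) (G n)"
  unfolding graded_bimodule_def
  using C_bimodule C_direct_sum G_action by (simp add: C_simps)

lemma p3_factor:
  assumes "a \<in> carrier A" "x \<in> carrier T" "b \<in> carrier A"
  shows "p3 a x b = lA a (rA b (p3 \<one>\<^bsub>A\<^esub> x \<one>\<^bsub>A\<^esub>))"
  using assms by (simp add: lA_p3 rA_p3 A_closed A_laws)

lemma p3_one_G:
  assumes "x \<in> J n"
  shows "p3 \<one>\<^bsub>A\<^esub> x \<one>\<^bsub>A\<^esub> \<in> G n (int n)"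
proof -
  have "int (0 + n + 0) = int n" by simp
  then have "p3 \<one>\<^bsub>A\<^esub> x \<one>\<^bsub>A\<^esub> \<in> degs n (int n)" using Ad_one assms by blast
  then show ?thesis unfolding G_eq by (rule lspan_base)
qed

lemma C_generated: "generated_in_degree K A (C n) (G n) (int n)"
proof -
  let ?S = "{lact (C n) a (ract (C n) x b) | a x b. a \<in> carrier A \<and> x \<in> G n (int n) \<and> b \<in> carrier A}"
  have S: "?S \<subseteq> W n" by (auto simp: C_simps intro!: lA_W rA_W intro: subsetD[OF G_W])
  have "gens3 n \<subseteq> ?S"
  proof
    fix z assume "z \<in> gens3 n"
    then obtain a x b where z: "z = p3 a x b" "a \<in> carrier A" "x \<in> J n" "b \<in> carrier A" by blast
    have "z = lact (C n) a (ract (C n) (p3 \<one>\<^bsub>A\<^esub> x \<one>\<^bsub>A\<^esub>) b)"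
      unfolding z(1) C_simps by (rule p3_factor[OF z(2) J_carrier[OF z(3)] z(4)])
    then show "z \<in> ?S" using z p3_one_G[OF z(3)] by blast
  qed
  then have "W n \<subseteq> lspan K AA ?S" by (rule lspan_mono)
  then show ?thesis
    unfolding generated_in_degree_def C_lspan[OF S] using lspan_least[OF W_submodule S] by (simp add: C_simps)
qed

section \<open>Projectivity\<close>

text \<open>
  A linear lift \<open>h\<^sub>0\<close> of \<open>x \<mapsto> g (1 \<otimes> x \<otimes> 1)\<close> determines the bimodule map \<open>a \<otimes> x \<otimes> b \<mapsto> a h\<^sub>0(x) b\<close>, which lifts
  \<open>g\<close> since \<open>1 \<otimes> J\<^sub>n \<otimes> 1\<close> generates. The subspace \<open>M'\<close> is all of \<open>M\<close> for plain projectivity and the component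
  of degree \<open>n\<close> for graded projectivity, where the last clause controls the degrees of \<open>h\<close>.
\<close>

lemma C_lift:
  fixes M :: "('k, ('k, 'v) halg, 'm) bimod" and N :: "('k, ('k, 'v) halg, 'n) bimod"
  assumes M: "bimodule K A M" and N: "bimodule K A N" and e: "e \<in> bimod_hom K A M N"
    and g: "g \<in> bimod_hom K A (C n) N" and M': "submodule M' K M"
    and sur: "\<And>x. x \<in> J n \<Longrightarrow> \<exists>m\<in>M'. e m = g (p3 \<one>\<^bsub>A\<^esub> x \<one>\<^bsub>A\<^esub>)"
  shows "\<exists>h\<in>bimod_hom K A (C n) M. lin K AA M h \<and> (\<forall>x\<in>carrier (C n). e (h x) = g x) \<and>
     (\<forall>a\<in>carrier A. \<forall>x\<in>J n. \<forall>b\<in>carrier A. \<exists>y\<in>M'. h (p3 a x b) = lact M a (ract M y b))"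
proof -
  interpret M: bimodule K A M by (rule M)
  interpret N: bimodule K A N by (rule N)
  note Mm = M.module_axioms and Nm = N.module_axioms
  note el = bimod_hom_lin[OF e] and gl = bimod_hom_lin[OF g]
  have p1: "p3 \<one>\<^bsub>A\<^esub> x \<one>\<^bsub>A\<^esub> \<in> W n" if "x \<in> J n" for x
    using that A_closed(1) by (intro lspan_base) blast
  note p1l = p3_lin(2)[OF A_closed(1) A_closed(1)]
  have "lin K (T\<lparr>carrier := J n\<rparr>) N (\<lambda>x. g (p3 \<one>\<^bsub>A\<^esub> x \<one>\<^bsub>A\<^esub>))"
    using p1 lin_closed[OF gl] lin_add[OF gl] lin_smult[OF gl] lin_add[OF p1l] lin_smult[OF p1l] J_carrier
    by (intro linI) (simp_all add: C_simps)
  from lin_lift[OF K T_module Mm Nm J_submodule[OF R_carrier] M' el this sur]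
  obtain h0 where h0: "lin K T M h0"
    and h0v: "\<And>x. x \<in> J n \<Longrightarrow> h0 x \<in> M' \<and> e (h0 x) = g (p3 \<one>\<^bsub>A\<^esub> x \<one>\<^bsub>A\<^esub>)" by blast
  note h0c = lin_closed[OF h0]
  have "\<exists>h. lin K AA M h \<and> (\<forall>a\<in>carrier A. \<forall>x\<in>carrier T. \<forall>b\<in>carrier A.
      h (p3 a x b) = lact M a (ract M (h0 x) b))"
  proof (rule AA_lift[OF Mm])
    show "lin K A M (\<lambda>a. lact M a (ract M (h0 x) b))" if "x \<in> carrier T" "b \<in> carrier A" for x b
      by (rule M.lact_lin'[OF A_kalg M.ract_closed[OF that(2) h0c[OF that(1)]]])
    show "lin K T M (\<lambda>x. lact M a (ract M (h0 x) b))" if "a \<in> carrier A" "b \<in> carrier A" for a b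
      by (rule lin_comp[OF lin_comp[OF h0 M.ract_lin[OF that(2)]] M.lact_lin[OF that(1)]])
    show "lin K A M (\<lambda>b. lact M a (ract M (h0 x) b))" if "a \<in> carrier A" "x \<in> carrier T" for a x
      by (rule lin_comp[OF M.ract_lin'[OF A_kalg h0c[OF that(2)]] M.lact_lin[OF that(1)]])
  qed
  then obtain h where h: "lin K AA M h"
    and hv: "\<And>a x b. a \<in> carrier A \<Longrightarrow> x \<in> carrier T \<Longrightarrow> b \<in> carrier A \<Longrightarrow>
      h (p3 a x b) = lact M a (ract M (h0 x) b)" by blast
  have hl: "h (lA a z) = lact M a (h z)" if a: "a \<in> carrier A" and z: "z \<in> carrier AA" for a z
    by (rule AA_lin_eq[OF Mm lin_comp[OF lA_lin[OF a] h] lin_comp[OF h M.lact_lin[OF a]] _ z])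
       (simp add: lA_p3 a word_closed hv A_closed M.lact_mult M.ract_closed h0c)
  have hr: "h (rA a z) = ract M (h z) a" if a: "a \<in> carrier A" and z: "z \<in> carrier AA" for a z
    by (rule AA_lin_eq[OF Mm lin_comp[OF rA_lin[OF a] h] lin_comp[OF h M.ract_lin[OF a]] _ z])
       (simp add: rA_p3 a word_closed hv A_closed M.ract_mult M.ract_closed h0c M.lact_ract)
  have hC: "lin K (C n) M h" using h W_carrier by (simp add: lin_def C_simps Pi_def)
  have hb: "h \<in> bimod_hom K A (C n) M"
    using hC hl hr W_carrier unfolding bimod_hom_def lin_def by (simp add: C_simps)
  have "e (h z) = g z" if "z \<in> carrier (C n)" for z
  proof (rule lin_eq_on_span[OF C_module Nm lin_comp[OF hC el] gl])
    show "gens3 n \<subseteq> carrier (C n)" unfolding C_simps by (rule lspan_superset)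
    show "z \<in> lspan K (C n) (gens3 n)" using that C_lspan[OF lspan_superset, of n] by (simp only: C_simps)
    fix y assume "y \<in> gens3 n"
    then obtain a x b where y: "y = p3 a x b" "a \<in> carrier A" "x \<in> J n" "b \<in> carrier A" by blast
    note xc = J_carrier[OF y(3)]
    have g': "g (lact (C n) a u) = lact N a (g u)" "g (ract (C n) u b) = ract N (g u) b" if "u \<in> W n" for u
      using g that y(2,4) unfolding bimod_hom_def by (auto simp: C_simps)
    have e': "e (lact M a u) = lact N a (e u)" "e (ract M u b) = ract N (e u) b" if "u \<in> carrier M" for u
      using e that y(2,4) unfolding bimod_hom_def by auto
    have "e (h y) = lact N a (ract N (e (h0 x)) b)"
      unfolding y(1) hv[OF y(2) xc y(4)] using e' h0c[OF xc] M.ract_closed[OF y(4)] by simp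
    also have "\<dots> = g (lact (C n) a (ract (C n) (p3 \<one>\<^bsub>A\<^esub> x \<one>\<^bsub>A\<^esub>) b))"
      using g' p1[OF y(3)] rA_W[OF y(4) p1[OF y(3)]] h0v[OF y(3)] by (simp add: C_simps)
    also have "\<dots> = g y"
      unfolding y(1) C_simps p3_factor[OF y(2) xc y(4), symmetric] ..
    finally show "e (h y) = g y" .
  qed
  moreover have "\<exists>y\<in>M'. h (p3 a x b) = lact M a (ract M y b)"
    if "a \<in> carrier A" "x \<in> J n" "b \<in> carrier A" for a x b
    using hv[OF that(1) J_carrier[OF that(2)] that(3)] h0v[OF that(2)] by blast
  ultimately show ?thesis using hb h by blast
qed

lemma C_projective: "projective_bimodule TYPE('m) TYPE('n) K A (C n)"
  unfolding projective_bimodule_def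
proof (intro conjI C_bimodule allI impI)
  fix M :: "('k, ('k, 'v) halg, 'm) bimod" and N :: "('k, ('k, 'v) halg, 'n) bimod" and e g
  assume H: "bimodule K A M \<and> bimodule K A N \<and> e \<in> bimod_hom K A M N \<and> e ` carrier M = carrier N \<and>
    g \<in> bimod_hom K A (C n) N"
  then have M: "bimodule K A M" and N: "bimodule K A N" and e: "e \<in> bimod_hom K A M N"
    and eM: "e ` carrier M = carrier N" and g: "g \<in> bimod_hom K A (C n) N" by auto
  have "\<exists>m\<in>carrier M. e m = g (p3 \<one>\<^bsub>A\<^esub> x \<one>\<^bsub>A\<^esub>)" if "x \<in> J n" for x
  proof -
    have "p3 \<one>\<^bsub>A\<^esub> x \<one>\<^bsub>A\<^esub> \<in> carrier (C n)" using p3_one_G[OF that] G_W by (auto simp: C_simps)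
    then have "g (p3 \<one>\<^bsub>A\<^esub> x \<one>\<^bsub>A\<^esub>) \<in> e ` carrier M" unfolding eM by (rule lin_closed[OF bimod_hom_lin[OF g]])
    then show ?thesis by auto
  qed
  from C_lift[OF M N e g module.carrier_is_submodule[OF bimodule.axioms(2)[OF M]] this]
  show "\<exists>h\<in>bimod_hom K A (C n) M. \<forall>x\<in>carrier (C n). e (h x) = g x" by blast
qed

text \<open>
  If \<open>e m = y\<close> is homogeneous of degree \<open>d\<close>, uniqueness of decompositions in \<open>N\<close> shows that the component
  of \<open>m\<close> of degree \<open>d\<close> is already mapped to \<open>y\<close>.
\<close>

lemma graded_surj:
  assumes M: "graded_bimodule K A Ad M GM" and N: "graded_bimodule K A Ad N GN"
    and e: "e \<in> bimod_hom K A M N" and e0: "degree_zero e GM GN" and eM: "e ` carrier M = carrier N"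
    and y: "y \<in> GN d"
  shows "\<exists>m\<in>GM d. e m = y"
proof -
  have Mb: "module K M" and Nb: "module K N" using M N by (auto simp: graded_bimodule_def bimodule_def)
  have dM: "direct_sum_decomp K M GM" and dN: "direct_sum_decomp K N GN"
    using M N by (auto simp: graded_bimodule_def)
  interpret N: module K N by (rule Nb)
  note el = bimod_hom_lin[OF e]
  have GM: "\<And>d. submodule (GM d) K M" and GN: "\<And>d. submodule (GN d) K N"
    using dM dN by (auto simp: direct_sum_decomp_def)
  note GM' = submodule_facts[OF Mb GM] and GN' = submodule_facts[OF Nb GN]
  have yc: "y \<in> carrier N" using y GN'(1) by blast
  then obtain m where m: "m \<in> carrier M" "y = e m" using eM by blast
  then obtain f where f: "\<And>d. f d \<in> GM d" "finite {d. f d \<noteq> \<zero>\<^bsub>M\<^esub>}" "m = (\<Oplus>\<^bsub>M\<^esub>d\<in>{d. f d \<noteq> \<zero>\<^bsub>M\<^esub>}. f d)"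
    using dM unfolding direct_sum_decomp_def by metis
  have fc: "f d \<in> carrier M" for d using f(1) GM'(1) by blast
  have efG: "e (f d) \<in> GN d" for d using e0 f(1) by (auto simp: degree_zero_def)
  then have efc: "e (f d) \<in> carrier N" for d using GN'(1) by blast
  have e00: "e \<zero>\<^bsub>M\<^esub> = \<zero>\<^bsub>N\<^esub>" by (rule lin_zero[OF Mb Nb el])
  have sub: "{d. e (f d) \<noteq> \<zero>\<^bsub>N\<^esub>} \<subseteq> {d. f d \<noteq> \<zero>\<^bsub>M\<^esub>}" using e00 by auto
  have "y = (\<Oplus>\<^bsub>N\<^esub>d\<in>{d. f d \<noteq> \<zero>\<^bsub>M\<^esub>}. e (f d))"
    using lin_of_finsum[OF Mb Nb el f(2), of f] fc m(2) f(3) by simp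
  also have "\<dots> = (\<Oplus>\<^bsub>N\<^esub>d\<in>{d. e (f d) \<noteq> \<zero>\<^bsub>N\<^esub>}. e (f d))"
    using sub f(2) efc by (intro N.add.finprod_mono_neutral_cong_right) auto
  finally have y1: "y = (\<Oplus>\<^bsub>N\<^esub>d\<in>{d. e (f d) \<noteq> \<zero>\<^bsub>N\<^esub>}. e (f d))" .
  let ?g = "\<lambda>d'. if d' = d then y else \<zero>\<^bsub>N\<^esub>"
  have "{d'. ?g d' \<noteq> \<zero>\<^bsub>N\<^esub>} = (if y = \<zero>\<^bsub>N\<^esub> then {} else {d})" by auto
  then have y2: "finite {d'. ?g d' \<noteq> \<zero>\<^bsub>N\<^esub>}" "y = (\<Oplus>\<^bsub>N\<^esub>d'\<in>{d'. ?g d' \<noteq> \<zero>\<^bsub>N\<^esub>}. ?g d')"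
    using yc by simp_all
  let ?P = "\<lambda>f. (\<forall>d. f d \<in> GN d) \<and> finite {d. f d \<noteq> \<zero>\<^bsub>N\<^esub>} \<and> y = (\<Oplus>\<^bsub>N\<^esub>d\<in>{d. f d \<noteq> \<zero>\<^bsub>N\<^esub>}. f d)"
  have "\<exists>!f. ?P f"
    using dN yc unfolding direct_sum_decomp_def by blast
  then obtain f0 where f0: "?P f0" "\<forall>f f'. ?P f \<and> ?P f' \<longrightarrow> f = f'" by (rule alt_ex1E)
  have P1: "?P (\<lambda>d. e (f d))"
    using efG y1 finite_subset[OF sub f(2)] by blast
  have P2: "?P ?g"
    using y y2 GN'(2) by simp
  have "(\<lambda>d. e (f d)) = ?g"
    by (rule f0(2)[THEN spec, THEN spec, THEN mp, OF conjI[OF P1 P2]])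
  then have "e (f d) = y" by (simp add: fun_eq_iff)
  then show ?thesis using f(1) by blast
qed

lemma C_graded_projective: "graded_projective_bimodule TYPE('m) TYPE('n) K A Ad (C n) (G n)"
  unfolding graded_projective_bimodule_def
proof (intro conjI C_graded allI impI)
  fix M :: "('k, ('k, 'v) halg, 'm) bimod" and GM and N :: "('k, ('k, 'v) halg, 'n) bimod" and GN e g
  assume H: "graded_bimodule K A Ad M GM \<and> graded_bimodule K A Ad N GN \<and>
        e \<in> bimod_hom K A M N \<and> degree_zero e GM GN \<and> e ` carrier M = carrier N \<and>
        g \<in> bimod_hom K A (C n) N \<and> degree_zero g (G n) GN"
  then have MG: "graded_bimodule K A Ad M GM" and NG: "graded_bimodule K A Ad N GN"
    and e: "e \<in> bimod_hom K A M N" and e0: "degree_zero e GM GN" and eM: "e ` carrier M = carrier N"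
    and g: "g \<in> bimod_hom K A (C n) N" and g0: "degree_zero g (G n) GN" by auto
  have M: "bimodule K A M" and N: "bimodule K A N" using MG NG by (auto simp: graded_bimodule_def)
  note Mm = bimodule.axioms(2)[OF M]
  have GM: "\<And>d. submodule (GM d) K M" using MG by (auto simp: graded_bimodule_def direct_sum_decomp_def)
  have act: "lact M a x \<in> GM (int p + d)" "ract M x a \<in> GM (d + int p)" if "a \<in> Ad p" "x \<in> GM d" for a p x d
    using MG that by (auto simp: graded_bimodule_def)
  have "\<exists>m\<in>GM (int n). e m = g (p3 \<one>\<^bsub>A\<^esub> x \<one>\<^bsub>A\<^esub>)" if "x \<in> J n" for x
  proof (rule graded_surj[OF MG NG e e0 eM])
    show "g (p3 \<one>\<^bsub>A\<^esub> x \<one>\<^bsub>A\<^esub>) \<in> GN (int n)" using g0 p3_one_G[OF that] by (auto simp: degree_zero_def)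
  qed
  from C_lift[OF M N e g GM this] obtain h where h: "h \<in> bimod_hom K A (C n) M" "lin K AA M h"
    "\<forall>x\<in>carrier (C n). e (h x) = g x"
    "\<And>a x b. a \<in> carrier A \<Longrightarrow> x \<in> J n \<Longrightarrow> b \<in> carrier A \<Longrightarrow> \<exists>y\<in>GM (int n). h (p3 a x b) = lact M a (ract M y b)"
    by blast
  have "h z \<in> GM d" if z: "z \<in> G n d" for z d
  proof (rule lin_span_mem[OF AA_module Mm h(2) degs_carrier GM _ z[unfolded G_eq]])
    fix y assume "y \<in> degs n d"
    then obtain a x b p q where y: "y = p3 a x b" "a \<in> Ad p" "x \<in> J n" "b \<in> Ad q" "int (p + n + q) = d" by blast
    then obtain u where "u \<in> GM (int n)" "h y = lact M a (ract M u b)"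
      using h(4)[OF Ad_carrier[OF y(2)] y(3) Ad_carrier[OF y(4)]] by blast
    then have "h y \<in> GM (int p + (int n + int q))" using act y by simp
    then show "h y \<in> GM d" using y(5) by (simp add: algebra_simps)
  qed
  then have "degree_zero h (G n) GM" by (auto simp: degree_zero_def)
  then show "\<exists>h\<in>bimod_hom K A (C n) M. degree_zero h (G n) GM \<and> (\<forall>x\<in>carrier (C n). e (h x) = g x)"
    using h by blast
qed

section \<open>The complex\<close>

text \<open>
  Bimodule maps of the ambient space that lower the index by \<open>k\<close> and preserve the total degree, for all
  indices simultaneously. This class is closed under composition and sums, which covers all
  differentials at once.
\<close>

definition lowers :: "nat \<Rightarrow> (('k, 'v) atensa \<Rightarrow> ('k, 'v) atensa) \<Rightarrow> bool" where
  "lowers k f \<longleftrightarrow> lin K AA AA f \<and>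
     (\<forall>a\<in>carrier A. \<forall>z\<in>carrier AA. f (lA a z) = lA a (f z) \<and> f (rA a z) = rA a (f z)) \<and>
     (\<forall>n. \<forall>z\<in>W (n + k). f z \<in> W n) \<and> (\<forall>n d. \<forall>z\<in>G (n + k) d. f z \<in> G n d)"

lemma lowers_bimod_hom: "lowers k f \<Longrightarrow> f \<in> bimod_hom K A (C (n + k)) (C n)"
  unfolding lowers_def bimod_hom_def lin_def using W_carrier by (simp add: C_simps)

lemma lowers_degree_zero: "lowers k f \<Longrightarrow> degree_zero f (G (n + k)) (G n)"
  unfolding lowers_def degree_zero_def by blast

lemma lowers_comp:
  assumes f: "lowers k f" and g: "lowers l g"
  shows "lowers (k + l) (\<lambda>z. f (g z))"
proof -
  have lf: "lin K AA AA f" and lg: "lin K AA AA g" using f g by (simp_all add: lowers_def)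
  have gc: "g z \<in> carrier AA" if "z \<in> carrier AA" for z by (rule lin_closed[OF lg that])
  have fW: "f z \<in> W n" if "z \<in> W (n + k)" for z n using f that by (simp add: lowers_def)
  have gW: "g z \<in> W (n + k)" if "z \<in> W (n + (k + l))" for z n
    using g that by (simp add: lowers_def flip: add.assoc)
  have fG: "f z \<in> G n d" if "z \<in> G (n + k) d" for z n d using f that by (simp add: lowers_def)
  have gG: "g z \<in> G (n + k) d" if "z \<in> G (n + (k + l)) d" for z n d
    using g that by (simp add: lowers_def flip: add.assoc)
  show ?thesis
    unfolding lowers_def
  proof (intro conjI ballI allI)
    show "lin K AA AA (\<lambda>z. f (g z))" by (rule lin_comp[OF lg lf])
    show "f (g (lA a z)) = lA a (f (g z))" "f (g (rA a z)) = rA a (f (g z))"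
      if "a \<in> carrier A" "z \<in> carrier AA" for a z
      using f g that gc by (simp_all add: lowers_def)
    show "f (g z) \<in> W n" if "z \<in> W (n + (k + l))" for n z by (rule fW[OF gW[OF that]])
    show "f (g z) \<in> G n d" if "z \<in> G (n + (k + l)) d" for n d z by (rule fG[OF gG[OF that]])
  qed
qed

lemma lowers_id: "lowers 0 (\<lambda>z. z)"
  by (simp add: lowers_def lin_id)

lemma lowers_funpow: "lowers 1 f \<Longrightarrow> lowers k (f ^^ k)"
proof (induction k)
  case 0
  show ?case using lowers_id by (simp add: id_def)
next
  case (Suc k)
  from lowers_comp[OF Suc.prems Suc.IH[OF Suc.prems]] show ?case by (simp add: o_def)
qed

lemma lowers_finsum:
  assumes "finite I" "\<And>i. i \<in> I \<Longrightarrow> lowers k (f i)"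
  shows "lowers k (\<lambda>z. \<Oplus>\<^bsub>AA\<^esub>i\<in>I. f i z)"
proof -
  interpret M: module K AA by (rule AA_module)
  have l: "lin K AA AA (f i)" if "i \<in> I" for i using assms(2)[OF that] by (simp add: lowers_def)
  show ?thesis unfolding lowers_def
  proof (intro conjI ballI allI)
    show "lin K AA AA (\<lambda>z. \<Oplus>\<^bsub>AA\<^esub>i\<in>I. f i z)" by (rule lin_finsum[OF AA_module AA_module assms(1) l])
    show "(\<Oplus>\<^bsub>AA\<^esub>i\<in>I. f i z) \<in> W n" if "z \<in> W (n + k)" for n z
      using that assms(2) by (intro submodule_finsum[OF AA_module W_submodule assms(1)]) (simp add: lowers_def)
    show "(\<Oplus>\<^bsub>AA\<^esub>i\<in>I. f i z) \<in> G n d" if "z \<in> G (n + k) d" for n d z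
      using that assms(2) by (intro submodule_finsum[OF AA_module G_submodule assms(1)]) (simp add: lowers_def)
    fix a z assume a: "a \<in> carrier A" and z: "z \<in> carrier AA"
    show "(\<Oplus>\<^bsub>AA\<^esub>i\<in>I. f i (lA a z)) = lA a (\<Oplus>\<^bsub>AA\<^esub>i\<in>I. f i z)"
    proof -
      have "lA a (\<Oplus>\<^bsub>AA\<^esub>i\<in>I. f i z) = (\<Oplus>\<^bsub>AA\<^esub>i\<in>I. lA a (f i z))"
        by (rule lin_of_finsum[OF AA_module AA_module lA_lin[OF a] assms(1) lin_closed[OF l z]])
      also have "\<dots> = (\<Oplus>\<^bsub>AA\<^esub>i\<in>I. f i (lA a z))"
        using a z assms(2) lin_closed[OF l lin_closed[OF lA_lin[OF a] z]]
        by (intro M.finsum_cong') (simp_all add: lowers_def Pi_def)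
      finally show ?thesis by (rule sym)
    qed
    show "(\<Oplus>\<^bsub>AA\<^esub>i\<in>I. f i (rA a z)) = rA a (\<Oplus>\<^bsub>AA\<^esub>i\<in>I. f i z)"
    proof -
      have "rA a (\<Oplus>\<^bsub>AA\<^esub>i\<in>I. f i z) = (\<Oplus>\<^bsub>AA\<^esub>i\<in>I. rA a (f i z))"
        by (rule lin_of_finsum[OF AA_module AA_module rA_lin[OF a] assms(1) lin_closed[OF l z]])
      also have "\<dots> = (\<Oplus>\<^bsub>AA\<^esub>i\<in>I. f i (rA a z))"
        using a z assms(2) lin_closed[OF l lin_closed[OF rA_lin[OF a] z]]
        by (intro M.finsum_cong') (simp_all add: lowers_def Pi_def)
      finally show ?thesis by (rule sym)
    qed
  qed
qed

lemma lowers_diff: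
  assumes f: "lowers k f" and g: "lowers k g"
  shows "lowers k (\<lambda>z. f z \<ominus>\<^bsub>AA\<^esub> g z)"
proof -
  have l: "lin K AA AA f" "lin K AA AA g" using f g by (simp_all add: lowers_def)
  show ?thesis unfolding lowers_def
  proof (intro conjI ballI allI)
    show "lin K AA AA (\<lambda>z. f z \<ominus>\<^bsub>AA\<^esub> g z)" by (rule lin_diff[OF AA_module AA_module l])
    show "f z \<ominus>\<^bsub>AA\<^esub> g z \<in> W n" if "z \<in> W (n + k)" for n z
      using that f g by (intro submodule_diff[OF AA_module W_submodule]) (simp_all add: lowers_def)
    show "f z \<ominus>\<^bsub>AA\<^esub> g z \<in> G n d" if "z \<in> G (n + k) d" for n d z
      using that f g by (intro submodule_diff[OF AA_module G_submodule]) (simp_all add: lowers_def)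
    fix a z assume a: "a \<in> carrier A" and z: "z \<in> carrier AA"
    note c = lin_closed[OF l(1) z] lin_closed[OF l(2) z]
    show "f (lA a z) \<ominus>\<^bsub>AA\<^esub> g (lA a z) = lA a (f z \<ominus>\<^bsub>AA\<^esub> g z)"
      using f g a z lin_minus[OF AA_module AA_module lA_lin[OF a] c] by (simp add: lowers_def)
    show "f (rA a z) \<ominus>\<^bsub>AA\<^esub> g (rA a z) = rA a (f z \<ominus>\<^bsub>AA\<^esub> g z)"
      using f g a z lin_minus[OF AA_module AA_module rA_lin[OF a] c] by (simp add: lowers_def)
  qed
qed

lemma dL_lA_rA:
  assumes a: "a \<in> carrier A" and z: "z \<in> carrier AA"
  shows "dL (lA a z) = lA a (dL z)" and "dL (rA a z) = rA a (dL z)"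
    and "dR (lA a z) = lA a (dR z)" and "dR (rA a z) = rA a (dR z)"
proof -
  note z0 = lin_zero[OF AA_module AA_module lA_lin[OF a]] lin_zero[OF AA_module AA_module rA_lin[OF a]]
  note cl = A_closed(3) proj_closed vec_closed word_closed
  show "dL (lA a z) = lA a (dL z)"
  proof (rule AA_lin_eq[OF AA_module lin_comp[OF lA_lin[OF a] dL_lin] lin_comp[OF dL_lin lA_lin[OF a]] _ z])
    fix a' w b assume h: "a' \<in> carrier A" "w \<in> Lists" "b \<in> carrier A"
    then show "dL (lA a (p3 a' (wd w) b)) = lA a (dL (p3 a' (wd w) b))"
      using a by (cases w) (simp_all add: lA_p3 cl dL_Nil dL_Cons z0 A_laws)
  qed
  show "dL (rA a z) = rA a (dL z)"
  proof (rule AA_lin_eq[OF AA_module lin_comp[OF rA_lin[OF a] dL_lin] lin_comp[OF dL_lin rA_lin[OF a]] _ z])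
    fix a' w b assume h: "a' \<in> carrier A" "w \<in> Lists" "b \<in> carrier A"
    then show "dL (rA a (p3 a' (wd w) b)) = rA a (dL (p3 a' (wd w) b))"
      using a by (cases w) (simp_all add: rA_p3 cl dL_Nil dL_Cons z0 A_laws)
  qed
  show "dR (lA a z) = lA a (dR z)"
  proof (rule AA_lin_eq[OF AA_module lin_comp[OF lA_lin[OF a] dR_lin] lin_comp[OF dR_lin lA_lin[OF a]] _ z])
    fix a' w b assume h: "a' \<in> carrier A" "w \<in> Lists" "b \<in> carrier A"
    then show "dR (lA a (p3 a' (wd w) b)) = lA a (dR (p3 a' (wd w) b))"
      using a by (cases w rule: rev_cases) (simp_all add: lA_p3 cl dR_Nil dR_snoc z0 A_laws)
  qed
  show "dR (rA a z) = rA a (dR z)"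
  proof (rule AA_lin_eq[OF AA_module lin_comp[OF rA_lin[OF a] dR_lin] lin_comp[OF dR_lin rA_lin[OF a]] _ z])
    fix a' w b assume h: "a' \<in> carrier A" "w \<in> Lists" "b \<in> carrier A"
    then show "dR (rA a (p3 a' (wd w) b)) = rA a (dR (p3 a' (wd w) b))"
      using a by (cases w rule: rev_cases) (simp_all add: rA_p3 cl dR_Nil dR_snoc z0 A_laws)
  qed
qed

lemma dL_lowers: "lowers 1 dL"
  unfolding lowers_def
proof (intro conjI ballI allI dL_lin)
  show "dL (lA a z) = lA a (dL z)" "dL (rA a z) = rA a (dL z)" if "a \<in> carrier A" "z \<in> carrier AA" for a z
    using dL_lA_rA[OF that] by auto
  show "dL z \<in> W n" if "z \<in> W (n + 1)" for n z
  proof (rule lin_span_mem[OF AA_module AA_module dL_lin gens3_carrier W_submodule _ that])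
    fix y assume "y \<in> gens3 (n + 1)"
    then obtain a x b where y: "y = p3 a x b" "a \<in> carrier A" "x \<in> J (Suc n)" "b \<in> carrier A" by auto
    show "dL y \<in> W n" unfolding y(1)
    proof (rule dL_J_mem[OF y(3,2,4) W_submodule])
      fix v u assume v: "v \<in> carrier V" and u: "u \<in> J n"
      have "a \<otimes>\<^bsub>A\<^esub> pj (wd [v]) \<in> carrier A" by (rule A_closed(3)[OF y(2) proj_closed[OF vec_closed[OF v]]])
      then show "p3 (a \<otimes>\<^bsub>A\<^esub> pj (wd [v])) u b \<in> W n" using u y(4) by (intro lspan_base) blast
    qed
  qed
  show "dL z \<in> G n d" if "z \<in> G (n + 1) d" for n d z
  proof (rule lin_span_mem[OF AA_module AA_module dL_lin degs_carrier G_submodule _ that[unfolded G_eq]])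
    fix y assume "y \<in> degs (n + 1) d"
    then obtain a x b p q where y: "y = p3 a x b" "a \<in> Ad p" "x \<in> J (Suc n)" "b \<in> Ad q" "int (p + (n + 1) + q) = d"
      by auto
    show "dL y \<in> G n d" unfolding y(1)
    proof (rule dL_J_mem[OF y(3) Ad_carrier[OF y(2)] Ad_carrier[OF y(4)] G_submodule])
      fix v u assume v: "v \<in> carrier V" and u: "u \<in> J n"
      have "a \<otimes>\<^bsub>A\<^esub> pj (wd [v]) \<in> Ad (p + 1)" by (rule Ad_mult[OF y(2) Ad_vec[OF v]])
      moreover have "int ((p + 1) + n + q) = d" using y(5) by simp
      ultimately have "p3 (a \<otimes>\<^bsub>A\<^esub> pj (wd [v])) u b \<in> degs n d" using u y(4) by blast
      then show "p3 (a \<otimes>\<^bsub>A\<^esub> pj (wd [v])) u b \<in> G n d" unfolding G_eq by (rule lspan_base)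
    qed
  qed
qed

lemma dR_lowers: "lowers 1 dR"
  unfolding lowers_def
proof (intro conjI ballI allI dR_lin)
  show "dR (lA a z) = lA a (dR z)" "dR (rA a z) = rA a (dR z)" if "a \<in> carrier A" "z \<in> carrier AA" for a z
    using dL_lA_rA[OF that] by auto
  show "dR z \<in> W n" if "z \<in> W (n + 1)" for n z
  proof (rule lin_span_mem[OF AA_module AA_module dR_lin gens3_carrier W_submodule _ that])
    fix y assume "y \<in> gens3 (n + 1)"
    then obtain a x b where y: "y = p3 a x b" "a \<in> carrier A" "x \<in> J (Suc n)" "b \<in> carrier A" by auto
    show "dR y \<in> W n" unfolding y(1)
    proof (rule dR_J_mem[OF y(3,2,4) W_submodule])
      fix v u assume v: "v \<in> carrier V" and u: "u \<in> J n"
      have "pj (wd [v]) \<otimes>\<^bsub>A\<^esub> b \<in> carrier A" by (rule A_closed(3)[OF proj_closed[OF vec_closed[OF v]] y(4)])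
      then show "p3 a u (pj (wd [v]) \<otimes>\<^bsub>A\<^esub> b) \<in> W n" using u y(2) by (intro lspan_base) blast
    qed
  qed
  show "dR z \<in> G n d" if "z \<in> G (n + 1) d" for n d z
  proof (rule lin_span_mem[OF AA_module AA_module dR_lin degs_carrier G_submodule _ that[unfolded G_eq]])
    fix y assume "y \<in> degs (n + 1) d"
    then obtain a x b p q where y: "y = p3 a x b" "a \<in> Ad p" "x \<in> J (Suc n)" "b \<in> Ad q" "int (p + (n + 1) + q) = d"
      by auto
    show "dR y \<in> G n d" unfolding y(1)
    proof (rule dR_J_mem[OF y(3) Ad_carrier[OF y(2)] Ad_carrier[OF y(4)] G_submodule])
      fix v u assume v: "v \<in> carrier V" and u: "u \<in> J n"
      have "pj (wd [v]) \<otimes>\<^bsub>A\<^esub> b \<in> Ad (1 + q)" by (rule Ad_mult[OF Ad_vec[OF v] y(4)])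
      moreover have "int (p + n + (1 + q)) = d" using y(5) by simp
      ultimately have "p3 a u (pj (wd [v]) \<otimes>\<^bsub>A\<^esub> b) \<in> degs n d" using u y(2) by blast
      then show "p3 a u (pj (wd [v]) \<otimes>\<^bsub>A\<^esub> b) \<in> G n d" unfolding G_eq by (rule lspan_base)
    qed
  qed
qed

lemma s_complexI:
  assumes f: "lowers 1 f"
    and nil: "\<And>n a x b. a \<in> carrier A \<Longrightarrow> x \<in> J n \<Longrightarrow> b \<in> carrier A \<Longrightarrow> (f ^^ s) (p3 a x b) = \<zero>\<^bsub>AA\<^esub>"
    and zero: "\<And>a b. a \<in> carrier A \<Longrightarrow> b \<in> carrier A \<Longrightarrow> f (p3 a (wd []) b) = \<zero>\<^bsub>AA\<^esub>"
  shows "s_complex_of_bimodules K A s C f"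
  unfolding s_complex_of_bimodules_def
proof (intro conjI allI ballI C_bimodule)
  have l: "lin K AA AA f" using f by (simp add: lowers_def)
  show "f \<in> bimod_hom K A (C (Suc n)) (C n)" for n using lowers_bimod_hom[OF f, of n] by simp
  show "(f ^^ s) z = \<zero>\<^bsub>C n\<^esub>" if "z \<in> carrier (C n)" for n z
    unfolding C_simps
    by (rule lin_eq_on_span[OF AA_module AA_module lin_funpow[OF l] lin_const_zero[OF AA_module] gens3_carrier
          _ that[unfolded C_simps]]) (auto simp: nil)
  fix z assume z: "z \<in> carrier (C 0)"
  show "f z = \<zero>\<^bsub>C 0\<^esub>"
    unfolding C_simps
  proof (rule lin_eq_on_span[OF AA_module AA_module l lin_const_zero[OF AA_module] gens3_carrier
          _ z[unfolded C_simps]])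
    fix y assume "y \<in> gens3 0"
    then obtain a x b where y: "y = p3 a x b" "a \<in> carrier A" "x \<in> J 0" "b \<in> carrier A" by blast
    have "x \<in> tpow K V 0" using y(3) s2 by (simp add: J_space_def)
    then show "f y = \<zero>\<^bsub>AA\<^esub>" unfolding y(1)
      by (rule tpow_lin_eq[OF AA_module lin_comp[OF p3_lin(2)[OF y(2,4)] l] lin_const_zero[OF AA_module], rotated])
         (simp add: zero y)
  qed
qed

lemma s_complex_dL: "s_complex_of_bimodules K A s C dL"
  by (rule s_complexI[OF dL_lowers dL_nilpotent dL_Nil])

lemma s_complex_dR: "s_complex_of_bimodules K A s C dR"
  by (rule s_complexI[OF dR_lowers dR_nilpotent dR_Nil])

abbreviation "dK \<equiv> d' K V s R"

text \<open>
  The differential for even index, equal to \<open>(\<delta>'\<^sub>L\<^sup>s - \<delta>'\<^sub>R\<^sup>s) / (\<delta>'\<^sub>L - \<delta>'\<^sub>R)\<close> as a formal polynomial.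
\<close>

definition mixed :: "('k, 'v) atensa \<Rightarrow> ('k, 'v) atensa" where
  "mixed z = (\<Oplus>\<^bsub>AA\<^esub>j\<in>{..<s}. (dL ^^ (s - 1 - j)) ((dR ^^ j) z))"

lemma dK_odd: "odd i \<Longrightarrow> dK i = (\<lambda>z. dL z \<ominus>\<^bsub>AA\<^esub> dR z)"
  by (simp add: d'_def fun_eq_iff)

lemma dK_even: "even i \<Longrightarrow> dK i = mixed"
  by (simp add: d'_def fun_eq_iff mixed_def)

lemma mixed_lowers: "lowers (s - 1) mixed"
  unfolding mixed_def[abs_def]
proof (rule lowers_finsum)
  fix j assume "j \<in> {..<s}"
  then have "s - 1 - j + j = s - 1" by auto
  with lowers_comp[OF lowers_funpow[OF dL_lowers, of "s - 1 - j"] lowers_funpow[OF dR_lowers, of j]]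
  show "lowers (s - 1) (\<lambda>z. (dL ^^ (s - 1 - j)) ((dR ^^ j) z))" by simp
qed simp

lemma ndeg_step:
  assumes "i \<ge> 1"
  shows "ndeg s i = ndeg s (i - 1) + (if odd i then 1 else s - 1)"
proof (cases "odd i")
  case True
  then obtain j where "i = 2 * j + 1" by (rule oddE)
  then show ?thesis by (simp add: ndeg_def)
next
  case False
  then have "even i" by simp
  then obtain j where "i = 2 * j" by (rule evenE)
  moreover with assms obtain k where "j = Suc k" by (cases j) auto
  ultimately show ?thesis using s2 by (simp add: ndeg_def)
qed

lemma dK_lowers: "lowers (if odd i then 1 else s - 1) (dK i)"
  using lowers_diff[OF dL_lowers dR_lowers] mixed_lowers by (simp add: dK_odd dK_even)

lemma funpow_commute:
  assumes f: "lin K AA AA f" and g: "lin K AA AA g" and fg: "\<And>z. z \<in> carrier AA \<Longrightarrow> f (g z) = g (f z)"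
    and z: "z \<in> carrier AA"
  shows "f ((g ^^ j) z) = (g ^^ j) (f z)"
proof (induction j)
  case (Suc j)
  have "f ((g ^^ Suc j) z) = g (f ((g ^^ j) z))" using fg[OF lin_closed[OF lin_funpow[OF g] z]] by simp
  then show ?case using Suc by simp
qed simp

lemma telescope:
  assumes "\<And>j. t j \<in> carrier AA"
  shows "(\<Oplus>\<^bsub>AA\<^esub>j\<in>{..<n}. t (Suc j)) \<oplus>\<^bsub>AA\<^esub> t 0 = (\<Oplus>\<^bsub>AA\<^esub>j\<in>{..<n}. t j) \<oplus>\<^bsub>AA\<^esub> t (n::nat)"
proof (induction n)
  case 0
  interpret M: module K AA by (rule AA_module)
  show ?case by simp
next
  case (Suc n)
  interpret M: module K AA by (rule AA_module)
  have c: "(\<Oplus>\<^bsub>AA\<^esub>j\<in>{..<n}. t (Suc j)) \<in> carrier AA" "(\<Oplus>\<^bsub>AA\<^esub>j\<in>{..<n}. t j) \<in> carrier AA"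
    using assms by (auto intro: M.finsum_closed)
  have "(\<Oplus>\<^bsub>AA\<^esub>j\<in>{..<Suc n}. t (Suc j)) \<oplus>\<^bsub>AA\<^esub> t 0 = t (Suc n) \<oplus>\<^bsub>AA\<^esub> ((\<Oplus>\<^bsub>AA\<^esub>j\<in>{..<n}. t (Suc j)) \<oplus>\<^bsub>AA\<^esub> t 0)"
    using assms c by (simp add: lessThan_Suc M.a_assoc)
  also have "\<dots> = (\<Oplus>\<^bsub>AA\<^esub>j\<in>{..<Suc n}. t j) \<oplus>\<^bsub>AA\<^esub> t (Suc n)"
    unfolding Suc.IH using assms c by (simp add: lessThan_Suc M.a_ac)
  finally show ?case .
qed

lemma mixed_lin: "lin K AA AA mixed"
  using mixed_lowers by (simp add: lowers_def)

lemma mixed_commute: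
  assumes z: "z \<in> carrier AA"
  shows "mixed (dL z) = dL (mixed z)" and "mixed (dR z) = dR (mixed z)"
proof -
  interpret M: module K AA by (rule AA_module)
  note cl = lin_closed[OF lin_funpow[OF dL_lin]] lin_closed[OF lin_funpow[OF dR_lin]]
    lin_closed[OF dL_lin] lin_closed[OF dR_lin]
  note fin = lin_of_finsum[OF AA_module AA_module _ finite_lessThan]
  have L: "dL ((dR ^^ j) u) = (dR ^^ j) (dL u)" if "u \<in> carrier AA" for j u
    by (rule funpow_commute[OF dL_lin dR_lin dL_dR_commute that])
  have R: "dR ((dL ^^ j) u) = (dL ^^ j) (dR u)" if "u \<in> carrier AA" for j u
    by (rule funpow_commute[OF dR_lin dL_lin dL_dR_commute[symmetric] that])
  show "mixed (dL z) = dL (mixed z)"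
    unfolding mixed_def fin[OF dL_lin cl(1)[OF cl(2)[OF z]]]
    using z cl by (intro M.finsum_cong') (auto simp flip: L funpow_swap1)
  show "mixed (dR z) = dR (mixed z)"
    unfolding mixed_def fin[OF dR_lin cl(1)[OF cl(2)[OF z]]]
    using z cl by (intro M.finsum_cong') (auto simp: R funpow_swap1)
qed

text \<open>
  With \<open>t j = \<delta>'\<^sub>L\<^bsup>s-j\<^esup> \<delta>'\<^sub>R\<^sup>j z\<close>, the two sides are the sums of \<open>t 0, \<dots>, t (s - 1)\<close> and of
  \<open>t 1, \<dots>, t s\<close>; both end terms \<open>t 0\<close> and \<open>t s\<close> vanish by nilpotency.
\<close>

lemma dL_mixed:
  assumes z: "z \<in> W n"
  shows "dL (mixed z) = dR (mixed z)"
proof -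
  interpret M: module K AA by (rule AA_module)
  note zc = W_carrier[OF z]
  note cl = lin_closed[OF lin_funpow[OF dL_lin]] lin_closed[OF lin_funpow[OF dR_lin]]
  note fin = lin_of_finsum[OF AA_module AA_module _ finite_lessThan]
  let ?t = "\<lambda>j. (dL ^^ (s - j)) ((dR ^^ j) z)"
  have tc: "?t j \<in> carrier AA" for j by (rule cl(1)[OF cl(2)[OF zc]])
  have t0: "?t 0 = \<zero>\<^bsub>AA\<^esub>" "?t s = \<zero>\<^bsub>AA\<^esub>"
    using s_complex_dL s_complex_dR z unfolding s_complex_of_bimodules_def by (simp_all add: C_simps)
  have "dL (mixed z) = (\<Oplus>\<^bsub>AA\<^esub>j\<in>{..<s}. ?t j)"
    unfolding mixed_def fin[OF dL_lin cl(1)[OF cl(2)[OF zc]]]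
  proof (intro M.finsum_cong')
    fix j assume "j \<in> {..<s}"
    then have "s - j = Suc (s - 1 - j)" by auto
    then show "dL ((dL ^^ (s - 1 - j)) ((dR ^^ j) z)) = ?t j" by simp
  qed (use tc in auto)
  also have "\<dots> = (\<Oplus>\<^bsub>AA\<^esub>j\<in>{..<s}. ?t (Suc j))"
  proof -
    have c: "(\<Oplus>\<^bsub>AA\<^esub>j\<in>{..<s}. ?t (Suc j)) \<in> carrier AA" "(\<Oplus>\<^bsub>AA\<^esub>j\<in>{..<s}. ?t j) \<in> carrier AA"
      using tc by (intro M.finsum_closed; simp add: Pi_def del: funpow.simps)+
    show ?thesis
      using telescope[of ?t s, OF tc, unfolded t0 M.r_zero[OF c(1)] M.r_zero[OF c(2)]] by (rule sym)
  qed
  also have "\<dots> = dR (mixed z)"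
    unfolding mixed_def fin[OF dR_lin cl(1)[OF cl(2)[OF zc]]]
  proof (intro M.finsum_cong')
    fix j assume "j \<in> {..<s}"
    have "dR ((dL ^^ (s - 1 - j)) ((dR ^^ j) z)) = (dL ^^ (s - 1 - j)) (dR ((dR ^^ j) z))"
      by (rule funpow_commute[OF dR_lin dL_lin dL_dR_commute[symmetric] cl(2)[OF zc]])
    then show "?t (Suc j) = dR ((dL ^^ (s - 1 - j)) ((dR ^^ j) z))" by simp
  qed (use cl[OF cl(1)[OF cl(2)[OF zc]]] lin_closed[OF dR_lin cl(1)[OF cl(2)[OF zc]]] in auto)
  finally show ?thesis .
qed

lemma dK_dK:
  assumes z: "z \<in> W n"
  shows "dK i (dK (Suc i) z) = \<zero>\<^bsub>AA\<^esub>"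
proof -
  note zc = W_carrier[OF z]
  note mc = lin_closed[OF mixed_lin zc] and lc = lin_closed[OF dL_lin zc] and rc = lin_closed[OF dR_lin zc]
  have "dL (mixed z) \<ominus>\<^bsub>AA\<^esub> dR (mixed z) = \<zero>\<^bsub>AA\<^esub>"
    using diff_eq_zero_iff[OF AA_module lin_closed[OF dL_lin mc] lin_closed[OF dR_lin mc]] dL_mixed[OF z] by simp
  moreover have "mixed (dL z \<ominus>\<^bsub>AA\<^esub> dR z) = dL (mixed z) \<ominus>\<^bsub>AA\<^esub> dR (mixed z)"
    using lin_minus[OF AA_module AA_module mixed_lin lc rc] mixed_commute[OF zc] by simp
  ultimately show ?thesis by (cases "odd i") (simp_all add: dK_odd dK_even)
qed

end

theorem mainTheorem1:
  fixes K :: "'k ring" and V :: "('k, 'v) module" and s :: nat and R :: "('k, 'v) talg set"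
  assumes "field K" and "module K V" and "s \<ge> 2"
    and "submodule R K (tensor_algebra K V)" and "R \<subseteq> tpow K V s"
  shows
    "let A = hom_algebra K V R; Ad = hom_algebra_deg K V R;
         \<delta>L = \<delta>'_L K V R; \<delta>R = \<delta>'_R K V R;
         C = K_LR K V s R;
         KK = (\<lambda>i. K_LR K V s R (ndeg s i)); G = (\<lambda>i. K_LR_deg K V s R (ndeg s i));
         d = d' K V s R
     in s_complex_of_bimodules K A s C \<delta>L \<and>
        s_complex_of_bimodules K A s C \<delta>R \<and>
        (\<forall>n. \<forall>x\<in>carrier (C n). \<delta>L (\<delta>R x) = \<delta>R (\<delta>L x)) \<and>
        (\<forall>i. graded_bimodule K A Ad (KK i) (G i) \<and>
             projective_bimodule TYPE('m) TYPE('n) K A (KK i) \<and>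
             graded_projective_bimodule TYPE('m) TYPE('n) K A Ad (KK i) (G i) \<and>
             generated_in_degree K A (KK i) (G i) (int (ndeg s i))) \<and>
        (\<forall>i\<ge>1. d i \<in> bimod_hom K A (KK i) (KK (i - 1)) \<and> degree_zero (d i) (G i) (G (i - 1))) \<and>
        (\<forall>i\<ge>1. \<forall>x\<in>carrier (KK (i + 1)). d i (d (i + 1) x) = \<zero>\<^bsub>KK (i - 1)\<^esub>)"
proof -
  interpret koszul K V s R
    by (intro koszul.intro tensor_alg.intro koszul_axioms.intro) (use assms in auto)
  have "dK i \<in> bimod_hom K A (C (ndeg s i)) (C (ndeg s (i - 1))) \<and>
      degree_zero (dK i) (G (ndeg s i)) (G (ndeg s (i - 1)))" if "i \<ge> 1" for i
    using lowers_bimod_hom[OF dK_lowers, of i "ndeg s (i - 1)"] lowers_degree_zero[OF dK_lowers, of i "ndeg s (i - 1)"]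
    by (simp only: ndeg_step[OF that])
  moreover have "dL (dR x) = dR (dL x)" if "x \<in> carrier (C n)" for n x
    using that dL_dR_commute[OF W_carrier] by (simp add: C_simps)
  moreover have "dK i (dK (i + 1) x) = \<zero>\<^bsub>C (ndeg s (i - 1))\<^esub>" if "x \<in> carrier (C (ndeg s (i + 1)))" for i x
    using dK_dK that by (simp add: C_simps)
  ultimately show ?thesis
    unfolding Let_def
    using s_complex_dL s_complex_dR C_graded C_projective C_graded_projective C_generated by blast
qed

end
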